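(* Let $\zeta$ be a primitive aperiodic substitution on $\mathcal A=\{1,\ldots,m\}$, with substitution matrix $\mathsf S$. Suppose that the characteristic polynomial of $\mathsf S$ is irreducible (over $\mathbb Q$) and that the second eigenvalue $\theta_2$ of $\mathsf S$ (eigenvalues ordered by decreasing absolute value) satisfies $|\theta_2|>1$. Then there exists a constant $\gamma>0$, depending only on the substitution $\zeta$, such that for Lebesgue-almost every $\vec s\in\Delta^{m-1}$ and every $B>1$ there exist $r_0=r_0(\vec s,B)>0$ and $C=C(\vec s,B)>0$ such that the spectral measures $\sigma_a$ of the suspension flow $(\mathfrak X_\zeta^{\vec s},h_t)$ satisfy $$\sigma_a([\omega-r,\omega+r])\le C r^{\gamma}\quad\text{for all } |\omega|\in[B^{-1},B],\ 0<r\le r_0,\ a\in\mathcal A.$$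
   Context: Let $m\ge2$, $\mathcal A=\{1,\dots,m\}$, and let $\mathcal A^+$ be the set of nonempty finite words over $\mathcal A$. A substitution is a map $\zeta:\mathcal A\to\mathcal A^+$, extended to words and sequences by concatenation. The substitution matrix $\mathsf S$ is the $m\times m$ matrix with $\mathsf S(i,j)$ = number of symbols $i$ in $\zeta(j)$; $\zeta$ is primitive if some power $\mathsf S^n$ is entrywise strictly positive. $X_\zeta\subset\mathcal A^{\mathbb Z}$ is the set of bi-infinite sequences all of whose finite subwords occur as subwords of $\zeta^n(a)$ for some $a\in\mathcal A$, $n\in\mathbb N$; $T_\zeta$ is the left shift on $X_\zeta$. For primitive $\zeta$, aperiodic means $X_\zeta$ is infinite; $(X_\zeta,T_\zeta)$ is uniquely ergodic. For a strictly positive vector $\vec s=(s_1,\dots,s_m)$, the suspension flow $(\mathfrak X_\zeta^{\vec s},h_t)$ is the unit-speed vertical flow over $T_\zeta$ under the roof function equal to $s_j$ on $\{x\in X_\zeta:x_0=j\}$; thus $\mathfrak X_\zeta^{\vec s}=\{(x,t):x\in X_\zeta,\ 0\le t\le s_{x_0}\}$ with $(x,s_{x_0})$ identified with $(T_\zeta x,0)$. Let $\widetilde\mu$ be its unique invariant probability measure. For $a\in\mathcal A$ let $\mathfrak X_a=\{(x,t):x\in X_\zeta,\ x_0=a,\ 0\le t\le s_a\}$. For $f\in L^2(\mathfrak X_\zeta^{\vec s},\widetilde\mu)$ the spectral measure $\sigma_f$ is the finite positive Borel measure on $\mathbb R$ with $\int_{\mathbb R}e^{2\pi i\omega t}\,d\sigma_f(\omega)=\langle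 f\circ h_t,f\rangle$ for all $t\in\mathbb R$; $\sigma_a:=\sigma_f$ for $f=\mathbf 1_{\mathfrak X_a}$. $\Delta^{m-1}$ is the set of vectors in $\mathbb R^m$ with positive entries summing to $1$; "Lebesgue-almost every" refers to $(m-1)$-dimensional Lebesgue measure on $\Delta^{m-1}$. *)

theory Defs
  imports
    "HOL-Probability.Probability"
    "HOL-Library.Sublist"
    "Jordan_Normal_Form.Char_Poly"
begin

text \<open>The alphabet with \<open>m\<close> letters is \<open>{..<m}\<close>, so that letters are matrix indices.
  Values of \<open>\<zeta>\<close> outside the alphabet are irrelevant.\<close>

definition substitution :: "nat \<Rightarrow> (nat \<Rightarrow> nat list) \<Rightarrow> bool" where
  "substitution m \<zeta> \<longleftrightarrow> (\<forall>a<m. \<zeta> a \<noteq> [] \<and> set (\<zeta> a) \<subseteq> {..<m})"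

definition subst_word :: "(nat \<Rightarrow> nat list) \<Rightarrow> nat list \<Rightarrow> nat list" where
  "subst_word \<zeta> w = concat (map \<zeta> w)"

definition subst_matrix :: "nat \<Rightarrow> (nat \<Rightarrow> nat list) \<Rightarrow> int mat" where
  "subst_matrix m \<zeta> = mat m m (\<lambda>(i, j). int (count_list (\<zeta> j) i))"

definition primitive_subst :: "nat \<Rightarrow> (nat \<Rightarrow> nat list) \<Rightarrow> bool" where
  "primitive_subst m \<zeta> \<longleftrightarrow>
     (\<exists>n\<ge>1. \<forall>i<m. \<forall>j<m. 0 < (subst_matrix m \<zeta> ^\<^sub>m n) $$ (i, j))"

definition subst_space :: "nat \<Rightarrow> (nat \<Rightarrow> nat list) \<Rightarrow> (int \<Rightarrow> nat) set" where
  "subst_space m \<zeta> =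
     {x. \<forall>i l. \<exists>a<m. \<exists>n.
        sublist (map (\<lambda>k. x (i + int k)) [0..<l]) ((subst_word \<zeta> ^^ n) [a])}"

definition aperiodic_subst :: "nat \<Rightarrow> (nat \<Rightarrow> nat list) \<Rightarrow> bool" where
  "aperiodic_subst m \<zeta> \<longleftrightarrow> infinite (subst_space m \<zeta>)"

definition shift :: "int \<Rightarrow> (int \<Rightarrow> nat) \<Rightarrow> int \<Rightarrow> nat" where
  "shift n x = (\<lambda>i. x (i + n))"

text \<open>\<open>\<theta>\<close> lists the eigenvalues with algebraic multiplicity, in an order of decreasing modulus.\<close>

definition ordered_eigenvalues :: "complex mat \<Rightarrow> complex list \<Rightarrow> bool" where
  "ordered_eigenvalues A \<theta> \<longleftrightarrow>
     char_poly A = (\<Prod>e\<leftarrow>\<theta>. [:- e, 1:]) \<and> sorted_wrt (\<lambda>x y. cmod x \<ge> cmod y) \<theta>"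

text \<open>Birkhoff sum of the roof function \<open>x \<mapsto> s (x 0)\<close> over \<open>n\<close> steps of the shift; for
  \<open>n < 0\<close> the second sum is the one that contributes.\<close>

definition roof_sum :: "(nat \<Rightarrow> real) \<Rightarrow> (int \<Rightarrow> nat) \<Rightarrow> int \<Rightarrow> real" where
  "roof_sum s x n = (\<Sum>i\<in>{0..<n}. s (x i)) - (\<Sum>i\<in>{n..<0}. s (x i))"

text \<open>The identification of \<open>(x, s (x 0))\<close> with \<open>(shift 1 x, 0)\<close> is realised by choosing in each
  class the representative \<open>(y, u)\<close> with \<open>0 \<le> u < s (y 0)\<close>: \<open>susp_rep s (x, t)\<close> is the
  representative of the point reached from \<open>(x, 0)\<close> after time \<open>t\<close>, for any real \<open>t\<close>. The
  suspension is thus a subset of the product space \<open>(int \<Rightarrow> nat) \<times> real\<close>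
  (product topology, discrete letters), and carries the trace of its Borel sets; these correspond
  to the Borel sets of the quotient topology.\<close>

definition susp_rep :: "(nat \<Rightarrow> real) \<Rightarrow> (int \<Rightarrow> nat) \<times> real \<Rightarrow> (int \<Rightarrow> nat) \<times> real" where
  "susp_rep s = (\<lambda>(x, t).
     let n = (THE n. roof_sum s x n \<le> t \<and> t < roof_sum s x (n + 1))
     in (shift n x, t - roof_sum s x n))"

definition suspension ::
  "nat \<Rightarrow> (nat \<Rightarrow> nat list) \<Rightarrow> (nat \<Rightarrow> real) \<Rightarrow> ((int \<Rightarrow> nat) \<times> real) set" where
  "suspension m \<zeta> s =
     susp_rep s ` {(x, t). x \<in> subst_space m \<zeta> \<and> 0 \<le> t \<and> t \<le> s (x 0)}"

definition susp_cylinder ::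
  "nat \<Rightarrow> (nat \<Rightarrow> nat list) \<Rightarrow> (nat \<Rightarrow> real) \<Rightarrow> nat \<Rightarrow> ((int \<Rightarrow> nat) \<times> real) set" where
  "susp_cylinder m \<zeta> s a =
     susp_rep s ` {(x, t). x \<in> subst_space m \<zeta> \<and> x 0 = a \<and> 0 \<le> t \<and> t \<le> s a}"

definition susp_flow ::
  "(nat \<Rightarrow> real) \<Rightarrow> real \<Rightarrow> (int \<Rightarrow> nat) \<times> real \<Rightarrow> (int \<Rightarrow> nat) \<times> real" where
  "susp_flow s \<tau> = (\<lambda>(x, t). susp_rep s (x, t + \<tau>))"

definition invariant_prob ::
  "nat \<Rightarrow> (nat \<Rightarrow> nat list) \<Rightarrow> (nat \<Rightarrow> real) \<Rightarrow> ((int \<Rightarrow> nat) \<times> real) measure \<Rightarrow> bool" where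
  "invariant_prob m \<zeta> s \<mu> \<longleftrightarrow>
     prob_space \<mu> \<and> sets \<mu> = sets (restrict_space borel (suspension m \<zeta> s)) \<and>
     (\<forall>t. susp_flow s t \<in> \<mu> \<rightarrow>\<^sub>M \<mu> \<and> distr \<mu> \<mu> (susp_flow s t) = \<mu>)"

definition is_spectral_measure ::
  "'a measure \<Rightarrow> (real \<Rightarrow> 'a \<Rightarrow> 'a) \<Rightarrow> ('a \<Rightarrow> complex) \<Rightarrow> real measure \<Rightarrow> bool" where
  "is_spectral_measure \<mu> h f \<sigma> \<longleftrightarrow>
     finite_measure \<sigma> \<and> sets \<sigma> = sets borel \<and>
     (\<forall>t. (LINT \<omega>|\<sigma>. cis (2 * pi * \<omega> * t)) = (LINT z|\<mu>. f (h t z) * cnj (f z)))"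

definition open_simplex :: "nat \<Rightarrow> (nat \<Rightarrow> real) set" where
  "open_simplex m = {s \<in> {..<m} \<rightarrow>\<^sub>E {0<..}. (\<Sum>i<m. s i) = 1}"

text \<open>Up to the constant factor \<open>sqrt m\<close>, this is \<open>(m - 1)\<close>-dimensional Lebesgue measure on the
  simplex, parametrised by the first \<open>m - 1\<close> coordinates; the null sets are the same.\<close>

definition simplex_lebesgue :: "nat \<Rightarrow> (nat \<Rightarrow> real) measure" where
  "simplex_lebesgue m =
     distr
       (restrict_space (\<Pi>\<^sub>M i\<in>{..<m - 1}. lborel) {u. (\<forall>i<m - 1. 0 < u i) \<and> (\<Sum>i<m - 1. u i) < 1})
       (restrict_space (\<Pi>\<^sub>M i\<in>{..<m}. borel) (open_simplex m))
       (\<lambda>u. u(m - 1 := 1 - (\<Sum>i<m - 1. u i)))"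

end

theory Submission
  imports Defs "HOL-Computational_Algebra.Field_as_Ring"
begin

text \<open>The spectral measure of an interval of radius \<open>r\<close> around \<open>\<omega>\<close> is controlled by exponential sums of
  length \<open>1 / r\<close> along orbits, hence by the twisted sums of the words \<open>\<zeta>\<^sup>k b\<close>. Fix a word
  \<open>v\<close> such that \<open>v\<close> followed by its first letter occurs in \<open>\<zeta>\<^sup>P b\<close> for every letter \<open>b\<close>. Each time
  \<open>x\<^sub>n = \<omega> \<bar>\<zeta>\<^sup>n v\<bar>\<^sub>s\<close> is far from the integers, the normalised twisted sums shrink by a constant factor,
  so it suffices that this happens for a positive proportion of the \<open>n\<close>, for almost every \<open>s\<close> and
  all \<open>\<omega>\<close>. This is an Erdos-Kahane argument: \<open>x\<^sub>n\<close> satisfies the integer recurrence given by the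
  characteristic polynomial, so if \<open>x\<^sub>n\<close> is close to an integer for most \<open>n < N\<close>, then the sequence of
  nearest integers is one of few codes. By irreducibility each code determines the ratio of two
  independent eigenfunctionals of \<open>s\<close> up to \<open>O(\<bar>\<theta>\<^sub>2\<bar>\<^sup>-\<^sup>N)\<close>; the ratio does not see
  \<open>\<omega>\<close>, and Borel-Cantelli applies because \<open>\<bar>\<theta>\<^sub>2\<bar> > 1\<close>.\<close>

section \<open>Twisted sums along substitution words\<close>

text \<open>The estimate has to hold for all frequencies in a range, while the exceptional set of
  \<open>s\<close> may not depend on \<omega>. Coding the multiples of \<open>s\<close> by \<omega>
  leaves one free scale; dividing the two eigenfunctionals removes it, so that each code confines
  \<open>s\<close> to one slab of width of order \<open>1 / cmod \<theta>2 ^ N\<close>. Lowering the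
  permitted proportion of indices far from the integers brings the growth rate of the number of
  codes as close to 1 as desired, hence below \<open>cmod \<theta>2\<close>. For the slabs to have
  small measure, the independence of the functionals must be quantitative and uniform over all
  values of the ratio. The exponent comes from a balance of scales. The flow is sampled with time
  step \<open>r\<close> over a time of order \<open>1 / r\<close>, which replaces orbit integrals by
  finite sums. If inflation lengthens words by a factor of at most \<Lambda>, then levels with
  \<open>\<Lambda> ^ k\<close> up to \<open>r powr (- (1 / 2))\<close> leave end pieces that are
  small against \<open>1 / r\<close>, and the contraction gathered over these levels is a power of
  \<open>r\<close>.\<close>

fun twisted_sum :: "real \<Rightarrow> (nat \<Rightarrow> real) \<Rightarrow> nat \<Rightarrow> nat list \<Rightarrow> complex" where
  "twisted_sum \<omega> s a [] = 0"
| "twisted_sum \<omega> s a (b # w) =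
    (if b = a then 1 else 0) + cis (- (2 * pi * \<omega> * s b)) * twisted_sum \<omega> s a w"

definition weight :: "(nat \<Rightarrow> real) \<Rightarrow> nat list \<Rightarrow> real" where
  "weight s w = sum_list (map s w)"

lemma weight_simps [simp]:
  "weight s [] = 0" "weight s (b # w) = s b + weight s w" "weight s (u @ w) = weight s u + weight s w"
  by (simp_all add: weight_def)

text \<open>Unfolding the recursion, an occurrence of \<open>a\<close> carries the phase
  \<open>- 2 * pi * \<omega>\<close> times the weight of the prefix in front of it, i.e. times the
  time at which the flow reaches that letter. Hence appending \<open>w\<close> to \<open>u\<close>
  delays all of \<open>w\<close> by the weight of \<open>u\<close>.\<close>

lemma twisted_sum_append:
  "twisted_sum \<omega> s a (u @ w) =
     twisted_sum \<omega> s a u + cis (- (2 * pi * \<omega> * weight s u)) * twisted_sum \<omega> s a w"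
proof (induction u)
  case (Cons b u)
  have "cis (- (2 * pi * \<omega> * weight s (b # u))) =
      cis (- (2 * pi * \<omega> * s b)) * cis (- (2 * pi * \<omega> * weight s u))"
    by (simp add: cis_mult distrib_left)
  then show ?case using Cons by (simp add: distrib_left mult.assoc)
qed simp

lemma norm_twisted_sum_append_le:
  "cmod (twisted_sum \<omega> s a (u @ w)) \<le> cmod (twisted_sum \<omega> s a u) + cmod (twisted_sum \<omega> s a w)"
  unfolding twisted_sum_append by (rule order_trans[OF norm_triangle_ineq]) (simp add: norm_mult)

lemma norm_twisted_sum_le: "cmod (twisted_sum \<omega> s a w) \<le> length w"
proof (induction w)
  case (Cons b w)
  have "cmod (twisted_sum \<omega> s a (b # w)) \<le> 1 + cmod (twisted_sum \<omega> s a w)"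
    by (simp only: twisted_sum.simps, rule order_trans[OF norm_triangle_ineq]) (simp add: norm_mult)
  then show ?case using Cons by simp
qed simp

lemma norm_one_plus_cis: "cmod (1 + cis t) = sqrt (2 + 2 * cos t)"
proof -
  have "(cmod (1 + cis t))\<^sup>2 = 2 + 2 * cos t"
    using sin_cos_squared_add[of t] unfolding cmod_power2 by (simp add: power2_sum)
  then show ?thesis using real_sqrt_unique[of "cmod (1 + cis t)"] by simp
qed

text \<open>The distance of \<open>y\<close> to the nearest integer is at most 1/2, so the angle
  \<open>2 * pi * d\<close> lies where the cosine decreases.\<close>

lemma norm_one_plus_cis_le:
  assumes "0 < \<rho>" "\<rho> \<le> \<bar>y - of_int (round y)\<bar>"
  shows "cmod (1 + cis (- (2 * pi * y))) \<le> sqrt (2 + 2 * cos (2 * pi * \<rho>))"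
proof -
  define d where "d = \<bar>y - of_int (round y)\<bar>"
  have "d \<le> 1 / 2"
    using of_int_round_abs_le[of y] by (simp add: d_def abs_minus_commute)
  have "cos (2 * pi * y) = cos (2 * pi * (y - of_int (round y)))"
    using cos_int_2pin[of "round y"] sin_int_2pin[of "round y"]
    by (simp add: right_diff_distrib cos_diff)
  also have "\<dots> = cos (2 * pi * d)"
  proof -
    have "2 * pi * d = \<bar>2 * pi * (y - of_int (round y))\<bar>"
      by (simp add: d_def abs_mult)
    then show ?thesis by (simp only: cos_abs_real)
  qed
  also have "\<dots> \<le> cos (2 * pi * \<rho>)"
    using assms \<open>d \<le> 1 / 2\<close> by (intro cos_monotone_0_pi_le) (auto simp: d_def)
  finally show ?thesis by (simp add: norm_one_plus_cis)
qed

section \<open>Iterated substitution and factors of concatenations\<close>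

abbreviation iter :: "(nat \<Rightarrow> nat list) \<Rightarrow> nat \<Rightarrow> nat list \<Rightarrow> nat list" where
  "iter \<zeta> k \<equiv> subst_word \<zeta> ^^ k"

lemma subst_word_simps [simp]:
  "subst_word \<zeta> [] = []" "subst_word \<zeta> (b # w) = \<zeta> b @ subst_word \<zeta> w"
  "subst_word \<zeta> (u @ w) = subst_word \<zeta> u @ subst_word \<zeta> w"
  by (simp_all add: subst_word_def)

lemma iter_Nil [simp]: "iter \<zeta> k [] = []"
  by (induction k) auto

lemma iter_append [simp]: "iter \<zeta> k (u @ w) = iter \<zeta> k u @ iter \<zeta> k w"
  by (induction k) auto

lemma iter_Cons: "iter \<zeta> k (b # w) = iter \<zeta> k [b] @ iter \<zeta> k w"
  using iter_append[of k \<zeta> "[b]" w] by simp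

lemma iter_add: "iter \<zeta> (j + k) w = iter \<zeta> j (iter \<zeta> k w)"
  by (simp add: funpow_add)

lemma iter_concat: "iter \<zeta> k w = concat (map (\<lambda>b. iter \<zeta> k [b]) w)"
proof (induction w)
  case (Cons b w)
  then show ?case by (subst iter_Cons) simp
qed simp

lemma prefix_concat_split:
  assumes "prefix w (concat ws)" "\<And>x. x \<in> set ws \<Longrightarrow> length x \<le> L"
  shows "\<exists>us q. w = concat us @ q \<and> set us \<subseteq> set ws \<and> length q \<le> L"
  using assms
proof (induction ws arbitrary: w)
  case Nil
  then show ?case by (intro exI[of _ "[]"]) auto
next
  case (Cons x ws)
  from Cons.prems(1) consider "prefix w x" | w' where "w = x @ w'" "prefix w' (concat ws)"
    by (auto simp: prefix_append)
  then show ?case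
  proof cases
    case 1
    then show ?thesis
      using Cons.prems(2)[of x] prefix_length_le[OF 1]
      by (intro exI[of _ "[]"] exI[of _ w]) auto
  next
    case 2
    then obtain us q where "w' = concat us @ q" "set us \<subseteq> set ws" "length q \<le> L"
      using Cons.IH Cons.prems(2) by (metis list.set_intros(2))
    then show ?thesis
      using 2 by (intro exI[of _ "x # us"] exI[of _ q]) auto
  qed
qed

text \<open>A factor of a concatenation of short blocks consists of whole blocks apart from two
  ragged ends. A factor lying inside a single block is counted entirely as the left end.\<close>

lemma sublist_concat_split:
  assumes "sublist w (concat ws)" "\<And>x. x \<in> set ws \<Longrightarrow> length x \<le> L"
  shows "\<exists>p us q. w = p @ concat us @ q \<and> set us \<subseteq> set ws \<and> length p \<le> L \<and> length q \<le> L"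
  using assms
proof (induction ws)
  case Nil
  then show ?case by (intro exI[of _ "[]"]) auto
next
  case (Cons x ws)
  from Cons.prems(1) consider "sublist w x" | "sublist w (concat ws)"
    | p w' where "w = p @ w'" "suffix p x" "prefix w' (concat ws)"
    by (auto simp: sublist_append)
  then show ?case
  proof cases
    case 1
    then show ?thesis
      using Cons.prems(2)[of x] sublist_length_le[OF 1]
      by (intro exI[of _ w] exI[of _ "[]"]) auto
  next
    case 2
    then obtain p us q where "w = p @ concat us @ q" "set us \<subseteq> set ws" "length p \<le> L" "length q \<le> L"
      using Cons.IH Cons.prems(2) by (metis list.set_intros(2))
    then show ?thesis by (intro exI[of _ p] exI[of _ us] exI[of _ q]) auto
  next
    case 3
    then obtain us q where "w' = concat us @ q" "set us \<subseteq> set ws" "length q \<le> L"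
      using prefix_concat_split[of w' ws L] Cons.prems(2) by (metis list.set_intros(2))
    then show ?thesis
      using 3 Cons.prems(2)[of x] suffix_length_le[of p x]
      by (intro exI[of _ p] exI[of _ us] exI[of _ q]) auto
  qed
qed

lemma count_list_split:
  assumes "count_list w c \<ge> 2"
  obtains p v q where "w = p @ [c] @ v @ [c] @ q"
proof -
  have "c \<in> set w" using assms by (metis count_list_0_iff not_numeral_le_zero)
  then obtain p r where w: "w = p @ c # r" "c \<notin> set p" by (meson split_list_first)
  then have "c \<in> set r"
    using assms count_list_0_iff[of p c] count_list_0_iff[of r c] by auto
  then obtain v q where "r = v @ c # q" by (meson split_list)
  then show ?thesis using that w by simp
qed

context
  fixes m :: nat and \<zeta> :: "nat \<Rightarrow> nat list"
  assumes subst: "substitution m \<zeta>"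
begin

lemma iter_letters: "set w \<subseteq> {..<m} \<Longrightarrow> set (iter \<zeta> k w) \<subseteq> {..<m}"
proof (induction k)
  case (Suc k)
  then show ?case using subst by (auto simp: subst_word_def substitution_def)
qed auto

lemma iter_not_Nil: "w \<noteq> [] \<Longrightarrow> set w \<subseteq> {..<m} \<Longrightarrow> iter \<zeta> k w \<noteq> []"
proof (induction k)
  case (Suc k)
  then have "iter \<zeta> k w \<noteq> []" "set (iter \<zeta> k w) \<subseteq> {..<m}"
    using iter_letters[of w k] by auto
  then obtain c u where "iter \<zeta> k w = c # u" "c < m" by (cases "iter \<zeta> k w") auto
  then show ?case using subst by (auto simp: substitution_def)
qed auto

lemma iter_letter_length_pos: "b < m \<Longrightarrow> length (iter \<zeta> k [b]) > 0"
  using iter_not_Nil[of "[b]" k] by simp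

lemma length_subst_word_le:
  assumes "\<And>b. b < m \<Longrightarrow> length (\<zeta> b) \<le> \<Lambda>" "set w \<subseteq> {..<m}"
  shows "length (subst_word \<zeta> w) \<le> \<Lambda> * length w"
  using assms(2)
proof (induction w)
  case (Cons b w)
  then show ?case using assms(1)[of b] by simp
qed simp

lemma length_iter_le:
  assumes "\<And>b. b < m \<Longrightarrow> length (\<zeta> b) \<le> \<Lambda>" "set w \<subseteq> {..<m}"
  shows "length (iter \<zeta> k w) \<le> \<Lambda> ^ k * length w"
proof (induction k)
  case (Suc k)
  have "length (iter \<zeta> (Suc k) w) \<le> \<Lambda> * length (iter \<zeta> k w)"
    using length_subst_word_le[OF assms(1) iter_letters[OF assms(2)]] by simp
  also have "\<dots> \<le> \<Lambda> * (\<Lambda> ^ k * length w)"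
    using Suc by simp
  finally show ?case by (simp add: mult.assoc)
qed simp

lemma count_list_iter:
  "set w \<subseteq> {..<m} \<Longrightarrow>
   count_list (iter \<zeta> k w) i = (\<Sum>l<m. count_list w l * count_list (iter \<zeta> k [l]) i)"
proof (induction w)
  case (Cons b w)
  have "(\<Sum>l<m. count_list (b # w) l * count_list (iter \<zeta> k [l]) i) =
      (\<Sum>l<m. count_list w l * count_list (iter \<zeta> k [l]) i +
        (if l = b then count_list (iter \<zeta> k [l]) i else 0))"
    by (rule sum.cong) auto
  also have "\<dots> = count_list (iter \<zeta> k w) i + count_list (iter \<zeta> k [b]) i"
    using Cons by (simp add: sum.distrib)
  also have "\<dots> = count_list (iter \<zeta> k (b # w)) i"
    by (subst iter_Cons) simp
  finally show ?case by simp
qed simp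

lemma weight_eq_sum_count:
  "set w \<subseteq> {..<m} \<Longrightarrow> weight s w = (\<Sum>b<m. s b * count_list w b)"
proof (induction w)
  case (Cons c w)
  have "(\<Sum>b<m. s b * count_list (c # w) b) =
      (\<Sum>b<m. s b * count_list w b + (if b = c then s b else 0))"
    by (rule sum.cong) (auto simp: algebra_simps)
  then show ?case using Cons by (simp add: sum.distrib)
qed simp

lemma count_list_iter_Suc:
  assumes "set w \<subseteq> {..<m}" "b < m"
  shows "int (count_list (iter \<zeta> (Suc k) w) b) =
    (\<Sum>d<m. subst_matrix m \<zeta> $$ (b, d) * int (count_list (iter \<zeta> k w) d))"
  using count_list_iter[OF iter_letters[OF assms(1), of k], of 1 b] assms(2)
  by (simp add: subst_matrix_def mult.commute)

lemma subst_matrix_pow: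
  assumes "i < m" "j < m"
  shows "(subst_matrix m \<zeta> ^\<^sub>m n) $$ (i, j) = int (count_list (iter \<zeta> n [j]) i)"
  using assms
proof (induction n arbitrary: i j)
  case (Suc n)
  have S: "subst_matrix m \<zeta> \<in> carrier_mat m m" by (simp add: subst_matrix_def)
  have "(subst_matrix m \<zeta> ^\<^sub>m Suc n) $$ (i, j) =
      (\<Sum>l<m. (subst_matrix m \<zeta> ^\<^sub>m n) $$ (i, l) * subst_matrix m \<zeta> $$ (l, j))"
    using Suc.prems S by (simp add: scalar_prod_def lessThan_atLeast0)
  also have "\<dots> = (\<Sum>l<m. int (count_list (iter \<zeta> n [l]) i) * int (count_list (\<zeta> j) l))"
    using Suc by (intro sum.cong) (auto simp: subst_matrix_def)
  also have "\<dots> = int (count_list (iter \<zeta> n (\<zeta> j)) i)"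
    using subst Suc.prems by (subst count_list_iter) (auto simp: substitution_def mult.commute)
  finally show ?case by (simp add: funpow_Suc_right del: funpow.simps)
qed (auto simp: subst_matrix_def)

section \<open>Consequences of primitivity\<close>

lemma primitive_all_letters:
  assumes "primitive_subst m \<zeta>"
  obtains P where "\<And>b d. b < m \<Longrightarrow> d < m \<Longrightarrow> b \<in> set (iter \<zeta> P [d])"
proof -
  obtain n where n: "0 < (subst_matrix m \<zeta> ^\<^sub>m n) $$ (i, j)" if "i < m" "j < m" for i j
    using assms unfolding primitive_subst_def by blast
  have "b \<in> set (iter \<zeta> n [d])" if "b < m" "d < m" for b d
  proof -
    have "count_list (iter \<zeta> n [d]) b \<noteq> 0"
      using n[OF that] subst_matrix_pow[OF that, of n] by linarith
    then show ?thesis by (simp add: count_list_0_iff)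
  qed
  then show ?thesis by (rule that)
qed

text \<open>The same gap word between two equal letters must occur in every inflated letter. In
  \<open>iter \<zeta> (P + P) [0]\<close> the letter 0 arises both through an intermediate 0 and
  through an intermediate 1, hence at least twice; another \<open>P\<close> steps put a copy of that
  word into the image of every letter.\<close>

lemma return_word:
  assumes "m \<ge> 2" "primitive_subst m \<zeta>"
  obtains v P where "set v \<subseteq> {..<m}" "P \<ge> 1"
    "\<And>b. b < m \<Longrightarrow> \<exists>p q. iter \<zeta> P [b] = p @ [0] @ v @ [0] @ q"
proof -
  obtain P where P: "\<And>b d. b < m \<Longrightarrow> d < m \<Longrightarrow> b \<in> set (iter \<zeta> P [d])"
    using primitive_all_letters[OF assms(2)] by blast
  \<comment> \<open>For \<open>P = 0\<close> the iterate of \<open>[1]\<close> would be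
    \<open>[1]\<close> itself, which does not contain 0.\<close>
  have "P \<noteq> 0"
    using P[of 0 1] assms(1) by (intro notI) auto
  have "0 \<in> set (iter \<zeta> P [0])" "1 \<in> set (iter \<zeta> P [0])"
    using P assms(1) by auto
  then have c: "count_list (iter \<zeta> P [0]) 0 \<ge> 1" "count_list (iter \<zeta> P [0]) 1 \<ge> 1"
    by (metis count_list_0_iff less_one not_le)+
  have "0 \<in> set (iter \<zeta> P [1])"
    using P assms(1) by auto
  then have c': "count_list (iter \<zeta> P [1]) 0 \<ge> 1"
    by (metis count_list_0_iff less_one not_le)
  have "count_list (iter \<zeta> (P + P) [0]) 0 =
      (\<Sum>l<m. count_list (iter \<zeta> P [0]) l * count_list (iter \<zeta> P [l]) 0)"
    using assms(1) by (simp only: iter_add, subst count_list_iter) (auto intro!: iter_letters)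
  also have "\<dots> \<ge> (\<Sum>l\<in>{0, 1}. count_list (iter \<zeta> P [0]) l * count_list (iter \<zeta> P [l]) 0)"
    using assms(1) by (intro sum_mono2) auto
  finally have "count_list (iter \<zeta> (P + P) [0]) 0 \<ge>
      count_list (iter \<zeta> P [0]) 0 * count_list (iter \<zeta> P [0]) 0 +
      count_list (iter \<zeta> P [0]) 1 * count_list (iter \<zeta> P [1]) 0"
    by simp
  moreover have "count_list (iter \<zeta> P [0]) 0 * count_list (iter \<zeta> P [0]) 0 \<ge> 1 * 1"
    "count_list (iter \<zeta> P [0]) 1 * count_list (iter \<zeta> P [1]) 0 \<ge> 1 * 1"
    using c c' by (intro mult_mono; simp)+
  ultimately have "count_list (iter \<zeta> (P + P) [0]) 0 \<ge> 2" by linarith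
  then obtain p v q where pvq: "iter \<zeta> (P + P) [0] = p @ [0] @ v @ [0] @ q"
    by (rule count_list_split)
  have "set (iter \<zeta> (P + P) [0]) \<subseteq> {..<m}"
    using assms(1) by (intro iter_letters) auto
  then have "set v \<subseteq> {..<m}"
    unfolding pvq by auto
  moreover have "\<exists>p q. iter \<zeta> (P + P + P) [b] = p @ [0] @ v @ [0] @ q" if b: "b < m" for b
  proof -
    obtain p1 q1 where "iter \<zeta> P [b] = p1 @ 0 # q1"
      using P[of 0 b] b assms(1) by (auto dest: split_list)
    then have "iter \<zeta> (P + P + P) [b] = iter \<zeta> (P + P) p1 @ iter \<zeta> (P + P) [0] @ iter \<zeta> (P + P) q1"
      by (subst iter_add) (simp add: iter_Cons[of "P + P" \<zeta> 0 q1])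
    then show ?thesis unfolding pvq by (metis append.assoc)
  qed
  ultimately show ?thesis
    using that[of v "P + P + P"] \<open>P \<noteq> 0\<close> by simp
qed

text \<open>By primitivity \<open>iter \<zeta> k [b]\<close> is a factor of
  \<open>iter \<zeta> (k + P) [c]\<close>. Reading the latter as \<open>P\<close> further
  substitutions of \<open>iter \<zeta> k [c]\<close> bounds its length by
  \<open>\<Lambda> ^ P\<close> times that word, independently of \<open>k\<close>.\<close>

lemma lengths_comparable:
  assumes "primitive_subst m \<zeta>"
  obtains K where "\<And>k b c. b < m \<Longrightarrow> c < m \<Longrightarrow> length (iter \<zeta> k [b]) \<le> K * length (iter \<zeta> k [c])"
proof -
  obtain P where P: "\<And>b d. b < m \<Longrightarrow> d < m \<Longrightarrow> b \<in> set (iter \<zeta> P [d])"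
    using primitive_all_letters[OF assms] by blast
  define \<Lambda> where "\<Lambda> = (\<Sum>b<m. length (\<zeta> b))"
  have \<Lambda>: "length (\<zeta> b) \<le> \<Lambda>" if "b < m" for b
    unfolding \<Lambda>_def using that by (intro member_le_sum) auto
  have "length (iter \<zeta> k [b]) \<le> \<Lambda> ^ P * length (iter \<zeta> k [c])" if bc: "b < m" "c < m" for k b c
  proof -
    obtain p q where "iter \<zeta> P [c] = p @ b # q"
      using P[OF bc] by (meson split_list)
    then have "iter \<zeta> (k + P) [c] = iter \<zeta> k p @ iter \<zeta> k [b] @ iter \<zeta> k q"
      by (subst iter_add) (simp add: iter_Cons[of k \<zeta> b q])
    then have "length (iter \<zeta> k [b]) \<le> length (iter \<zeta> (k + P) [c])" by simp
    also have "\<dots> = length (iter \<zeta> P (iter \<zeta> k [c]))"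
      by (simp only: add.commute[of k P] iter_add)
    also have "\<dots> \<le> \<Lambda> ^ P * length (iter \<zeta> k [c])"
      using bc by (intro length_iter_le \<Lambda> iter_letters) auto
    finally show ?thesis .
  qed
  then show ?thesis using that by blast
qed

section \<open>Normalised twisted sums and their contraction\<close>

definition sup_ratio :: "real \<Rightarrow> (nat \<Rightarrow> real) \<Rightarrow> nat \<Rightarrow> nat \<Rightarrow> real" where
  "sup_ratio \<omega> s a k =
     Max ((\<lambda>b. cmod (twisted_sum \<omega> s a (iter \<zeta> k [b])) / length (iter \<zeta> k [b])) ` {..<m})"

lemma norm_twisted_sum_letter_le:
  assumes "b < m"
  shows "cmod (twisted_sum \<omega> s a (iter \<zeta> k [b])) \<le> sup_ratio \<omega> s a k * length (iter \<zeta> k [b])"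
proof -
  have "cmod (twisted_sum \<omega> s a (iter \<zeta> k [b])) / length (iter \<zeta> k [b]) \<le> sup_ratio \<omega> s a k"
    unfolding sup_ratio_def using assms by (intro Max_ge) auto
  then show ?thesis
    using iter_letter_length_pos[OF assms, of k] by (simp add: field_simps)
qed

lemma sup_ratio_leI:
  fixes W :: real
  assumes "m > 0"
    "\<And>b. b < m \<Longrightarrow> cmod (twisted_sum \<omega> s a (iter \<zeta> k [b])) \<le> W * length (iter \<zeta> k [b])"
  shows "sup_ratio \<omega> s a k \<le> W"
  unfolding sup_ratio_def
proof (rule Max.boundedI)
  fix y assume "y \<in> (\<lambda>b. cmod (twisted_sum \<omega> s a (iter \<zeta> k [b])) / length (iter \<zeta> k [b])) ` {..<m}"
  then obtain b where b: "b < m" "y = cmod (twisted_sum \<omega> s a (iter \<zeta> k [b])) / length (iter \<zeta> k [b])"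
    by auto
  then show "y \<le> W"
    using assms(2)[of b] iter_letter_length_pos[of b k] by (simp add: pos_divide_le_eq)
qed (use assms(1) in auto)

lemma sup_ratio_nonneg:
  assumes "m > 0" shows "0 \<le> sup_ratio \<omega> s a k"
proof -
  have "0 \<le> cmod (twisted_sum \<omega> s a (iter \<zeta> k [0])) / length (iter \<zeta> k [0])" by simp
  also have "\<dots> \<le> sup_ratio \<omega> s a k"
    unfolding sup_ratio_def using assms by (intro Max_ge) auto
  finally show ?thesis .
qed

lemma sup_ratio_le_1: "m > 0 \<Longrightarrow> sup_ratio \<omega> s a k \<le> 1"
  by (rule sup_ratio_leI) (auto simp: norm_twisted_sum_le)

text \<open>Moduli of twisted sums are subadditive and lengths additive under concatenation, so a
  bound per unit length passes from inflated letters to all inflated words with the same constant.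
  This is the reason for dividing by the length.\<close>

lemma norm_twisted_sum_iter_le:
  "set w \<subseteq> {..<m} \<Longrightarrow>
   cmod (twisted_sum \<omega> s a (iter \<zeta> k w)) \<le> sup_ratio \<omega> s a k * length (iter \<zeta> k w)"
proof (induction w)
  case (Cons b w)
  have "cmod (twisted_sum \<omega> s a (iter \<zeta> k (b # w))) \<le>
      cmod (twisted_sum \<omega> s a (iter \<zeta> k [b])) + cmod (twisted_sum \<omega> s a (iter \<zeta> k w))"
    by (subst iter_Cons) (rule norm_twisted_sum_append_le)
  also have "\<dots> \<le> sup_ratio \<omega> s a k * length (iter \<zeta> k [b]) + sup_ratio \<omega> s a k * length (iter \<zeta> k w)"
    using Cons by (intro add_mono norm_twisted_sum_letter_le) auto
  also have "\<dots> = sup_ratio \<omega> s a k * length (iter \<zeta> k (b # w))"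
    by (subst iter_Cons[of k \<zeta> b w]) (simp add: distrib_left)
  finally show ?case .
qed simp

text \<open>A letter inflated \<open>k\<close> times is the word
  \<open>iter \<zeta> (k - j) [b]\<close> inflated \<open>j\<close> times.\<close>

lemma sup_ratio_antimono:
  assumes "m > 0" "j \<le> k" shows "sup_ratio \<omega> s a k \<le> sup_ratio \<omega> s a j"
proof (rule sup_ratio_leI[OF assms(1)])
  fix b assume b: "b < m"
  have "iter \<zeta> k [b] = iter \<zeta> j (iter \<zeta> (k - j) [b])"
    using assms(2) by (simp flip: iter_add)
  then show "cmod (twisted_sum \<omega> s a (iter \<zeta> k [b])) \<le> sup_ratio \<omega> s a j * length (iter \<zeta> k [b])"
    using norm_twisted_sum_iter_le[OF iter_letters[of "[b]" "k - j"], of \<omega> s a j] b by simp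
qed

text \<open>The two occurrences of the letter \<open>0\<close> around the return word contribute with a phase
  difference equal to the weight of the inflated return word, whence the gain.\<close>

lemma sup_ratio_gain:
  assumes m: "m > 0"
    and v: "set v \<subseteq> {..<m}" "\<And>b. b < m \<Longrightarrow> \<exists>p q. iter \<zeta> P [b] = p @ [0] @ v @ [0] @ q"
    and K: "K > 0" "\<And>k b. b < m \<Longrightarrow> length (iter \<zeta> (k + P) [b]) \<le> K * length (iter \<zeta> k [0])"
    and \<kappa>: "0 \<le> \<kappa>" "cmod (1 + cis (- (2 * pi * (\<omega> * weight s (iter \<zeta> k (0 # v)))))) \<le> 2 - \<kappa>"
  shows "sup_ratio \<omega> s a (k + P) \<le> sup_ratio \<omega> s a k * (1 - \<kappa> / K)"
proof (rule sup_ratio_leI[OF m])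
  fix b assume b: "b < m"
  let ?T = "\<lambda>w. twisted_sum \<omega> s a (iter \<zeta> k w)" and ?U = "sup_ratio \<omega> s a k"
    and ?l = "\<lambda>w. real (length (iter \<zeta> k w))"
    and ?e = "\<lambda>w. cis (- (2 * pi * \<omega> * weight s (iter \<zeta> k w)))"
  obtain p q where pq: "iter \<zeta> P [b] = p @ [0] @ v @ [0] @ q"
    using v(2)[OF b] by blast
  have "set (iter \<zeta> P [b]) \<subseteq> {..<m}"
    using b by (intro iter_letters) auto
  then have letters: "set p \<subseteq> {..<m}" "set q \<subseteq> {..<m}"
    unfolding pq by auto
  have *: "iter \<zeta> (k + P) [b] = iter \<zeta> k p @ iter \<zeta> k [0] @ iter \<zeta> k v @ iter \<zeta> k [0] @ iter \<zeta> k q"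
    by (simp only: iter_add pq iter_append)
  have e: "?e [0] * ?e v = ?e (0 # v)"
    by (subst iter_Cons[of k \<zeta> 0 v]) (simp add: cis_mult algebra_simps)
  have split: "twisted_sum \<omega> s a (iter \<zeta> (k + P) [b]) =
      ?T p + ?e p * ?e [0] * ?T v + ?e p * (1 + ?e [0] * ?e v) * ?T [0]
      + ?e p * ?e [0] * ?e v * ?e [0] * ?T q"
    unfolding * by (simp only: twisted_sum_append) (simp add: algebra_simps)
  have "cmod (twisted_sum \<omega> s a (iter \<zeta> (k + P) [b])) \<le> cmod (?T p) + cmod (?T v) + cmod (1 + ?e [0] * ?e v) * cmod (?T [0]) + cmod (?T q)"
  proof -
    have "cmod (x + y + z + w) \<le> cmod x + cmod y + cmod z + cmod w" for x y z w
      using norm_triangle_ineq[of "x + y + z" w] norm_triangle_ineq[of "x + y" z] norm_triangle_ineq[of x y]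
      by linarith
    from this[of "?T p" "?e p * ?e [0] * ?T v" "?e p * (1 + ?e [0] * ?e v) * ?T [0]"
        "?e p * ?e [0] * ?e v * ?e [0] * ?T q"]
    show ?thesis unfolding split by (simp only: norm_mult norm_cis mult_1_left)
  qed
  also have "\<dots> \<le> ?U * ?l p + ?U * ?l v + (2 - \<kappa>) * (?U * ?l [0]) + ?U * ?l q"
  proof -
    have 0: "0 \<le> 2 - \<kappa>"
      using order_trans[OF norm_ge_zero \<kappa>(2)] .
    have "cmod (1 + ?e [0] * ?e v) \<le> 2 - \<kappa>"
      unfolding e using \<kappa>(2) by (simp only: mult.assoc)
    then have "cmod (1 + ?e [0] * ?e v) * cmod (?T [0]) \<le> (2 - \<kappa>) * (?U * ?l [0])"
      by (rule mult_mono) (use m 0 in \<open>auto intro: norm_twisted_sum_iter_le\<close>)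
    moreover have "cmod (?T w) \<le> ?U * ?l w" if "set w \<subseteq> {..<m}" for w
      using that by (rule norm_twisted_sum_iter_le)
    ultimately show ?thesis
      using letters v(1) by (intro add_mono) auto
  qed
  also have "\<dots> = ?U * (?l p + ?l [0] + ?l v + ?l [0] + ?l q - \<kappa> * ?l [0])"
    by (simp add: algebra_simps)
  also have "?l p + ?l [0] + ?l v + ?l [0] + ?l q = real (length (iter \<zeta> (k + P) [b]))"
    unfolding * by simp
  \<comment> \<open>The pair of \<open>0\<close> blocks saves \<kappa> times the length of one
    block; \<open>K\<close> converts this into a fixed proportion of the whole length.\<close>
  also have "?U * (length (iter \<zeta> (k + P) [b]) - \<kappa> * ?l [0]) \<le>
      ?U * (length (iter \<zeta> (k + P) [b]) - \<kappa> * (length (iter \<zeta> (k + P) [b]) / K))"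
  proof -
    have "real (length (iter \<zeta> (k + P) [b])) / K \<le> ?l [0]"
      using of_nat_mono[OF K(2)[OF b, of k], where 'a = real] K(1) by (simp add: field_simps)
    then show ?thesis
      using \<kappa>(1) sup_ratio_nonneg[OF m, of \<omega> s a k] by (intro mult_left_mono diff_mono) auto
  qed
  also have "\<dots> = ?U * (1 - \<kappa> / K) * length (iter \<zeta> (k + P) [b])"
    by (simp add: algebra_simps)
  finally show "cmod (twisted_sum \<omega> s a (iter \<zeta> (k + P) [b])) \<le>
    ?U * (1 - \<kappa> / K) * length (iter \<zeta> (k + P) [b])" .
qed

text \<open>A gain at \<open>n\<close> compares the levels \<open>n\<close> and
  \<open>n + P\<close>, so gains fall into separate residue classes modulo \<open>P\<close>. The
  product of \<open>P\<close> consecutive values treats all classes at once: moving the window by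
  one replaces the value at \<open>k\<close> by the value at \<open>k + P\<close>, so every far
  index below \<open>k\<close> contributes one factor \<open>q\<close>. Monotonicity then bounds the
  \<open>P\<close>-th power of the value at \<open>k + P\<close> by the product.\<close>

lemma sup_ratio_power_le:
  assumes "m \<ge> 2" "primitive_subst m \<zeta>"
  obtains v P where "v \<noteq> []" "set v \<subseteq> {..<m}" "P \<ge> 1"
    "\<And>\<rho>. 0 < \<rho> \<Longrightarrow> \<rho> \<le> 1 / 2 \<Longrightarrow> \<exists>q. 0 < q \<and> q < 1 \<and> (\<forall>\<omega> s a k.
       sup_ratio \<omega> s a (k + P) ^ P \<le> q ^ card {n. n < k \<and>
         \<rho> \<le> \<bar>\<omega> * weight s (iter \<zeta> n v) - of_int (round (\<omega> * weight s (iter \<zeta> n v)))\<bar>})"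
proof -
  have m: "m > 0" using assms(1) by simp
  obtain v P where v: "set v \<subseteq> {..<m}" and P: "P \<ge> 1"
    and ret: "\<And>b. b < m \<Longrightarrow> \<exists>p q. iter \<zeta> P [b] = p @ [0] @ v @ [0] @ q"
    using return_word[OF assms] by blast
  obtain K0 where K0: "\<And>k b c. b < m \<Longrightarrow> c < m \<Longrightarrow> length (iter \<zeta> k [b]) \<le> K0 * length (iter \<zeta> k [c])"
    using lengths_comparable[OF assms(2)] by blast
  define \<Lambda> where "\<Lambda> = (\<Sum>b<m. length (\<zeta> b))"
  have \<Lambda>: "length (\<zeta> b) \<le> \<Lambda>" if "b < m" for b
    unfolding \<Lambda>_def using that by (intro member_le_sum) auto
  \<comment> \<open>The summand 3 keeps \<open>\<kappa> / K\<close> below 1 later on, where \<kappa>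
    is at most 2.\<close>
  define K where "K = \<Lambda> ^ P * K0 + 3"
  have K: "length (iter \<zeta> (k + P) [b]) \<le> K * length (iter \<zeta> k [0])" if "b < m" for k b
  proof -
    have "iter \<zeta> (k + P) [b] = iter \<zeta> P (iter \<zeta> k [b])"
      by (simp only: add.commute[of k P] iter_add)
    then have "length (iter \<zeta> (k + P) [b]) \<le> \<Lambda> ^ P * length (iter \<zeta> k [b])"
      using length_iter_le[OF \<Lambda> iter_letters[of "[b]" k], of P] that by simp
    also have "\<dots> \<le> \<Lambda> ^ P * (K0 * length (iter \<zeta> k [0]))"
      using K0[OF that m] by simp
    also have "\<dots> \<le> K * length (iter \<zeta> k [0])"
      by (simp add: K_def algebra_simps)
    finally show ?thesis .
  qed
  have "\<exists>q. 0 < q \<and> q < 1 \<and> (\<forall>\<omega> s a k. sup_ratio \<omega> s a (k + P) ^ P \<le> q ^ card {n. n < k \<and>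
      \<rho> \<le> \<bar>\<omega> * weight s (iter \<zeta> n (0 # v)) - of_int (round (\<omega> * weight s (iter \<zeta> n (0 # v))))\<bar>})"
    if \<rho>: "0 < \<rho>" "\<rho> \<le> 1 / 2" for \<rho> :: real
  proof -
    define \<kappa> where "\<kappa> = 2 - sqrt (2 + 2 * cos (2 * pi * \<rho>))"
    have "cos (2 * pi * \<rho>) < cos 0"
      using \<rho> by (intro cos_monotone_0_pi) auto
    then have "sqrt (2 + 2 * cos (2 * pi * \<rho>)) < sqrt 4"
      by (intro real_sqrt_less_mono) simp
    then have \<kappa>0: "\<kappa> > 0" by (simp add: \<kappa>_def)
    have "0 \<le> sqrt (2 + 2 * cos (2 * pi * \<rho>))"
      using cos_ge_minus_one[of "2 * pi * \<rho>"] by (intro real_sqrt_ge_zero) linarith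
    then have \<kappa>2: "\<kappa> \<le> 2" by (simp add: \<kappa>_def)
    define q where "q = 1 - \<kappa> / real K"
    have q: "0 < q" "q < 1"
    proof -
      have "real K \<ge> 3" by (simp add: K_def)
      then have "\<kappa> / real K < 1" "\<kappa> / real K > 0"
        using \<kappa>0 \<kappa>2 by (simp_all add: pos_divide_less_eq)
      then show "0 < q" "q < 1" by (simp_all add: q_def)
    qed
    define G where "G = (\<lambda>\<omega> s. {n. \<rho> \<le> \<bar>\<omega> * weight s (iter \<zeta> n (0 # v)) -
      of_int (round (\<omega> * weight s (iter \<zeta> n (0 # v))))\<bar>})"
    have gain: "sup_ratio \<omega> s a (n + P) \<le> sup_ratio \<omega> s a n * (if n \<in> G \<omega> s then q else 1)"
      for \<omega> s a n
    proof (cases "n \<in> G \<omega> s")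
      case True
      then have "cmod (1 + cis (- (2 * pi * (\<omega> * weight s (iter \<zeta> n (0 # v)))))) \<le> 2 - \<kappa>"
        unfolding \<kappa>_def G_def using norm_one_plus_cis_le[OF \<rho>(1)] by auto
      then have "sup_ratio \<omega> s a (n + P) \<le> sup_ratio \<omega> s a n * q"
        unfolding q_def using \<kappa>0 by (intro sup_ratio_gain[OF m v ret _ K]) (auto simp: K_def)
      then show ?thesis using True by simp
    next
      case False
      then show ?thesis using sup_ratio_antimono[OF m, of n "n + P"] by simp
    qed
    have prod: "(\<Prod>i<P. sup_ratio \<omega> s a (k + i)) \<le> q ^ card {n. n < k \<and> n \<in> G \<omega> s}" for \<omega> s a k
    proof (induction k)
      case 0
      show ?case
        using sup_ratio_le_1[OF m] sup_ratio_nonneg[OF m] by (auto intro!: prod_le_1)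
    next
      case (Suc k)
      let ?u = "sup_ratio \<omega> s a"
      obtain P' where P': "P = Suc P'" using P by (cases P) auto
      have card: "q ^ card {n. n < Suc k \<and> n \<in> G \<omega> s} =
          q ^ card {n. n < k \<and> n \<in> G \<omega> s} * (if k \<in> G \<omega> s then q else 1)"
      proof (cases "k \<in> G \<omega> s")
        case True
        then have "{n. n < Suc k \<and> n \<in> G \<omega> s} = insert k {n. n < k \<and> n \<in> G \<omega> s}"
          by (auto simp: less_Suc_eq)
        then show ?thesis using True by simp
      next
        case False
        then have "{n. n < Suc k \<and> n \<in> G \<omega> s} = {n. n < k \<and> n \<in> G \<omega> s}"
          by (auto simp: less_Suc_eq)
        then show ?thesis using False by simp
      qed
      have "(\<Prod>i<P. ?u (Suc k + i)) = (\<Prod>i<P'. ?u (Suc k + i)) * ?u (k + P)"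
        by (simp add: P')
      also have "\<dots> \<le> (\<Prod>i<P'. ?u (Suc k + i)) * (?u k * (if k \<in> G \<omega> s then q else 1))"
        by (intro mult_left_mono gain prod_nonneg) (simp add: sup_ratio_nonneg[OF m])
      also have "\<dots> = (\<Prod>i<P. ?u (k + i)) * (if k \<in> G \<omega> s then q else 1)"
        unfolding P' by (subst prod.lessThan_Suc_shift) simp
      also have "\<dots> \<le> q ^ card {n. n < k \<and> n \<in> G \<omega> s} * (if k \<in> G \<omega> s then q else 1)"
        using q by (intro mult_right_mono Suc.IH) auto
      finally show ?case unfolding card .
    qed
    have "sup_ratio \<omega> s a (k + P) ^ P \<le> q ^ card {n. n < k \<and> n \<in> G \<omega> s}" for \<omega> s a k
    proof -
      have "sup_ratio \<omega> s a (k + P) ^ P = (\<Prod>i<P. sup_ratio \<omega> s a (k + P))" by simp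
      also have "\<dots> \<le> (\<Prod>i<P. sup_ratio \<omega> s a (k + i))"
        using sup_ratio_antimono[OF m] sup_ratio_nonneg[OF m] by (intro prod_mono) auto
      finally show ?thesis using prod[of \<omega> s a k] by linarith
    qed
    then show ?thesis using q by (intro exI[of _ q]) (simp add: G_def)
  qed
  \<comment> \<open>The word handed over is \<open>0 # v\<close>: it is nonempty even when the gap
    \<open>v\<close> is empty, and its inflated weight is the delay between the two blocks.\<close>
  then show ?thesis
    using that[of "0 # v" P] v P m by auto
qed

text \<open>A factor of \<open>iter \<zeta> n [c]\<close> is cut along the blocks
  \<open>iter \<zeta> k [b]\<close>. Whole blocks are governed by \<open>sup_ratio\<close>; each of
  the two ends costs at most its length, bounded by \<open>\<Lambda> ^ k\<close>. For
  \<open>n < k\<close> the entire word is no longer than that.\<close>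

lemma norm_twisted_sum_factor_le:
  assumes x: "x \<in> subst_space m \<zeta>" and \<Lambda>: "\<And>b. b < m \<Longrightarrow> length (\<zeta> b) \<le> \<Lambda>" "\<Lambda> \<ge> 1"
  shows "cmod (twisted_sum \<omega> s a (map (\<lambda>j. x (i + int j)) [0..<l])) \<le>
    2 * real \<Lambda> ^ k + sup_ratio \<omega> s a k * l"
proof -
  define w where "w = map (\<lambda>j. x (i + int j)) [0..<l]"
  have lw: "length w = l" by (simp add: w_def)
  obtain c n where cn: "c < m" "sublist w (iter \<zeta> n [c])"
    using x unfolding subst_space_def w_def by blast
  have m: "m > 0" using cn by simp
  have len: "length (iter \<zeta> j [b]) \<le> \<Lambda> ^ j" if "b < m" for j b
    using length_iter_le[OF \<Lambda>(1), of "[b]" j] that by simp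
  show ?thesis
  proof (cases "k \<le> n")
    case True
    let ?ws = "map (\<lambda>b. iter \<zeta> k [b]) (iter \<zeta> (n - k) [c])"
    have letters: "set (iter \<zeta> (n - k) [c]) \<subseteq> {..<m}"
      using cn by (intro iter_letters) auto
    have "iter \<zeta> n [c] = iter \<zeta> k (iter \<zeta> (n - k) [c])"
      using True by (simp flip: iter_add)
    also have "\<dots> = concat ?ws" by (rule iter_concat)
    finally have "sublist w (concat ?ws)" using cn(2) by simp
    moreover have "length y \<le> \<Lambda> ^ k" if "y \<in> set ?ws" for y
      using that letters len by auto
    ultimately obtain p us q where w: "w = p @ concat us @ q"
      and us: "set us \<subseteq> set ?ws" and pq: "length p \<le> \<Lambda> ^ k" "length q \<le> \<Lambda> ^ k"
      using sublist_concat_split[of w ?ws "\<Lambda> ^ k"] by blast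
    have "us \<in> lists ((\<lambda>b. iter \<zeta> k [b]) ` {..<m})"
      using us letters by auto
    then have "cmod (twisted_sum \<omega> s a (concat us)) \<le> sup_ratio \<omega> s a k * length (concat us)"
    proof (induction us)
      case (Cons y us)
      then have "cmod (twisted_sum \<omega> s a y) \<le> sup_ratio \<omega> s a k * length y"
        by (auto intro: norm_twisted_sum_letter_le)
      then show ?case
        using Cons.IH norm_twisted_sum_append_le[of \<omega> s a y "concat us"]
        by (simp add: distrib_left)
    qed simp
    also have "\<dots> \<le> sup_ratio \<omega> s a k * l"
      using lw w sup_ratio_nonneg[OF m, of \<omega> s a k] by (intro mult_left_mono) auto
    finally have mid: "cmod (twisted_sum \<omega> s a (concat us)) \<le> sup_ratio \<omega> s a k * l" .
    have ends: "cmod (twisted_sum \<omega> s a p) \<le> real \<Lambda> ^ k" "cmod (twisted_sum \<omega> s a q) \<le> real \<Lambda> ^ k"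
      using norm_twisted_sum_le[of \<omega> s a p] norm_twisted_sum_le[of \<omega> s a q]
        of_nat_mono[OF pq(1), where 'a = real] of_nat_mono[OF pq(2), where 'a = real]
      unfolding of_nat_power by linarith+
    show ?thesis
      unfolding w_def[symmetric] w
      using norm_twisted_sum_append_le[of \<omega> s a p "concat us @ q"]
        norm_twisted_sum_append_le[of \<omega> s a "concat us" q] mid ends by linarith
  next
    case False
    have "cmod (twisted_sum \<omega> s a w) \<le> real (length w)"
      by (rule norm_twisted_sum_le)
    also have "\<dots> \<le> real (\<Lambda> ^ n)"
      using sublist_length_le[OF cn(2)] len[OF cn(1), of n] by (intro of_nat_mono) simp
    also have "\<dots> \<le> real \<Lambda> ^ k"
      using False \<Lambda>(2) by (simp add: power_increasing)
    also have "\<dots> \<le> 2 * real \<Lambda> ^ k + sup_ratio \<omega> s a k * l"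
      using sup_ratio_nonneg[OF m, of \<omega> s a k] by simp
    finally show ?thesis by (simp add: w_def)
  qed
qed

end

section \<open>The suspension flow\<close>

lemma norm_cis_minus_1_le: "cmod (cis \<theta> - 1) \<le> \<bar>\<theta>\<bar>"
  using iexp_approx1[of \<theta> 0] by (simp add: cis_conv_exp mult.commute)

text \<open>In the Taylor expansion the quadratic remainder is at most half of the linear term when
  the angle is at most 1.\<close>

lemma norm_cis_minus_1_ge:
  assumes "\<bar>\<theta>\<bar> \<le> 1" shows "\<bar>\<theta>\<bar> / 2 \<le> cmod (cis \<theta> - 1)"
proof -
  have "cmod (cis \<theta> - (1 + \<i> * \<theta>)) \<le> \<theta>\<^sup>2 / 2"
    using iexp_approx1[of \<theta> 1] by (simp add: cis_conv_exp power2_eq_square)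
  moreover have "cmod (\<i> * \<theta>) \<le> cmod (cis \<theta> - 1) + cmod (cis \<theta> - (1 + \<i> * \<theta>))"
    using norm_triangle_ineq4[of "cis \<theta> - 1" "cis \<theta> - (1 + \<i> * \<theta>)"] by simp
  moreover have "\<theta>\<^sup>2 / 2 \<le> \<bar>\<theta>\<bar> / 2"
    using assms mult_left_le[of "\<bar>\<theta>\<bar>" "\<bar>\<theta>\<bar>"] by (simp add: power2_eq_square abs_mult_self_eq)
  ultimately show ?thesis by (simp add: norm_mult)
qed

lemma norm_cis_diff_le: "cmod (cis a - cis b) \<le> \<bar>a - b\<bar>"
proof -
  have "cis a - cis b = cis b * (cis (a - b) - 1)"
    by (simp add: right_diff_distrib cis_mult)
  then show ?thesis
    using norm_cis_minus_1_le[of "a - b"] by (simp add: norm_mult)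
qed

section \<open>Roof sums and canonical representatives\<close>

lemma roof_sum_0 [simp]: "roof_sum s x 0 = 0"
  by (simp add: roof_sum_def)

lemma roof_sum_add_1: "roof_sum s x (n + 1) = roof_sum s x n + s (x n)"
proof (cases "n \<ge> 0")
  case True
  then have "{0..<n + 1} = insert n {0..<n}" "{n..<0} = {}" "{n + 1..<0} = {}" by auto
  then show ?thesis by (simp add: roof_sum_def)
next
  case False
  then have "{n..<0} = insert n {n + 1..<0}" "{0..<n} = {}" "{0..<n + 1} = {}" by auto
  then show ?thesis by (simp add: roof_sum_def)
qed

lemma roof_sum_shift: "roof_sum s (shift n x) k = roof_sum s x (n + k) - roof_sum s x n"
proof (induction k rule: int_induct[where k = 0])
  case (step1 i)
  then show ?case
    using roof_sum_add_1[of s x "n + i"] roof_sum_add_1[of s "shift n x" i]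
    by (simp add: shift_def algebra_simps)
next
  case (step2 i)
  then show ?case
    using roof_sum_add_1[of s x "n + (i - 1)"] roof_sum_add_1[of s "shift n x" "i - 1"]
    by (simp add: shift_def algebra_simps)
qed simp

lemma shift_shift [simp]: "shift k (shift n x) = shift (n + k) x"
  by (auto simp: shift_def algebra_simps)

lemma shift_0 [simp]: "shift 0 x = x"
  by (simp add: shift_def)

lemma roof_sum_eq_weight:
  "roof_sum s x (int N) = weight s (map (\<lambda>j. x (int j)) [0..<N])"
proof (induction N)
  case (Suc N)
  then show ?case using roof_sum_add_1[of s x "int N"] by (simp add: add.commute)
qed simp

definition roof_index :: "(nat \<Rightarrow> real) \<Rightarrow> (int \<Rightarrow> nat) \<Rightarrow> real \<Rightarrow> int" where
  "roof_index s x t = (THE n. roof_sum s x n \<le> t \<and> t < roof_sum s x (n + 1))"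

lemma susp_rep_eq:
  "susp_rep s (x, t) = (shift (roof_index s x t) x, t - roof_sum s x (roof_index s x t))"
  by (simp add: susp_rep_def roof_index_def Let_def)

text \<open>The lower bound \<delta> along the whole orbit makes the roof sums strictly increasing
  and unbounded in both directions, so that the \<open>THE\<close> in \<open>roof_index\<close>
  denotes for every real time.\<close>

locale roof =
  fixes s :: "nat \<Rightarrow> real" and x :: "int \<Rightarrow> nat" and \<delta> :: real
  assumes \<delta>: "\<delta> > 0" and roof_ge: "\<And>i. \<delta> \<le> s (x i)"
begin

lemma roof_sum_diff_ge: "n \<le> k \<Longrightarrow> \<delta> * (k - n) \<le> roof_sum s x k - roof_sum s x n"
proof (induction k rule: int_ge_induct)
  case (step i)
  then show ?case
    using roof_sum_add_1[of s x i] roof_ge[of i] by (simp add: algebra_simps)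
qed simp

lemma roof_sum_mono: "n \<le> k \<Longrightarrow> roof_sum s x n \<le> roof_sum s x k"
proof -
  assume "n \<le> k"
  then have "0 \<le> \<delta> * (real_of_int k - real_of_int n)" using \<delta> by simp
  then show ?thesis using roof_sum_diff_ge[OF \<open>n \<le> k\<close>] by linarith
qed

lemma roof_index_eqI:
  assumes "roof_sum s x n \<le> t" "t < roof_sum s x (n + 1)"
  shows "roof_index s x t = n"
  unfolding roof_index_def
proof (rule the_equality)
  fix k assume k: "roof_sum s x k \<le> t \<and> t < roof_sum s x (k + 1)"
  show "k = n"
    using k assms roof_sum_mono[of "n + 1" k] roof_sum_mono[of "k + 1" n] by linarith
qed (use assms in auto)

lemma roof_index_bounds:
  "roof_sum s x (roof_index s x t) \<le> t" "t < roof_sum s x (roof_index s x t + 1)"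
proof -
  \<comment> \<open>Each step adds at least \<delta>, so \<open>M\<close> steps in either direction
    pass \<open>t\<close>; the extra 1 gives room for the strict upper inequality.\<close>
  define M where "M = \<lceil>\<bar>t\<bar> / \<delta>\<rceil> + 1"
  have M: "\<delta> * M \<ge> \<bar>t\<bar> + \<delta>" "M \<ge> 0"
  proof -
    have "\<bar>t\<bar> / \<delta> \<le> of_int \<lceil>\<bar>t\<bar> / \<delta>\<rceil>" by simp
    then have "\<bar>t\<bar> / \<delta> * \<delta> \<le> of_int \<lceil>\<bar>t\<bar> / \<delta>\<rceil> * \<delta>" using \<delta> by (intro mult_right_mono) auto
    then show "\<delta> * M \<ge> \<bar>t\<bar> + \<delta>" using \<delta> by (simp add: M_def algebra_simps)
    have "\<lceil>\<bar>t\<bar> / \<delta>\<rceil> \<ge> 0"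
      using \<delta> by (simp only: zero_le_ceiling) (rule less_le_trans[of _ 0], simp_all)
    then show "M \<ge> 0" by (simp add: M_def)
  qed
  have lo: "roof_sum s x (- M) \<le> t"
    using roof_sum_diff_ge[of "- M" 0] M \<delta> by simp
  define K where "K = (LEAST k. t < roof_sum s x (- M + int k + 1))"
  have "t < roof_sum s x (- M + int (nat (2 * M)) + 1)"
    using roof_sum_diff_ge[of 0 M] roof_sum_mono[of M "M + 1"] M \<delta> by simp
  then have up: "t < roof_sum s x (- M + int K + 1)"
    unfolding K_def by (rule LeastI)
  have "roof_sum s x (- M + int K) \<le> t"
  proof (cases K)
    case (Suc K')
    then have "\<not> t < roof_sum s x (- M + int K' + 1)"
      unfolding K_def by (intro not_less_Least) simp
    then show ?thesis using Suc by (simp add: algebra_simps)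
  qed (simp add: lo)
  then have "roof_index s x t = - M + int K"
    using up by (rule roof_index_eqI)
  then show "roof_sum s x (roof_index s x t) \<le> t" "t < roof_sum s x (roof_index s x t + 1)"
    using up \<open>roof_sum s x (- M + int K) \<le> t\<close> by simp_all
qed

lemma roof_shift: "roof s (shift n x) \<delta>"
  using \<delta> roof_ge by unfold_locales (auto simp: shift_def)

text \<open>Both pairs describe the same point of a flow line, so the index merely drops by
  \<open>n\<close>. The group law of the flow on representatives rests on this.\<close>

lemma susp_rep_shift: "susp_rep s (shift n x, t - roof_sum s x n) = susp_rep s (x, t)"
proof -
  interpret sh: roof s "shift n x" \<delta> by (rule roof_shift)
  have "roof_index s (shift n x) (t - roof_sum s x n) = roof_index s x t - n"
    using roof_index_bounds[of t]
    by (intro sh.roof_index_eqI) (simp_all add: roof_sum_shift algebra_simps)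
  then show ?thesis
    by (simp add: susp_rep_eq roof_sum_shift)
qed

lemma susp_flow_susp_rep: "susp_flow s \<tau> (susp_rep s (x, t)) = susp_rep s (x, t + \<tau>)"
  using susp_rep_shift[of "roof_index s x t" "t + \<tau>"]
  by (simp add: susp_rep_eq[of s x t] susp_flow_def algebra_simps)

lemma susp_rep_id: "0 \<le> t \<Longrightarrow> t < s (x 0) \<Longrightarrow> susp_rep s (x, t) = (x, t)"
  using roof_index_eqI[of 0 t] roof_sum_add_1[of s x 0] by (simp add: susp_rep_eq)

lemma susp_rep_top: "susp_rep s (x, s (x 0)) = (shift 1 x, 0)"
  using roof_index_eqI[of 1 "s (x 0)"] roof_sum_add_1[of s x 0] roof_sum_add_1[of s x 1] roof_ge[of 1] \<delta>
  by (simp add: susp_rep_eq)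

end

section \<open>Orbit sums sampled at equal time steps\<close>

lemma less_nat_ceiling_iff: "j < nat \<lceil>z\<rceil> \<longleftrightarrow> real j < z"
  by linarith

lemma sum_power_telescope:
  fixes e :: complex
  assumes "p \<le> q"
  shows "(1 - e) * (\<Sum>j\<in>{p..<q}. e ^ j) = e ^ p - e ^ q"
  using assms
proof (induction q rule: dec_induct)
  case (step q)
  have "(1 - e) * (\<Sum>j\<in>{p..<Suc q}. e ^ j) = (1 - e) * (\<Sum>j\<in>{p..<q}. e ^ j) + (1 - e) * e ^ q"
    using step.hyps by (simp add: distrib_left)
  also have "\<dots> = (e ^ p - e ^ q) + (1 - e) * e ^ q"
    by (simp only: step.IH)
  finally show ?case by (simp add: algebra_simps)
qed simp

text \<open>The factor \<open>1 - e\<close> makes the sum over the times spent above one letter telescope. A sampling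
  time that hits the bottom of the tower exactly may also see the previous letter.\<close>

lemma (in roof) norm_orbit_sum_le:
  fixes f :: "nat \<Rightarrow> complex"
  assumes t: "0 \<le> t" "t < s (x 0)" and h: "h > 0"
    and e: "e = cis (- (2 * pi * \<omega> * h))"
    and f: "\<And>j. f j = of_bool (x (roof_index s x (t + real j * h)) = a \<or>
      t + real j * h = roof_sum s x (roof_index s x (t + real j * h)) \<and>
      x (roof_index s x (t + real j * h) - 1) = a)"
  obtains N where "real N * \<delta> \<le> t + real J * h"
    "cmod ((1 - e) * (\<Sum>j<J. e ^ j * f j)) \<le>
      2 * cmod (twisted_sum \<omega> s a (map (\<lambda>j. x (int j)) [0..<N])) + 4 + real N * (4 * pi * \<bar>\<omega>\<bar> * h)"
proof -
  define \<alpha> where "\<alpha> = (\<lambda>n. roof_sum s x (int n))"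
  \<comment> \<open>The first sampling index whose time has reached the bottom
    \<open>\<alpha> n\<close> of the \<open>n\<close>-th tower. Since
    \<open>\<alpha> 0 = 0 \<le> t\<close>, truncation by \<open>nat\<close> gives
    \<open>c 0 = 0\<close>.\<close>
  define c where "c = (\<lambda>n. nat \<lceil>(\<alpha> n - t) / h\<rceil>)"
  define F where "F = (\<lambda>n. \<Sum>j<n. e ^ j * f j)"
  define w where "w = (\<lambda>n. map (\<lambda>j. x (int j)) [0..<n])"
  define T where "T = (\<lambda>n. twisted_sum \<omega> s a (w n))"
  have less_c: "j < c n \<longleftrightarrow> t + real j * h < \<alpha> n" for j n
    unfolding c_def less_nat_ceiling_iff using h by (simp add: field_simps)
  have \<alpha>_mono: "\<alpha> n \<le> \<alpha> (Suc n)" for n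
    unfolding \<alpha>_def by (rule roof_sum_mono) simp
  have \<alpha>_Suc: "\<alpha> (Suc n) = \<alpha> n + s (x (int n))" for n
    using roof_sum_add_1[of s x "int n"] by (simp add: \<alpha>_def add.commute)
  have c_mono: "c n \<le> c (Suc n)" for n
    using less_c[of "c (Suc n)" n] less_c[of "c (Suc n)" "Suc n"] \<alpha>_mono[of n] by linarith
  have index: "roof_index s x (t + real j * h) = int n" if "c n \<le> j" "j < c (Suc n)" for j n
    using that less_c[of j n] less_c[of j "Suc n"]
    by (intro roof_index_eqI) (auto simp: \<alpha>_def add.commute)
  have e1: "cmod e = 1" by (simp add: e)
  have 1: "cmod (1 - e) \<le> 2 * pi * \<bar>\<omega>\<bar> * h"
    using norm_cis_minus_1_le[of "- (2 * pi * \<omega> * h)"] h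
    by (simp add: e norm_minus_commute abs_mult)
  have 2: "cmod (1 - e) \<le> 2"
    using norm_triangle_ineq4[of 1 e] e1 by simp
  have in_a: "(1 - e) * (\<Sum>j\<in>{c n..<k}. e ^ j * f j) = e ^ c n - e ^ k"
    if "x (int n) = a" "c n \<le> k" "k \<le> c (Suc n)" for n k
  proof -
    have "(\<Sum>j\<in>{c n..<k}. e ^ j * f j) = (\<Sum>j\<in>{c n..<k}. e ^ j)"
    proof (rule sum.cong)
      fix j assume "j \<in> {c n..<k}"
      then have "roof_index s x (t + real j * h) = int n"
        using that by (intro index) auto
      then show "e ^ j * f j = e ^ j" using that(1) by (simp add: f)
    qed simp
    then show ?thesis using sum_power_telescope[OF that(2), of e] by simp
  qed
  \<comment> \<open>Over a letter other than \<open>a\<close> only the first sample can count,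
    namely when it hits the bottom exactly and the previous letter is \<open>a\<close>.\<close>
  have out_a: "cmod ((1 - e) * (\<Sum>j\<in>{c n..<k}. e ^ j * f j)) \<le> cmod (1 - e)"
    if "x (int n) \<noteq> a" "c n \<le> k" "k \<le> c (Suc n)" for n k
  proof -
    have zero: "f j = 0" if j: "j \<in> {c n..<k}" "j \<noteq> c n" for j
    proof -
      have i: "roof_index s x (t + real j * h) = int n"
        using j \<open>k \<le> c (Suc n)\<close> by (intro index) auto
      have "\<alpha> n \<le> t + real (c n) * h" using less_c[of "c n" n] by simp
      also have "\<dots> < t + real j * h" using j h by simp
      finally show ?thesis
        using \<open>x (int n) \<noteq> a\<close> by (simp add: f i \<alpha>_def)
    qed
    have "(\<Sum>j\<in>{c n..<k}. e ^ j * f j) = (\<Sum>j\<in>{c n..<k}. if j = c n then e ^ j * f j else 0)"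
      using zero by (intro sum.cong) auto
    also have "cmod \<dots> \<le> 1"
      by (simp add: norm_mult norm_power e1 f)
    finally show ?thesis
      by (simp add: norm_mult mult_left_le)
  qed
  \<comment> \<open>The sampled phase at entry or exit lags the exact phase at the tower bottom by
    at most one time step, costing \<open>2 * pi * \<bar>\<omega>\<bar> * h\<close> each. The bottom
    of tower 0 lies at or before the start of the orbit, so the trivial bound 2 is used
    there.\<close>
  have step_a: "cmod ((e ^ c n - e ^ c (Suc n)) -
      (1 - cis (- (2 * pi * \<omega> * s a))) * cis (2 * pi * \<omega> * t) * cis (- (2 * pi * \<omega> * \<alpha> n)))
      \<le> 4 * pi * \<bar>\<omega>\<bar> * h + (if n = 0 then 2 else 0)" if xn: "x (int n) = a" for n
  proof -
    let ?E = "\<lambda>n. cis (- (2 * pi * \<omega> * (\<alpha> n - t)))"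
    have E: "(1 - cis (- (2 * pi * \<omega> * s a))) * cis (2 * pi * \<omega> * t) * cis (- (2 * pi * \<omega> * \<alpha> n)) =
        ?E n - ?E (Suc n)"
      using xn by (simp add: left_diff_distrib cis_mult \<alpha>_Suc algebra_simps)
    have close: "cmod (e ^ c n - ?E n) \<le> 2 * pi * \<bar>\<omega>\<bar> * h" if "n > 0" for n
    proof -
      have "\<alpha> 1 \<le> \<alpha> n"
        unfolding \<alpha>_def using that by (intro roof_sum_mono) simp
      then have "\<alpha> n > t"
        using t \<alpha>_Suc[of 0] by (simp add: \<alpha>_def)
      have "\<not> t + real (c n) * h < \<alpha> n" using less_c[of "c n" n] by simp
      moreover have "c n > 0" using less_c[of 0 n] \<open>\<alpha> n > t\<close> by simp
      then have "t + real (c n - 1) * h < \<alpha> n" using less_c[of "c n - 1" n] by simp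
      then have "t + real (c n) * h - h < \<alpha> n"
        using \<open>c n > 0\<close> by (simp add: of_nat_diff algebra_simps)
      ultimately have *: "\<bar>real (c n) * h - (\<alpha> n - t)\<bar> \<le> h" by linarith
      have "e ^ c n = cis (- (2 * pi * \<omega> * (real (c n) * h)))"
        unfolding e Complex.DeMoivre by (simp add: algebra_simps)
      then have "cmod (e ^ c n - ?E n) \<le>
          \<bar>- (2 * pi * \<omega> * (real (c n) * h)) - (- (2 * pi * \<omega> * (\<alpha> n - t)))\<bar>"
        by (simp only: norm_cis_diff_le)
      also have "\<dots> = 2 * pi * \<bar>\<omega>\<bar> * \<bar>real (c n) * h - (\<alpha> n - t)\<bar>"
        unfolding right_diff_distrib[symmetric] minus_diff_minus abs_minus_cancel
        by (simp add: abs_mult)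
      also have "\<dots> \<le> 2 * pi * \<bar>\<omega>\<bar> * h"
        using * by (intro mult_left_mono) auto
      finally show ?thesis .
    qed
    have "cmod (e ^ c n - ?E n) \<le> 2 * pi * \<bar>\<omega>\<bar> * h + (if n = 0 then 2 else 0)"
    proof (cases "n = 0")
      case True
      have "cmod (e ^ c n - ?E n) \<le> 2"
        using norm_triangle_ineq4[of "e ^ c n" "?E n"] by (simp add: norm_power e1)
      moreover have "2 * pi * \<bar>\<omega>\<bar> * h \<ge> 0" using h by simp
      moreover have "(if n = 0 then 2 else 0) = (2 :: real)" using True by simp
      ultimately show ?thesis by linarith
    next
      case False
      then show ?thesis using close[of n] by simp
    qed
    then have "cmod (e ^ c n - ?E n) + cmod (e ^ c (Suc n) - ?E (Suc n))
        \<le> 4 * pi * \<bar>\<omega>\<bar> * h + (if n = 0 then 2 else 0)"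
      using close[of "Suc n"] by simp
    moreover have "cmod ((e ^ c n - e ^ c (Suc n)) - (?E n - ?E (Suc n))) \<le>
        cmod (e ^ c n - ?E n) + cmod (e ^ c (Suc n) - ?E (Suc n))"
      using norm_triangle_ineq4[of "e ^ c n - ?E n" "e ^ c (Suc n) - ?E (Suc n)"]
      by (simp add: algebra_simps)
    ultimately show ?thesis unfolding E by linarith
  qed
  \<comment> \<open>The factor common to all full passages through \<open>a\<close>: entry phase
    minus exit phase of one tower, corrected by the starting height \<open>t\<close>.\<close>
  let ?g = "(1 - cis (- (2 * pi * \<omega> * s a))) * cis (2 * pi * \<omega> * t)"
  have F_split: "F k = F (c n) + (\<Sum>j\<in>{c n..<k}. e ^ j * f j)" if "c n \<le> k" for n k
    unfolding F_def using that by (simp add: lessThan_atLeast0 sum.atLeastLessThan_concat)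
  \<comment> \<open>The additional 2 enters once, with tower 0; every tower adds at most the
    discretisation error.\<close>
  have claim: "cmod ((1 - e) * F (c n) - ?g * T n) \<le>
      real n * (4 * pi * \<bar>\<omega>\<bar> * h) + (if n = 0 then 0 else 2)" for n
  proof (induction n)
    case 0
    have "c 0 = 0" using less_c[of 0 0] t by (simp add: \<alpha>_def)
    then show ?case by (simp add: F_def T_def w_def)
  next
    case (Suc n)
    have w: "w (Suc n) = w n @ [x (int n)]" by (simp add: w_def)
    have T_Suc: "T (Suc n) = T n + (if x (int n) = a then cis (- (2 * pi * \<omega> * \<alpha> n)) else 0)"
      unfolding T_def w twisted_sum_append \<alpha>_def roof_sum_eq_weight by (simp add: w_def)
    let ?D = "(1 - e) * (\<Sum>j\<in>{c n..<c (Suc n)}. e ^ j * f j) -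
      ?g * (if x (int n) = a then cis (- (2 * pi * \<omega> * \<alpha> n)) else 0)"
    have "cmod ?D \<le> 4 * pi * \<bar>\<omega>\<bar> * h + (if n = 0 then 2 else 0)"
    proof (cases "x (int n) = a")
      case True
      then show ?thesis using in_a[OF True c_mono order_refl] step_a[OF True] by simp
    next
      case False
      have "2 * pi * \<bar>\<omega>\<bar> * h \<ge> 0" using h by simp
      moreover have "?D = (1 - e) * (\<Sum>j\<in>{c n..<c (Suc n)}. e ^ j * f j)"
        using False by simp
      moreover have "(0 :: real) \<le> (if n = 0 then 2 else 0)" by simp
      ultimately show ?thesis
        using out_a[OF False c_mono order_refl] 1 by (simp only:)
    qed
    moreover have split: "(1 - e) * F (c (Suc n)) - ?g * T (Suc n) = ((1 - e) * F (c n) - ?g * T n) + ?D"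
      unfolding F_split[OF c_mono] T_Suc by (simp add: algebra_simps)
    ultimately have "cmod ((1 - e) * F (c (Suc n)) - ?g * T (Suc n)) \<le>
        (real n * (4 * pi * \<bar>\<omega>\<bar> * h) + (if n = 0 then 0 else 2)) +
        (4 * pi * \<bar>\<omega>\<bar> * h + (if n = 0 then 2 else 0))"
      unfolding split using norm_triangle_ineq[of "(1 - e) * F (c n) - ?g * T n" ?D] Suc.IH by linarith
    then show ?case by (simp add: algebra_simps split: if_splits)
  qed
  define N where "N = nat (roof_index s x (t + real J * h))"
  have "roof_index s x (t + real J * h) \<ge> 0"
  proof (rule ccontr)
    assume "\<not> ?thesis"
    then have "roof_sum s x (roof_index s x (t + real J * h) + 1) \<le> roof_sum s x 0"
      by (intro roof_sum_mono) simp
    moreover have "0 \<le> real J * h" using h by simp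
    ultimately show False using roof_index_bounds(2)[of "t + real J * h"] t by simp
  qed
  then have bounds: "\<alpha> N \<le> t + real J * h" "t + real J * h < \<alpha> (Suc N)"
    using roof_index_bounds[of "t + real J * h"] by (simp_all add: N_def \<alpha>_def add.commute)
  have J: "c N \<le> J" "J \<le> c (Suc N)"
  proof -
    show "c N \<le> J" using less_c[of J N] bounds(1) by linarith
    show "J \<le> c (Suc N)" using less_c[of J "Suc N"] bounds(2) by linarith
  qed
  \<comment> \<open>The last tower may be left unfinished; its part is bounded by 2 as well.
    Together with the 2 from tower 0 this makes the constant 4.\<close>
  have "cmod ((1 - e) * (\<Sum>j\<in>{c N..<J}. e ^ j * f j)) \<le> 2"
  proof (cases "x (int N) = a")
    case True
    then show ?thesis
      unfolding in_a[OF True J] using norm_triangle_ineq4[of "e ^ c N" "e ^ J"]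
      by (simp add: norm_power e1)
  next
    case False
    then show ?thesis using out_a[OF False J] 2 by linarith
  qed
  moreover have gT: "cmod (?g * T N) \<le> 2 * cmod (T N)"
  proof -
    have "cmod (1 - cis (- (2 * pi * \<omega> * s a))) \<le> 2"
      using norm_triangle_ineq4[of 1 "cis (- (2 * pi * \<omega> * s a))"] by simp
    then have "cmod (1 - cis (- (2 * pi * \<omega> * s a))) * cmod (T N) \<le> 2 * cmod (T N)"
      by (intro mult_right_mono) auto
    then show ?thesis by (simp only: norm_mult norm_cis mult_1_right)
  qed
  have split: "(1 - e) * F J = ((1 - e) * F (c N) - ?g * T N) + ?g * T N +
      (1 - e) * (\<Sum>j\<in>{c N..<J}. e ^ j * f j)"
    unfolding F_split[OF J(1)] by (simp add: algebra_simps)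
  have "cmod ((1 - e) * F J) \<le> cmod ((1 - e) * F (c N) - ?g * T N) + cmod (?g * T N) +
      cmod ((1 - e) * (\<Sum>j\<in>{c N..<J}. e ^ j * f j))"
    unfolding split using norm_triangle_ineq[of "((1 - e) * F (c N) - ?g * T N) + ?g * T N"
        "(1 - e) * (\<Sum>j\<in>{c N..<J}. e ^ j * f j)"]
      norm_triangle_ineq[of "(1 - e) * F (c N) - ?g * T N" "?g * T N"] by linarith
  moreover have "cmod ((1 - e) * F (c N) - ?g * T N) \<le> real N * (4 * pi * \<bar>\<omega>\<bar> * h) + 2"
    using claim[of N] by (simp split: if_splits)
  ultimately have "cmod ((1 - e) * F J) \<le> 2 * cmod (T N) + 4 + real N * (4 * pi * \<bar>\<omega>\<bar> * h)"
    using gT by linarith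
  moreover have "real N * \<delta> \<le> t + real J * h"
    using roof_sum_diff_ge[of 0 "int N"] bounds(1) by (simp add: \<alpha>_def mult.commute)
  ultimately show ?thesis
    using that[of N] by (simp add: F_def T_def w_def)
qed

section \<open>From spectral measures to sampled orbit sums\<close>

lemma cnj_measurable [measurable]: "cnj \<in> borel_measurable borel"
  by (intro borel_measurable_continuous_onI continuous_on_cnj continuous_on_id)

lemma cis_measurable [measurable]: "cis \<in> borel_measurable borel"
  by (intro borel_measurable_continuous_onI continuous_on_cis continuous_on_id)

lemma integral_double_sum:
  fixes g :: "nat \<Rightarrow> nat \<Rightarrow> 'a \<Rightarrow> complex"
  assumes "\<And>j k. integrable M (g j k)"
  shows "(LINT x|M. (\<Sum>j<J. \<Sum>k<J. d j k * g j k x)) = (\<Sum>j<J. \<Sum>k<J. d j k * (LINT x|M. g j k x))"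
  using assms by (simp add: Bochner_Integration.integral_sum)

text \<open>Both squares expand into double sums of correlations. Invariance of \<mu> reduces the
  correlation at times \<open>a\<close> and \<open>b\<close> to the one at \<open>a - b\<close> and
  0, which the definition of the spectral measure turns into a Fourier integral over
  \<sigma>.\<close>

lemma spectral_isometry:
  fixes H :: "real \<Rightarrow> 'a \<Rightarrow> 'a" and c :: "nat \<Rightarrow> complex"
  assumes "prob_space \<mu>"
    and H: "\<And>t. H t \<in> \<mu> \<rightarrow>\<^sub>M \<mu>" "\<And>t. distr \<mu> \<mu> (H t) = \<mu>"
      "\<And>a b z. z \<in> space \<mu> \<Longrightarrow> H a (H b z) = H (a + b) z"
    and A: "A \<in> sets \<mu>"
    and \<sigma>: "is_spectral_measure \<mu> H (indicator A) \<sigma>"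
  shows "(LINT z|\<mu>. (cmod (\<Sum>j<J. c j * indicator A (H (real j * h) z)))\<^sup>2) =
    (LINT \<omega>|\<sigma>. (cmod (\<Sum>j<J. c j * cis (2 * pi * \<omega> * (real j * h))))\<^sup>2)"
proof -
  interpret prob_space \<mu> by fact
  interpret \<sigma>: finite_measure \<sigma> using \<sigma> by (simp add: is_spectral_measure_def)
  have sets_\<sigma> [measurable_cong]: "sets \<sigma> = sets borel"
    using \<sigma> by (simp add: is_spectral_measure_def)
  let ?f = "\<lambda>z. indicator A z :: complex"
  have [measurable]: "A \<in> sets \<mu>" "\<And>t. H t \<in> \<mu> \<rightarrow>\<^sub>M \<mu>" by fact+
  have int\<mu>: "integrable \<mu> (\<lambda>z. ?f (H a z) * cnj (?f (H b z)))" for a b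
    by (rule integrable_const_bound[where B = 1]) (auto simp: indicator_def)
  have int\<sigma>: "integrable \<sigma> (\<lambda>\<omega>. cis (2 * pi * \<omega> * a) * cnj (cis (2 * pi * \<omega> * b)))" for a b
    by (rule \<sigma>.integrable_const_bound[where B = 1]) (auto simp: norm_mult)
  have corr: "(LINT z|\<mu>. ?f (H a z) * cnj (?f (H b z))) =
      (LINT \<omega>|\<sigma>. cis (2 * pi * \<omega> * a) * cnj (cis (2 * pi * \<omega> * b)))" for a b
  proof -
    have "(LINT z|\<mu>. ?f (H a z) * cnj (?f (H b z))) =
        (LINT z|\<mu>. ?f (H (a - b) (H b z)) * cnj (?f (H b z)))"
      by (intro Bochner_Integration.integral_cong) (simp_all add: H(3))
    also have "\<dots> = (LINT z|distr \<mu> \<mu> (H b). ?f (H (a - b) z) * cnj (?f z))"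
      by (subst integral_distr) auto
    also have "\<dots> = (LINT z|\<mu>. ?f (H (a - b) z) * cnj (?f z))"
      by (simp only: H(2))
    also have "\<dots> = (LINT \<omega>|\<sigma>. cis (2 * pi * \<omega> * (a - b)))"
      using \<sigma> by (simp add: is_spectral_measure_def)
    also have "\<dots> = (LINT \<omega>|\<sigma>. cis (2 * pi * \<omega> * a) * cnj (cis (2 * pi * \<omega> * b)))"
      by (intro Bochner_Integration.integral_cong) (simp_all add: cis_cnj cis_mult right_diff_distrib)
    finally show ?thesis .
  qed
  have expand: "complex_of_real ((cmod (\<Sum>j<J. c j * u j))\<^sup>2) =
      (\<Sum>j<J. \<Sum>k<J. c j * cnj (c k) * (u j * cnj (u k)))" for u :: "nat \<Rightarrow> complex"
    by (simp only: complex_norm_square cnj_sum sum_product complex_cnj_mult mult_ac)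
  have "complex_of_real (LINT z|\<mu>. (cmod (\<Sum>j<J. c j * ?f (H (real j * h) z)))\<^sup>2) =
      (LINT z|\<mu>. (\<Sum>j<J. \<Sum>k<J. c j * cnj (c k) *
        (?f (H (real j * h) z) * cnj (?f (H (real k * h) z)))))"
    by (simp only: integral_complex_of_real[symmetric] expand)
  also have "\<dots> = (\<Sum>j<J. \<Sum>k<J. c j * cnj (c k) *
      (LINT z|\<mu>. ?f (H (real j * h) z) * cnj (?f (H (real k * h) z))))"
    by (rule integral_double_sum) (rule int\<mu>)
  also have "\<dots> = (\<Sum>j<J. \<Sum>k<J. c j * cnj (c k) *
      (LINT \<omega>|\<sigma>. cis (2 * pi * \<omega> * (real j * h)) * cnj (cis (2 * pi * \<omega> * (real k * h)))))"
    by (simp only: corr)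
  also have "\<dots> = (LINT \<omega>|\<sigma>. (\<Sum>j<J. \<Sum>k<J. c j * cnj (c k) *
        (cis (2 * pi * \<omega> * (real j * h)) * cnj (cis (2 * pi * \<omega> * (real k * h))))))"
    by (rule integral_double_sum[symmetric]) (rule int\<sigma>)
  also have "\<dots> = complex_of_real
      (LINT \<omega>|\<sigma>. (cmod (\<Sum>j<J. c j * cis (2 * pi * \<omega> * (real j * h))))\<^sup>2)"
    by (simp only: integral_complex_of_real[symmetric] expand)
  finally show ?thesis by (simp only: of_real_eq_iff)
qed

text \<open>For a frequency in the interval, the terms twisted by the phases of \<omega> stay at an
  angle of at most \<open>2 * pi / 6 = pi / 3\<close>, so each has real part at least 1/2 and their
  sum has modulus at least \<open>J / 2\<close>. This is integrated against \<sigma> as in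
  Chebyshev's inequality, and the isometry moves the square integral to the orbit sums.\<close>

lemma spectral_measure_interval_le:
  fixes H :: "real \<Rightarrow> 'a \<Rightarrow> 'a"
  assumes \<mu>: "prob_space \<mu>"
    and H: "\<And>t. H t \<in> \<mu> \<rightarrow>\<^sub>M \<mu>" "\<And>t. distr \<mu> \<mu> (H t) = \<mu>"
      "\<And>a b z. z \<in> space \<mu> \<Longrightarrow> H a (H b z) = H (a + b) z"
    and A: "A \<in> sets \<mu>"
    and \<sigma>: "is_spectral_measure \<mu> H (indicator A) \<sigma>"
    and J: "J \<ge> 1" "h \<ge> 0" "r \<ge> 0" "real J * h * r \<le> 1 / 6"
    and S: "\<And>z. z \<in> space \<mu> \<Longrightarrow>
      cmod (\<Sum>j<J. cis (- (2 * pi * \<omega> * h)) ^ j * indicator A (H (real j * h) z)) \<le> M"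
  shows "measure \<sigma> {\<omega> - r..\<omega> + r} \<le> (2 * M / real J)\<^sup>2"
proof -
  interpret prob_space \<mu> by fact
  interpret \<sigma>: finite_measure \<sigma> using \<sigma> by (simp add: is_spectral_measure_def)
  have sets_\<sigma> [measurable_cong]: "sets \<sigma> = sets borel"
    using \<sigma> by (simp add: is_spectral_measure_def)
  let ?e = "\<lambda>j. cis (- (2 * pi * \<omega> * h)) ^ j"
  let ?g = "\<lambda>\<eta>. (cmod (\<Sum>j<J. ?e j * cis (2 * pi * \<eta> * (real j * h))))\<^sup>2"
  have [measurable]: "A \<in> sets \<mu>" "\<And>t. H t \<in> \<mu> \<rightarrow>\<^sub>M \<mu>" by fact+
  have "(real J / 2)\<^sup>2 * measure \<sigma> {\<omega> - r..\<omega> + r} =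
      (LINT \<eta>|\<sigma>. (real J / 2)\<^sup>2 * indicator {\<omega> - r..\<omega> + r} \<eta>)"
    using sets_\<sigma> sets_eq_imp_space_eq[OF sets_\<sigma>] by simp
  also have "\<dots> \<le> (LINT \<eta>|\<sigma>. ?g \<eta>)"
  proof (rule integral_mono)
    show "integrable \<sigma> (\<lambda>\<eta>. (real J / 2)\<^sup>2 * indicator {\<omega> - r..\<omega> + r} \<eta>)"
      using sets_\<sigma> by (intro integrable_mult_right integrable_real_indicator) (auto simp: less_top[symmetric])
    have "cmod (\<Sum>j<J. ?e j * cis (2 * pi * \<eta> * (real j * h))) \<le> real J" for \<eta>
      by (rule order_trans[OF norm_sum]) (simp add: norm_mult norm_power)
    then have "?g \<eta> \<le> (real J)\<^sup>2" for \<eta>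
      by (intro power_mono) auto
    then show "integrable \<sigma> ?g"
      by (intro \<sigma>.integrable_const_bound[where B = "(real J)\<^sup>2"]) auto
  next
    fix \<eta>
    show "(real J / 2)\<^sup>2 * indicator {\<omega> - r..\<omega> + r} \<eta> \<le> ?g \<eta>"
    proof (cases "\<eta> \<in> {\<omega> - r..\<omega> + r}")
      case True
      have "1 / 2 \<le> Re (?e j * cis (2 * pi * \<eta> * (real j * h)))" if j: "j < J" for j
      proof -
        have "\<bar>\<eta> - \<omega>\<bar> * (real j * h) \<le> r * (real J * h)"
          using True j J by (intro mult_mono) (auto simp: abs_le_iff)
        also have "\<dots> \<le> 1 / 6" using J(4) by (simp add: mult_ac)
        finally have "2 * pi * (\<bar>\<eta> - \<omega>\<bar> * (real j * h)) \<le> 2 * pi * (1 / 6)"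
          by (intro mult_left_mono) auto
        then have "cos (pi / 3) \<le> cos (2 * pi * (\<bar>\<eta> - \<omega>\<bar> * (real j * h)))"
          using J by (intro cos_monotone_0_pi_le) auto
        also have "2 * pi * (\<bar>\<eta> - \<omega>\<bar> * (real j * h)) = \<bar>2 * pi * ((\<eta> - \<omega>) * (real j * h))\<bar>"
          using J by (simp add: abs_mult)
        also have "cos \<bar>2 * pi * ((\<eta> - \<omega>) * (real j * h))\<bar> = Re (?e j * cis (2 * pi * \<eta> * (real j * h)))"
          unfolding Complex.DeMoivre cis_mult cos_abs_real by (simp add: algebra_simps)
        finally show ?thesis by (simp add: cos_60)
      qed
      then have "(\<Sum>j<J. 1 / 2) \<le> (\<Sum>j<J. Re (?e j * cis (2 * pi * \<eta> * (real j * h))))"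
        by (intro sum_mono) auto
      also have "\<dots> = Re (\<Sum>j<J. ?e j * cis (2 * pi * \<eta> * (real j * h)))" by (simp only: Re_sum)
      also have "\<dots> \<le> cmod (\<Sum>j<J. ?e j * cis (2 * pi * \<eta> * (real j * h)))" by (rule complex_Re_le_cmod)
      finally have "real J / 2 \<le> cmod (\<Sum>j<J. ?e j * cis (2 * pi * \<eta> * (real j * h)))" by simp
      then have "(real J / 2)\<^sup>2 \<le> ?g \<eta>" by (rule power_mono) simp
      then show ?thesis using True by simp
    qed simp
  qed
  also have "\<dots> = (LINT z|\<mu>. (cmod (\<Sum>j<J. ?e j * indicator A (H (real j * h) z)))\<^sup>2)"
    by (rule spectral_isometry[OF \<mu> H A \<sigma>, symmetric])
  also have "\<dots> \<le> (LINT z|\<mu>. M\<^sup>2)"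
  proof (rule integral_mono)
    have S2: "(cmod (\<Sum>j<J. ?e j * indicator A (H (real j * h) z)))\<^sup>2 \<le> M\<^sup>2" if "z \<in> space \<mu>" for z
      using S[OF that] by (rule power_mono) simp
    have "(\<lambda>z. (cmod (\<Sum>j<J. ?e j * indicator A (H (real j * h) z)))\<^sup>2) \<in> borel_measurable \<mu>"
      by measurable
    then show "integrable \<mu> (\<lambda>z. (cmod (\<Sum>j<J. ?e j * indicator A (H (real j * h) z)))\<^sup>2)"
      using S2 by (intro integrable_const_bound[where B = "M\<^sup>2"] AE_I2) (simp_all only: real_norm_def abs_power2)
    show "(cmod (\<Sum>j<J. ?e j * indicator A (H (real j * h) z)))\<^sup>2 \<le> M\<^sup>2" if "z \<in> space \<mu>" for z
      using S2[OF that] .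
  qed simp
  also have "\<dots> = M\<^sup>2" by (simp add: prob_space)
  finally show ?thesis
    using J(1) by (simp add: power_divide power_mult_distrib field_simps)
qed

section \<open>The suspension over the substitution subshift\<close>

context
  fixes m :: nat and \<zeta> :: "nat \<Rightarrow> nat list" and s :: "nat \<Rightarrow> real" and \<delta> :: real
  assumes subst: "substitution m \<zeta>"
    and \<delta>: "\<delta> > 0" "\<And>b. b < m \<Longrightarrow> \<delta> \<le> s b"
begin

lemma subst_space_letter:
  assumes "x \<in> subst_space m \<zeta>" shows "x i < m"
proof -
  obtain a n where a: "a < m" "sublist (map (\<lambda>k. x (i + int k)) [0..<1]) (iter \<zeta> n [a])"
    using assms unfolding subst_space_def by blast
  then have "x i \<in> set (iter \<zeta> n [a])"
    by (auto dest: set_mono_sublist)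
  then show ?thesis using iter_letters[OF subst, of "[a]" n] a(1) by auto
qed

lemma shift_subst_space: "x \<in> subst_space m \<zeta> \<Longrightarrow> shift n x \<in> subst_space m \<zeta>"
  unfolding subst_space_def shift_def
proof (intro CollectI allI)
  fix i l
  assume "x \<in> {x. \<forall>i l. \<exists>a<m. \<exists>n. sublist (map (\<lambda>k. x (i + int k)) [0..<l]) (iter \<zeta> n [a])}"
  then have "\<exists>a<m. \<exists>k. sublist (map (\<lambda>k. x (i + n + int k)) [0..<l]) (iter \<zeta> k [a])" by blast
  then show "\<exists>a<m. \<exists>na. sublist (map (\<lambda>k. x (i + int k + n)) [0..<l]) (iter \<zeta> na [a])"
    by (simp add: add_ac)
qed

lemma roof_subst_space: "x \<in> subst_space m \<zeta> \<Longrightarrow> roof s x \<delta>"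
  using \<delta> by unfold_locales (auto intro: subst_space_letter)

lemma suspension_eq:
  "suspension m \<zeta> s = {(x, t). x \<in> subst_space m \<zeta> \<and> 0 \<le> t \<and> t < s (x 0)}"
proof (intro Set.set_eqI iffI)
  fix z assume "z \<in> suspension m \<zeta> s"
  then obtain x t where x: "z = susp_rep s (x, t)" "x \<in> subst_space m \<zeta>" "0 \<le> t" "t \<le> s (x 0)"
    by (auto simp: suspension_def)
  interpret roof s x \<delta> by (rule roof_subst_space) fact
  show "z \<in> {(x, t). x \<in> subst_space m \<zeta> \<and> 0 \<le> t \<and> t < s (x 0)}"
    using x roof_index_bounds[of t] roof_sum_add_1[of s x "roof_index s x t"] shift_subst_space
    by (simp add: susp_rep_eq) (simp add: shift_def)
next
  fix z assume "z \<in> {(x, t). x \<in> subst_space m \<zeta> \<and> 0 \<le> t \<and> t < s (x 0)}"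
  then obtain x t where x: "z = (x, t)" "x \<in> subst_space m \<zeta>" "0 \<le> t" "t < s (x 0)" by auto
  interpret roof s x \<delta> by (rule roof_subst_space) fact
  show "z \<in> suspension m \<zeta> s"
    unfolding suspension_def using x susp_rep_id[of t] by (auto intro!: image_eqI[of _ _ "(x, t)"])
qed

text \<open>The tower over \<open>a\<close> is taken with its top. A top point is identified with
  the bottom of the next tower, whence the extra points with \<open>t = 0\<close> and previous
  letter \<open>a\<close>.\<close>

lemma susp_cylinder_eq:
  "susp_cylinder m \<zeta> s a =
     {(x, t). x \<in> subst_space m \<zeta> \<and> 0 \<le> t \<and> t < s (x 0) \<and> (x 0 = a \<or> t = 0 \<and> x (- 1) = a)}"
proof (intro Set.set_eqI iffI)
  fix z assume "z \<in> susp_cylinder m \<zeta> s a"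
  then obtain x t where x: "z = susp_rep s (x, t)" "x \<in> subst_space m \<zeta>" "x 0 = a" "0 \<le> t" "t \<le> s (x 0)"
    by (auto simp: susp_cylinder_def)
  interpret roof s x \<delta> by (rule roof_subst_space) fact
  show "z \<in> {(x, t). x \<in> subst_space m \<zeta> \<and> 0 \<le> t \<and> t < s (x 0) \<and> (x 0 = a \<or> t = 0 \<and> x (- 1) = a)}"
  proof (cases "t < s (x 0)")
    case True
    then show ?thesis using x susp_rep_id[of t] by simp
  next
    case False
    then have "z = (shift 1 x, 0)" using x susp_rep_top by simp
    moreover have "0 < s (x 1)" using roof_ge[of 1] \<delta> by simp
    ultimately show ?thesis using x shift_subst_space[of x 1] by (simp add: shift_def)
  qed
next
  fix z assume "z \<in> {(x, t). x \<in> subst_space m \<zeta> \<and> 0 \<le> t \<and> t < s (x 0) \<and> (x 0 = a \<or> t = 0 \<and> x (- 1) = a)}"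
  then obtain x t where x: "z = (x, t)" "x \<in> subst_space m \<zeta>" "0 \<le> t" "t < s (x 0)"
    "x 0 = a \<or> t = 0 \<and> x (- 1) = a" by auto
  show "z \<in> susp_cylinder m \<zeta> s a"
  proof (cases "x 0 = a")
    case True
    interpret roof s x \<delta> by (rule roof_subst_space) fact
    show ?thesis
      unfolding susp_cylinder_def using x True susp_rep_id[of t]
      by (auto intro!: image_eqI[of _ _ "(x, t)"])
  next
    case False
    let ?y = "shift (- 1) x"
    have y: "?y \<in> subst_space m \<zeta>" by (rule shift_subst_space) fact
    interpret roof s ?y \<delta> by (rule roof_subst_space) fact
    have y0: "?y 0 = a" using x False by (simp add: shift_def)
    have "susp_rep s (?y, s a) = z"
      using susp_rep_top x False unfolding y0 by simp
    moreover have "0 \<le> s a" using roof_ge[of 0] y0 \<delta> by simp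
    ultimately show ?thesis
      unfolding susp_cylinder_def using y y0 by (intro image_eqI[of _ _ "(?y, s a)"]) auto
  qed
qed

lemma susp_rep_in_cylinder_iff:
  assumes "x \<in> subst_space m \<zeta>"
  shows "susp_rep s (x, y) \<in> susp_cylinder m \<zeta> s a \<longleftrightarrow>
    x (roof_index s x y) = a \<or> y = roof_sum s x (roof_index s x y) \<and> x (roof_index s x y - 1) = a"
proof -
  interpret roof s x \<delta> by (rule roof_subst_space) fact
  have "0 \<le> y - roof_sum s x (roof_index s x y)"
    "y - roof_sum s x (roof_index s x y) < s (x (roof_index s x y))"
    using roof_index_bounds[of y] roof_sum_add_1[of s x "roof_index s x y"] by simp_all
  then show ?thesis
    using shift_subst_space[OF assms] unfolding susp_rep_eq susp_cylinder_eq
    by (auto simp: shift_def)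
qed

text \<open>The sigma-algebra is a trace, so it is enough to exhibit a Borel set of the product
  space that cuts out the cylinder; conditions on single letters and on the height are
  closed.\<close>

lemma susp_cylinder_sets:
  "susp_cylinder m \<zeta> s a \<in> sets (restrict_space borel (suspension m \<zeta> s))"
proof -
  have "closed {z :: (int \<Rightarrow> nat) \<times> real. fst z i = a}" for i
    by (intro closed_Collect_eq continuous_on_const
        continuous_on_compose2[OF continuous_on_product_coordinates continuous_on_fst[OF continuous_on_id]]) auto
  moreover have "closed {z :: (int \<Rightarrow> nat) \<times> real. snd z = 0}"
    by (intro closed_Collect_eq continuous_intros)
  ultimately have "{z :: (int \<Rightarrow> nat) \<times> real. fst z 0 = a} \<union> ({z. fst z (- 1) = a} \<inter> {z. snd z = 0}) \<in> sets borel"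
    by (intro borel_closed closed_Un closed_Int)
  moreover have "susp_cylinder m \<zeta> s a = suspension m \<zeta> s \<inter>
      ({z. fst z 0 = a} \<union> ({z. fst z (- 1) = a} \<inter> {z. snd z = 0}))"
    unfolding suspension_eq susp_cylinder_eq by auto
  ultimately show ?thesis
    unfolding sets_restrict_space by blast
qed

lemma susp_flow_add:
  assumes "z \<in> suspension m \<zeta> s"
  shows "susp_flow s a (susp_flow s b z) = susp_flow s (a + b) z"
proof -
  obtain x t where x: "z = (x, t)" "x \<in> subst_space m \<zeta>" using assms by (auto simp: suspension_eq)
  interpret roof s x \<delta> by (rule roof_subst_space) fact
  show ?thesis
    using susp_flow_susp_rep[of a "t + b"] by (simp add: x susp_flow_def[of s b] susp_flow_def[of s "a + b"] add_ac)
qed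

text \<open>Dividing the telescoped orbit sum by \<open>1 - e\<close> costs the factor
  \<open>1 / (pi * \<bar>\<omega>\<bar> * h)\<close>, which is where frequencies near 0 become
  expensive. What remains are twisted sums of factors whose length is at most the elapsed time over
  \<delta>; the 1 in \<open>1 + real J * h\<close> allows for the starting height.\<close>

lemma spectral_measure_le:
  assumes s1: "\<And>b. b < m \<Longrightarrow> s b \<le> 1"
    and \<mu>: "invariant_prob m \<zeta> s \<mu>"
    and \<sigma>: "is_spectral_measure \<mu> (susp_flow s) (indicator (susp_cylinder m \<zeta> s a)) \<sigma>"
    and J: "J \<ge> 1" "h > 0" "r \<ge> 0" "real J * h * r \<le> 1 / 6"
    and \<omega>: "\<omega> \<noteq> 0" "2 * pi * \<bar>\<omega>\<bar> * h \<le> 1"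
    and T: "\<And>x N. x \<in> subst_space m \<zeta> \<Longrightarrow> real N * \<delta> \<le> 1 + real J * h \<Longrightarrow>
      cmod (twisted_sum \<omega> s a (map (\<lambda>j. x (int j)) [0..<N])) \<le> T"
  shows "measure \<sigma> {\<omega> - r..\<omega> + r} \<le>
    (2 * ((2 * T + 4 + (1 + real J * h) / \<delta> * (4 * pi * \<bar>\<omega>\<bar> * h)) / (pi * \<bar>\<omega>\<bar> * h)) / real J)\<^sup>2"
proof (rule spectral_measure_interval_le[where \<mu> = \<mu> and H = "susp_flow s" and A = "susp_cylinder m \<zeta> s a"])
  show "prob_space \<mu>" "\<And>t. susp_flow s t \<in> \<mu> \<rightarrow>\<^sub>M \<mu>" "\<And>t. distr \<mu> \<mu> (susp_flow s t) = \<mu>"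
    using \<mu> by (auto simp: invariant_prob_def)
  have sets: "sets \<mu> = sets (restrict_space borel (suspension m \<zeta> s))"
    using \<mu> by (simp add: invariant_prob_def)
  have space: "space \<mu> = suspension m \<zeta> s"
    using sets_eq_imp_space_eq[OF sets] by (simp add: space_restrict_space)
  show "susp_cylinder m \<zeta> s a \<in> sets \<mu>"
    unfolding sets by (rule susp_cylinder_sets)
  show "susp_flow s a (susp_flow s b z) = susp_flow s (a + b) z" if "z \<in> space \<mu>" for a b z
    using that susp_flow_add by (simp add: space)
  show "is_spectral_measure \<mu> (susp_flow s) (indicator (susp_cylinder m \<zeta> s a)) \<sigma>" by fact
  show "cmod (\<Sum>j<J. cis (- (2 * pi * \<omega> * h)) ^ j *
      indicator (susp_cylinder m \<zeta> s a) (susp_flow s (real j * h) z)) \<le>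
      (2 * T + 4 + (1 + real J * h) / \<delta> * (4 * pi * \<bar>\<omega>\<bar> * h)) / (pi * \<bar>\<omega>\<bar> * h)"
    if z: "z \<in> space \<mu>" for z
  proof -
    obtain x t where x: "z = (x, t)" "x \<in> subst_space m \<zeta>" "0 \<le> t" "t < s (x 0)"
      using z by (auto simp: space suspension_eq)
    interpret roof s x \<delta> by (rule roof_subst_space) fact
    let ?e = "cis (- (2 * pi * \<omega> * h))"
    let ?S = "\<Sum>j<J. ?e ^ j * indicator (susp_cylinder m \<zeta> s a) (susp_flow s (real j * h) z)"
    let ?K = "4 * pi * \<bar>\<omega>\<bar> * h"
    have f: "indicator (susp_cylinder m \<zeta> s a) (susp_flow s (real j * h) z) =
        of_bool (x (roof_index s x (t + real j * h)) = a \<or>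
          t + real j * h = roof_sum s x (roof_index s x (t + real j * h)) \<and>
          x (roof_index s x (t + real j * h) - 1) = a)" for j
      unfolding x(1) susp_flow_def prod.case indicator_def susp_rep_in_cylinder_iff[OF x(2)] ..
    obtain N where N: "real N * \<delta> \<le> t + real J * h"
      "cmod ((1 - ?e) * ?S) \<le> 2 * cmod (twisted_sum \<omega> s a (map (\<lambda>j. x (int j)) [0..<N])) + 4 + real N * ?K"
      by (rule norm_orbit_sum_le[OF x(3,4) J(2) refl f])
    have "t \<le> 1" using x(4) s1[OF subst_space_letter[OF x(2), of 0]] by simp
    then have N1: "real N * \<delta> \<le> 1 + real J * h" using N(1) by linarith
    then have "real N \<le> (1 + real J * h) / \<delta>" using \<delta> by (simp add: pos_le_divide_eq)
    then have "real N * ?K \<le> (1 + real J * h) / \<delta> * ?K"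
      using J by (intro mult_right_mono) auto
    then have up: "cmod (1 - ?e) * cmod ?S \<le> 2 * T + 4 + (1 + real J * h) / \<delta> * ?K"
      using N(2) T[OF x(2) N1] by (simp only: norm_mult)
    have "\<bar>- (2 * pi * \<omega> * h)\<bar> = 2 * pi * \<bar>\<omega>\<bar> * h"
      using J by (simp add: abs_mult)
    then have lo: "pi * \<bar>\<omega>\<bar> * h \<le> cmod (1 - ?e)"
      using norm_cis_minus_1_ge[of "- (2 * pi * \<omega> * h)"] \<omega>(2) by (simp add: norm_minus_commute)
    have "cmod ?S * (pi * \<bar>\<omega>\<bar> * h) \<le> cmod ?S * cmod (1 - ?e)"
      using lo by (intro mult_left_mono) auto
    also have "\<dots> \<le> 2 * T + 4 + (1 + real J * h) / \<delta> * ?K"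
      using up by (simp add: mult.commute)
    finally show ?thesis
      using J \<omega> by (simp add: pos_le_divide_eq)
  qed
qed (use J in auto)

end

section \<open>Integer recurrences with irreducible characteristic polynomial\<close>

text \<open>The polynomial \<open>r\<close> evaluated at the shift operator and applied to the
  sequence \<open>f\<close>. Sequences become a module over the polynomial ring, so that
  divisibility and Bezout identities can act on them.\<close>

definition poly_shift :: "'a::comm_ring_1 poly \<Rightarrow> (nat \<Rightarrow> 'a) \<Rightarrow> nat \<Rightarrow> 'a" where
  "poly_shift r f n = (\<Sum>i\<le>degree r. coeff r i * f (n + i))"

lemma poly_shift_upto: "degree r \<le> d \<Longrightarrow> poly_shift r f n = (\<Sum>i\<le>d. coeff r i * f (n + i))"
  unfolding poly_shift_def by (rule sum.mono_neutral_left) (auto simp: coeff_eq_0)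

lemma poly_shift_0 [simp]: "poly_shift 0 f n = 0"
  by (simp add: poly_shift_def)

lemma poly_shift_1 [simp]: "poly_shift 1 f n = f n"
  by (simp add: poly_shift_def)

lemma poly_shift_add: "poly_shift (r + s) f n = poly_shift r f n + poly_shift s f n"
proof -
  let ?d = "max (degree r) (degree s)"
  have "poly_shift (r + s) f n = (\<Sum>i\<le>?d. coeff (r + s) i * f (n + i))"
    by (rule poly_shift_upto) (rule degree_add_le_max)
  also have "\<dots> = poly_shift r f n + poly_shift s f n"
    by (simp add: poly_shift_upto[of r ?d] poly_shift_upto[of s ?d] sum.distrib algebra_simps)
  finally show ?thesis .
qed

lemma poly_shift_zero: "(\<And>n. f n = 0) \<Longrightarrow> poly_shift r f n = 0"
  by (simp add: poly_shift_def)

lemma poly_shift_smult: "poly_shift (Polynomial.smult c r) f n = c * poly_shift r f n"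
  by (subst poly_shift_upto[of _ "degree r"]) (auto simp: degree_smult_le poly_shift_def sum_distrib_left ac_simps)

lemma poly_shift_diff: "poly_shift (r - s) f n = poly_shift r f n - poly_shift s f n"
proof -
  have "poly_shift (- s) f n = - poly_shift s f n" by (simp add: poly_shift_def sum_negf)
  then show ?thesis using poly_shift_add[of r "- s" f n] by simp
qed

lemma poly_shift_pCons: "poly_shift (pCons a r) f n = a * f n + poly_shift r f (Suc n)"
proof -
  have "poly_shift (pCons a r) f n = (\<Sum>i\<le>Suc (degree r). coeff (pCons a r) i * f (n + i))"
    by (rule poly_shift_upto) (rule degree_pCons_le)
  then show ?thesis
    by (simp add: sum.atMost_Suc_shift poly_shift_def del: sum.atMost_Suc)
qed

lemma poly_shift_mult: "poly_shift (r * s) f n = poly_shift r (poly_shift s f) n"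
proof (induction r arbitrary: n)
  case (pCons a r)
  then show ?case
    by (simp add: mult_pCons_left poly_shift_add poly_shift_smult poly_shift_pCons)
qed simp

lemma poly_shift_sum_poly: "poly_shift (\<Sum>i\<in>A. g i) f n = (\<Sum>i\<in>A. poly_shift (g i) f n)"
  by (induction A rule: infinite_finite_induct) (auto simp: poly_shift_add)

lemma poly_shift_sum: "poly_shift r (\<lambda>n. \<Sum>i\<in>A. c i * F i n) n = (\<Sum>i\<in>A. c i * poly_shift r (F i) n)"
  unfolding poly_shift_def sum_distrib_left
  by (subst sum.swap) (simp add: ac_simps)

text \<open>Cayley-Hamilton for sequences: with the variable acting as the shift, every row of the
  characteristic matrix annihilates \<open>p\<close>, and multiplication by the adjugate leaves the
  characteristic polynomial acting on a single coordinate.\<close>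

lemma poly_shift_char_poly:
  fixes S :: "'a::comm_ring_1 mat"
  assumes S: "S \<in> carrier_mat m m"
    and p: "\<And>n b. b < m \<Longrightarrow> p (Suc n) b = (\<Sum>d<m. S $$ (b, d) * p n d)"
    and b: "b < m"
  shows "poly_shift (char_poly S) (\<lambda>n. p n b) n = 0"
proof -
  let ?M = "char_poly_matrix S"
  let ?A = "adj_mat ?M"
  have M: "?M \<in> carrier_mat m m" using S by simp
  have A: "?A \<in> carrier_mat m m" by (rule adj_mat(1)[OF M])
  have zero: "(\<Sum>j<m. poly_shift (?M $$ (k, j)) (\<lambda>n. p n j) n) = 0" if "k < m" for k n
  proof -
    have "poly_shift (?M $$ (k, j)) (\<lambda>n. p n j) n = (if j = k then p (Suc n) k else 0) - S $$ (k, j) * p n j"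
      if "j < m" for j
      using that \<open>k < m\<close> S by (auto simp: char_poly_matrix_def poly_shift_pCons)
    then have "(\<Sum>j<m. poly_shift (?M $$ (k, j)) (\<lambda>n. p n j) n) =
        (\<Sum>j<m. (if j = k then p (Suc n) k else 0) - S $$ (k, j) * p n j)"
      by (intro sum.cong) auto
    also have "\<dots> = 0"
      using \<open>k < m\<close> by (simp add: sum_subtractf p)
    finally show ?thesis .
  qed
  have ent: "(\<Sum>k<m. ?A $$ (b, k) * ?M $$ (k, j)) = (if j = b then char_poly S else 0)" if "j < m" for j
  proof -
    have "(?A * ?M) $$ (b, j) = (\<Sum>k<m. ?A $$ (b, k) * ?M $$ (k, j))"
      using A M b that by (simp add: scalar_prod_def lessThan_atLeast0)
    then show ?thesis
      using adj_mat(3)[OF M] b that by (auto simp: char_poly_def)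
  qed
  have "poly_shift (char_poly S) (\<lambda>n. p n b) n =
      (\<Sum>j<m. poly_shift (if j = b then char_poly S else 0) (\<lambda>n. p n j) n)"
    using b by (simp add: if_distrib[of "\<lambda>r. poly_shift r _ _"] cong: if_cong)
  also have "\<dots> = (\<Sum>j<m. \<Sum>k<m. poly_shift (?A $$ (b, k)) (poly_shift (?M $$ (k, j)) (\<lambda>n. p n j)) n)"
    by (intro sum.cong) (auto simp flip: ent poly_shift_mult simp: poly_shift_sum_poly)
  also have "\<dots> = (\<Sum>k<m. poly_shift (?A $$ (b, k)) (\<lambda>n. \<Sum>j<m. 1 * poly_shift (?M $$ (k, j)) (\<lambda>n. p n j) n) n)"
    unfolding poly_shift_sum by (subst sum.swap) simp
  also have "\<dots> = 0"
    by (simp add: zero) (simp add: poly_shift_def)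
  finally show ?thesis .
qed


section \<open>Consequences of irreducibility\<close>

lemma irreducible_imp_coprime:
  assumes "irreducible a" "\<not> a dvd b"
  shows "coprime a b"
  using assms by (meson coprimeI dvd_trans irreducibleD')

text \<open>In other terms, the first \<open>m\<close> vectors \<open>p n\<close> are linearly
  independent over the complex numbers. Their determinant is an integer, so a complex dependence
  yields a rational one; its polynomial \<open>q\<close> annihilates the whole sequence and is
  coprime to the characteristic polynomial. By Bezout the polynomial 1 annihilates the sequence too,
  contradicting \<open>p 0 b0 \<noteq> 0\<close>.\<close>

lemma nonzero_act_of_irreducible:
  fixes S :: "int mat" and p :: "nat \<Rightarrow> nat \<Rightarrow> int" and r :: "complex poly"
  assumes S: "S \<in> carrier_mat m m"
    and p: "\<And>n b. b < m \<Longrightarrow> p (Suc n) b = (\<Sum>d<m. S $$ (b, d) * p n d)"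
    and irr: "irreducible (char_poly (map_mat rat_of_int S))"
    and p0: "b0 < m" "p 0 b0 \<noteq> 0"
    and r: "r \<noteq> 0" "degree r < m"
  shows "\<exists>b<m. poly_shift r (\<lambda>n. of_int (p n b)) 0 \<noteq> 0"
proof (rule ccontr)
  assume "\<not> ?thesis"
  then have r0: "poly_shift r (\<lambda>n. of_int (p n b)) 0 = 0" if "b < m" for b
    using that by blast
  define M where "M = mat m m (\<lambda>(b, j). p j b)"
  have M: "M \<in> carrier_mat m m" by (simp add: M_def)
  have "det (map_mat complex_of_int M) = 0"
  proof -
    let ?v = "Matrix.vec m (coeff r)"
    have "coeff r (degree r) \<noteq> 0" using r by simp
    then have "?v \<noteq> 0\<^sub>v m"
      using r by (metis index_vec index_zero_vec(1))
    moreover have "map_mat complex_of_int M *\<^sub>v ?v = 0\<^sub>v m"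
    proof (rule eq_vecI)
      fix b assume "b < dim_vec (0\<^sub>v m :: complex Matrix.vec)"
      then have b: "b < m" by simp
      have *: "{..<m} = {..m - 1}" using b by auto
      have "(map_mat complex_of_int M *\<^sub>v ?v) $ b = (\<Sum>j<m. of_int (p j b) * coeff r j)"
        using b by (simp add: M_def scalar_prod_def lessThan_atLeast0)
      also have "\<dots> = poly_shift r (\<lambda>n. of_int (p n b)) 0"
        unfolding * using r by (subst poly_shift_upto[of _ "m - 1"]) (auto simp: mult.commute)
      finally show "(map_mat complex_of_int M *\<^sub>v ?v) $ b = 0\<^sub>v m $ b"
        using r0 b by simp
    qed (simp add: M_def)
    ultimately show ?thesis
      using M by (subst det_0_iff_vec_prod_zero[of _ m]) (auto intro!: exI[of _ ?v])
  qed
  then have "det M = 0" by simp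
  then have "det (map_mat rat_of_int M) = 0" by simp
  then obtain v where v: "v \<in> carrier_vec m" "v \<noteq> 0\<^sub>v m" "map_mat rat_of_int M *\<^sub>v v = 0\<^sub>v m"
    using M by (subst (asm) det_0_iff_vec_prod_zero[of _ m]) auto
  define q where "q = (\<Sum>j<m. Polynomial.monom (v $ j) j)"
  define p' where "p' = (\<lambda>n b. rat_of_int (p n b))"
  have cq: "coeff q j = (if j < m then v $ j else 0)" for j
    by (auto simp: q_def coeff_sum)
  have dq: "degree q < m"
    using p0 by (intro degree_lessI) (auto simp: cq)
  have q: "q \<noteq> 0"
  proof
    assume "q = 0"
    then have "v $ j = 0" if "j < m" for j
      using cq[of j] that by simp
    then show False using v by auto
  qed
  have q0: "poly_shift q (\<lambda>n. p' n b) 0 = 0" if "b < m" for b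
  proof -
    have *: "{..<m} = {..m - 1}" using that by auto
    have "poly_shift q (\<lambda>n. p' n b) 0 = (\<Sum>j<m. of_int (p j b) * v $ j)"
      unfolding * using dq that by (subst poly_shift_upto[of _ "m - 1"]) (auto simp: mult.commute cq p'_def intro!: sum.cong)
    also have "\<dots> = (map_mat rat_of_int M *\<^sub>v v) $ b"
      using that v(1) by (simp add: M_def scalar_prod_def lessThan_atLeast0)
    finally show ?thesis using v(3) that by simp
  qed
  let ?S = "map_mat rat_of_int S"
  have S': "?S \<in> carrier_mat m m" using S by simp
  have p': "p' (Suc n) b = (\<Sum>d<m. ?S $$ (b, d) * p' n d)" if "b < m" for n b
    using p[of b n] that S by (simp add: p'_def)
  \<comment> \<open>The recurrence is linear with constant coefficients, so annihilation of all
    coordinates at one time passes to the next.\<close>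
  have qn: "poly_shift q (\<lambda>n. p' n b) n = 0" if "b < m" for b n
    using that
  proof (induction n arbitrary: b)
    case (Suc n)
    have "poly_shift q (\<lambda>n. p' n b) (Suc n) = poly_shift q (\<lambda>n. p' (Suc n) b) n"
      by (simp add: poly_shift_def)
    also have "\<dots> = (\<Sum>d<m. ?S $$ (b, d) * poly_shift q (\<lambda>n. p' n d) n)"
      using Suc.prems by (simp add: p' poly_shift_sum)
    also have "\<dots> = 0" using Suc.IH by simp
    finally show ?case .
  qed (simp add: q0)
  let ?c = "char_poly ?S"
  have cn: "poly_shift ?c (\<lambda>n. p' n b) n = 0" if "b < m" for b n
    using S' p' that by (intro poly_shift_char_poly[where S = ?S and p = p']) auto
  have "\<not> ?c dvd q"
    using dvd_imp_degree_le[of ?c q] q dq degree_monic_char_poly[OF S'] by auto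
  then have "coprime ?c q"
    using irr irreducible_imp_coprime by blast
  then obtain u w where uw: "u * ?c + w * q = 1"
    using bezout_coefficients_fst_snd[of ?c q] by auto
  have "p' 0 b0 = poly_shift (u * ?c + w * q) (\<lambda>n. p' n b0) 0"
    by (simp add: uw)
  also have "\<dots> = 0"
    using cn[OF p0(1)] qn[OF p0(1)] by (simp add: poly_shift_add poly_shift_mult poly_shift_zero)
  finally show False using p0 by (simp add: p'_def)
qed

text \<open>Cancelling the linear factor of a root from the characteristic polynomial leaves a
  polynomial whose action on \<open>p\<close> is geometric with that root as ratio; its coefficients
  are \<open>q1\<close> or \<open>q2\<close>. In this form the functional is computed from
  \<open>m\<close> consecutive integer vectors, so rounded values can be inserted later.\<close>

lemma eigenfunctionals_of_irreducible:
  fixes S :: "int mat" and p :: "nat \<Rightarrow> nat \<Rightarrow> int" and \<theta>1 \<theta>2 :: complex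
  assumes S: "S \<in> carrier_mat m m"
    and p: "\<And>n b. b < m \<Longrightarrow> p (Suc n) b = (\<Sum>d<m. S $$ (b, d) * p n d)"
    and irr: "irreducible (char_poly (map_mat rat_of_int S))"
    and p0: "b0 < m" "p 0 b0 \<noteq> 0"
    and root: "poly (char_poly (map_mat of_int S)) \<theta>1 = 0" "poly (char_poly (map_mat of_int S)) \<theta>2 = 0"
    and neq: "\<theta>1 \<noteq> \<theta>2"
  obtains q1 q2 L1 L2 :: "nat \<Rightarrow> complex"
  where "\<And>n b. b < m \<Longrightarrow> (\<Sum>j<m. q1 j * of_int (p (n + j) b)) = \<theta>1 ^ n * L1 b"
    and "\<And>n b. b < m \<Longrightarrow> (\<Sum>j<m. q2 j * of_int (p (n + j) b)) = \<theta>2 ^ n * L2 b"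
    and "\<exists>b<m. \<exists>d<m. L1 b * L2 d \<noteq> L1 d * L2 b"
proof -
  let ?S = "map_mat complex_of_int S"
  let ?c = "char_poly ?S"
  define p' where "p' = (\<lambda>n b. complex_of_int (p n b))"
  have S': "?S \<in> carrier_mat m m" using S by simp
  have p': "p' (Suc n) b = (\<Sum>d<m. ?S $$ (b, d) * p' n d)" if "b < m" for n b
    using p[of b n] that S by (simp add: p'_def)
  have cn: "poly_shift ?c (\<lambda>n. p' n b) n = 0" if "b < m" for b n
    using S' p' that by (intro poly_shift_char_poly[where S = ?S and p = p']) auto
  have dc: "degree ?c = m" and lc: "lead_coeff ?c = 1"
    using degree_monic_char_poly[OF S'] by auto
  then have c0: "?c \<noteq> 0" by auto
  obtain Q1 Q2 where Q1: "?c = [:- \<theta>1, 1:] * Q1" and Q2: "?c = [:- \<theta>2, 1:] * Q2"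
    using root by (auto simp: poly_eq_0_iff_dvd elim!: dvdE)
  have Qnz: "Q1 \<noteq> 0" "Q2 \<noteq> 0"
    using c0 Q1 Q2 by auto
  have dQ: "Suc (degree Q1) = m" "Suc (degree Q2) = m"
    using dc[unfolded Q1] dc[unfolded Q2] Qnz by (simp_all add: degree_mult_eq del: mult_pCons_left)
  have eig: "poly_shift Q (\<lambda>n. p' n b) n = \<theta> ^ n * poly_shift Q (\<lambda>n. p' n b) 0"
    if Q: "?c = [:- \<theta>, 1:] * Q" and b: "b < m" for Q \<theta> n b
  proof (induction n)
    case (Suc n)
    have "0 = poly_shift ([:- \<theta>, 1:] * Q) (\<lambda>n. p' n b) n"
      using cn[OF b] Q by simp
    also have "\<dots> = poly_shift Q (\<lambda>n. p' n b) (Suc n) - \<theta> * poly_shift Q (\<lambda>n. p' n b) n"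
      by (simp add: poly_shift_mult poly_shift_pCons del: mult_pCons_left)
    finally show ?case using Suc by simp
  qed simp
  have sum: "poly_shift Q f n = (\<Sum>j<m. coeff Q j * f (n + j))" if "Suc (degree Q) = m" for Q f and n
    using that by (auto simp: poly_shift_def lessThan_Suc_atMost)
  define L where "L = (\<lambda>Q b. poly_shift Q (\<lambda>n. p' n b) 0)"
  have nz: "\<exists>b<m. L r b \<noteq> 0" if "r \<noteq> 0" "degree r < m" for r
    unfolding L_def p'_def by (rule nonzero_act_of_irreducible[OF S p irr p0 that])
  have "\<exists>b<m. \<exists>d<m. L Q1 b * L Q2 d \<noteq> L Q1 d * L Q2 b"
  proof (rule ccontr)
    assume "\<not> ?thesis"
    then have minor: "L Q1 b * L Q2 d = L Q1 d * L Q2 b" if "b < m" "d < m" for b d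
      using that by blast
    obtain b where b: "b < m" "L Q1 b \<noteq> 0"
      using nz[OF Qnz(1)] dQ by auto
    \<comment> \<open>If all minors vanished, this combination would act as 0 on every coordinate
      and hence be the zero polynomial. Multiplied by both linear factors it becomes a linear
      polynomial times the characteristic polynomial, which forces
      \<open>\<theta>1 = \<theta>2\<close>.\<close>
    define r where "r = Polynomial.smult (L Q1 b) Q2 + Polynomial.smult (- L Q2 b) Q1"
    have "L r d = 0" if "d < m" for d
      using minor[OF b(1) that] by (simp add: L_def r_def poly_shift_diff poly_shift_smult)
    moreover have "degree r < m"
      unfolding r_def using dQ
      by (intro degree_add_less) (auto intro: le_less_trans[OF degree_smult_le])
    ultimately have "r = 0"
      using nz by blast
    then have "[:- \<theta>1, 1:] * [:- \<theta>2, 1:] * r = 0" by simp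
    moreover have "[:- \<theta>1, 1:] * [:- \<theta>2, 1:] * r =
        Polynomial.smult (L Q1 b) ([:- \<theta>1, 1:] * ([:- \<theta>2, 1:] * Q2)) +
        Polynomial.smult (- L Q2 b) ([:- \<theta>2, 1:] * ([:- \<theta>1, 1:] * Q1))"
      unfolding r_def by (simp only: distrib_left mult_smult_right mult_smult_left ac_simps)
    moreover have "\<dots> = (Polynomial.smult (L Q1 b) [:- \<theta>1, 1:] + Polynomial.smult (- L Q2 b) [:- \<theta>2, 1:]) * ?c"
      unfolding Q1[symmetric] Q2[symmetric] by (simp only: distrib_right mult_smult_left)
    ultimately have "Polynomial.smult (L Q1 b) [:- \<theta>1, 1:] + Polynomial.smult (- L Q2 b) [:- \<theta>2, 1:] = 0"
      using c0 by (metis mult_eq_0_iff)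
    then show False using b neq by (auto simp: algebra_simps)
  qed
  then show ?thesis
    using that[of "coeff Q1" "L Q1" "coeff Q2" "L Q2"] eig[OF Q1] eig[OF Q2] sum[OF dQ(1)] sum[OF dQ(2)]
    by (simp add: L_def p'_def)
qed

text \<open>Separability in characteristic 0: the polynomial is coprime to its derivative, and the
  Bezout identity, mapped to the complex numbers and evaluated at a double root, would give 0 =
  1.\<close>

lemma distinct_roots_of_irreducible:
  fixes \<theta> :: "complex list"
  assumes S: "S \<in> carrier_mat m m" and m: "m \<ge> 2"
    and irr: "irreducible (char_poly (map_mat rat_of_int S))"
    and \<theta>: "char_poly (map_mat complex_of_int S) = (\<Prod>e\<leftarrow>\<theta>. [:- e, 1:])"
  obtains \<theta>1 \<theta>2 \<theta>' where "\<theta> = \<theta>1 # \<theta>2 # \<theta>'" "\<theta>1 \<noteq> \<theta>2"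
    "poly (char_poly (map_mat of_int S)) \<theta>1 = 0" "poly (char_poly (map_mat of_int S)) \<theta>2 = 0"
proof -
  let ?S = "map_mat complex_of_int S" and ?T = "map_mat rat_of_int S"
  have S': "?S \<in> carrier_mat m m" "?T \<in> carrier_mat m m" using S by simp_all
  have "degree (\<Prod>e\<leftarrow>\<theta>. [:- e, 1:]) = length \<theta>"
  proof (induction \<theta>)
    case (Cons e \<theta>)
    have "(\<Prod>e\<leftarrow>\<theta>. [:- e, 1:]) \<noteq> 0" by (auto simp: prod_list_zero_iff)
    then have "degree ([:- e, 1:] * (\<Prod>e\<leftarrow>\<theta>. [:- e, 1:])) = 1 + degree (\<Prod>e\<leftarrow>\<theta>. [:- e, 1:])"
      by (subst degree_mult_eq) auto
    then show ?case using Cons by simp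
  qed simp
  then have "length \<theta> = m"
    using degree_monic_char_poly[OF S'(1)] \<theta> by simp
  then obtain \<theta>1 \<theta>2 \<theta>' where \<theta>': "\<theta> = \<theta>1 # \<theta>2 # \<theta>'"
    using m by (cases \<theta>; cases "tl \<theta>") auto
  have "\<theta>1 \<noteq> \<theta>2"
  proof
    assume eq: "\<theta>1 = \<theta>2"
    let ?c = "char_poly ?T"
    have dc: "degree ?c = m" using degree_monic_char_poly[OF S'(2)] by simp
    have "pderiv ?c \<noteq> 0" "degree (pderiv ?c) < degree ?c"
      using dc m by (auto simp: pderiv_eq_0_iff degree_pderiv)
    then have "\<not> ?c dvd pderiv ?c"
      using dvd_imp_degree_le[of ?c "pderiv ?c"] by auto
    then have "coprime ?c (pderiv ?c)"
      using irr irreducible_imp_coprime by blast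
    then obtain u w where uw: "u * ?c + w * pderiv ?c = 1"
      using bezout_coefficients_fst_snd[of ?c "pderiv ?c"] by auto
    interpret h: field_hom "of_rat :: rat \<Rightarrow> complex"
      by unfold_locales (auto simp: of_rat_add of_rat_mult)
    interpret hp: map_poly_comm_ring_hom "of_rat :: rat \<Rightarrow> complex" ..
    have c: "map_poly of_rat ?c = char_poly ?S"
    proof -
      have "map_mat of_rat ?T = ?S" by (intro eq_matI) auto
      then show ?thesis by (metis of_rat_hom.char_poly_hom[OF S'(2)])
    qed
    define R where "R = (\<Prod>e\<leftarrow>\<theta>'. [:- e, 1:])"
    have cS: "char_poly ?S = [:- \<theta>1, 1:] * ([:- \<theta>1, 1:] * R)"
      unfolding \<theta> \<theta>' R_def by (simp add: eq del: mult_pCons_left)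
    have pd: "pderiv (map_poly of_rat q) = (map_poly of_rat (pderiv q) :: complex poly)" for q
      by (rule poly_eqI) (simp add: coeff_pderiv of_rat_mult of_rat_add)
    have "map_poly of_rat (u * ?c + w * pderiv ?c) = (1 :: complex poly)"
      unfolding uw by simp
    then have "map_poly of_rat u * char_poly ?S + map_poly of_rat w * pderiv (char_poly ?S) = (1 :: complex poly)"
      by (simp add: hp.hom_add hp.hom_mult c flip: pd)
    then have "poly (map_poly of_rat u * char_poly ?S + map_poly of_rat w * pderiv (char_poly ?S)) \<theta>1 = 1"
      by simp
    moreover have "poly (char_poly ?S) \<theta>1 = 0" "poly (pderiv (char_poly ?S)) \<theta>1 = 0"
      unfolding cS by (simp_all add: pderiv_mult del: mult_pCons_left)
    ultimately show False by simp
  qed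
  moreover have "poly (char_poly ?S) \<theta>1 = 0" "poly (char_poly ?S) \<theta>2 = 0"
    unfolding \<theta> \<theta>' by (simp_all del: mult_pCons_left)
  ultimately show ?thesis using that \<theta>' by blast
qed

section \<open>Slabs in the simplex\<close>

lemma emeasure_abs_affine_le:
  fixes b c \<epsilon> :: real
  assumes "b \<noteq> 0" "\<epsilon> \<ge> 0"
  shows "emeasure lborel {y. \<bar>c + b * y\<bar> \<le> \<epsilon>} = ennreal (2 * \<epsilon> / \<bar>b\<bar>)"
proof -
  have "{y. \<bar>c + b * y\<bar> \<le> \<epsilon>} = {- c / b - \<epsilon> / \<bar>b\<bar> .. - c / b + \<epsilon> / \<bar>b\<bar>}"
  proof (intro Set.set_eqI)
    fix y
    have "\<bar>c + b * y\<bar> = \<bar>b\<bar> * \<bar>y - (- c / b)\<bar>"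
      using assms(1) by (simp flip: abs_mult add: algebra_simps)
    then have "\<bar>c + b * y\<bar> \<le> \<epsilon> \<longleftrightarrow> \<bar>y - (- c / b)\<bar> \<le> \<epsilon> / \<bar>b\<bar>"
      using assms(1) by (simp add: pos_le_divide_eq mult.commute)
    then show "y \<in> {y. \<bar>c + b * y\<bar> \<le> \<epsilon>} \<longleftrightarrow> y \<in> {- c / b - \<epsilon> / \<bar>b\<bar> .. - c / b + \<epsilon> / \<bar>b\<bar>}"
      by (simp add: abs_diff_le_iff) linarith
  qed
  then show ?thesis
    using assms by (simp add: algebra_simps)
qed

lemma emeasure_unit_cube:
  assumes "finite I"
  shows "emeasure (\<Pi>\<^sub>M i\<in>I. lborel) (\<Pi>\<^sub>E i\<in>I. {0<..<1 :: real}) = 1"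
proof -
  interpret product_sigma_finite "\<lambda>_. lborel :: real measure" ..
  show ?thesis using assms by (subst emeasure_PiM) auto
qed

lemma cube_slab_sets:
  fixes b :: "nat \<Rightarrow> real"
  assumes I: "finite I"
  shows "{u \<in> space (\<Pi>\<^sub>M i\<in>I. lborel). (\<forall>i\<in>I. 0 < u i \<and> u i < 1) \<and> \<bar>c + (\<Sum>i\<in>I. b i * u i)\<bar> \<le> \<epsilon>}
    \<in> sets (\<Pi>\<^sub>M i\<in>I. lborel)"
proof -
  let ?P = "\<Pi>\<^sub>M i\<in>I. lborel :: real measure"
  have c: "(\<lambda>u. u i) \<in> borel_measurable ?P" if "i \<in> I" for i
    using measurable_component_singleton[OF that, of "\<lambda>_. lborel :: real measure"] by simp
  have "(\<lambda>u. c + (\<Sum>i\<in>I. b i * u i)) \<in> borel_measurable ?P"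
    using c by (intro borel_measurable_add borel_measurable_sum borel_measurable_times) auto
  then have "{u \<in> space ?P. \<bar>c + (\<Sum>i\<in>I. b i * u i)\<bar> \<le> \<epsilon>} \<in> sets ?P"
    by (intro borel_measurable_le borel_measurable_abs) auto
  moreover have "{u \<in> space ?P. 0 < u i \<and> u i < 1} \<in> sets ?P" if "i \<in> I" for i
    using c[OF that] by (intro sets.sets_Collect_conj borel_measurable_less) auto
  then have "{u \<in> space ?P. \<forall>i\<in>I. 0 < u i \<and> u i < 1} \<in> sets ?P"
    using I by (intro sets.sets_Collect_finite_All) auto
  ultimately show ?thesis
    by (intro sets.sets_Collect_conj)
qed

text \<open>Fubini in the coordinate \<open>j\<close>: with the others fixed, the slab condition
  describes an interval of length \<open>2 * \<epsilon> / \<bar>b j\<bar>\<close>, and the others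
  range over a cube of measure 1.\<close>

lemma emeasure_cube_slab_le:
  fixes b :: "nat \<Rightarrow> real"
  assumes j: "j < d" "b j \<noteq> 0" and \<epsilon>: "\<epsilon> \<ge> 0"
  shows "emeasure (\<Pi>\<^sub>M i\<in>{..<d}. lborel)
    {u \<in> space (\<Pi>\<^sub>M i\<in>{..<d}. lborel). (\<forall>i\<in>{..<d}. 0 < u i \<and> u i < 1) \<and> \<bar>c + (\<Sum>i<d. b i * u i)\<bar> \<le> \<epsilon>}
    \<le> ennreal (2 * \<epsilon> / \<bar>b j\<bar>)"
proof -
  interpret product_sigma_finite "\<lambda>_. lborel :: real measure" ..
  define I where "I = {..<d} - {j}"
  have I: "{..<d} = insert j I" "finite I" "j \<notin> I"
    using j by (auto simp: I_def)
  let ?P = "\<Pi>\<^sub>M i\<in>insert j I. lborel :: real measure"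
  let ?Q = "{u \<in> space ?P. (\<forall>i\<in>insert j I. 0 < u i \<and> u i < 1) \<and> \<bar>c + (\<Sum>i\<in>insert j I. b i * u i)\<bar> \<le> \<epsilon>}"
  let ?C = "\<Pi>\<^sub>E i\<in>I. {0<..<1 :: real}"
  have Q: "?Q \<in> sets ?P"
    using I(2) by (intro cube_slab_sets) simp
  have C: "?C \<in> sets (\<Pi>\<^sub>M i\<in>I. lborel)"
    using I(2) by (intro sets_PiM_I_finite) auto
  have le: "(indicator ?Q (x(j := y)) :: ennreal) \<le>
      indicator ?C x * indicator {y. \<bar>(c + (\<Sum>i\<in>I. b i * x i)) + b j * y\<bar> \<le> \<epsilon>} y"
    if x: "x \<in> space (\<Pi>\<^sub>M i\<in>I. lborel)" for x y
  proof (cases "x(j := y) \<in> ?Q")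
    case True
    have sum: "(\<Sum>i\<in>insert j I. b i * (x(j := y)) i) = b j * y + (\<Sum>i\<in>I. b i * x i)"
    proof -
      have "(\<Sum>i\<in>I. b i * (x(j := y)) i) = (\<Sum>i\<in>I. b i * x i)"
        by (rule sum.cong) (use I(3) in auto)
      then show ?thesis using I(2,3) by simp
    qed
    have "\<bar>c + (\<Sum>i\<in>insert j I. b i * (x(j := y)) i)\<bar> \<le> \<epsilon>"
      using True by blast
    then have y: "y \<in> {y. \<bar>(c + (\<Sum>i\<in>I. b i * x i)) + b j * y\<bar> \<le> \<epsilon>}"
      unfolding sum by (simp add: add_ac)
    have x': "x \<in> ?C"
    proof (intro PiE_I)
      fix i assume "i \<in> I"
      then have "(x(j := y)) i = x i" using I(3) by auto
      have "\<forall>i\<in>insert j I. 0 < (x(j := y)) i \<and> (x(j := y)) i < 1" using True by blast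
      then have "0 < (x(j := y)) i \<and> (x(j := y)) i < 1" using \<open>i \<in> I\<close> by blast
      then show "x i \<in> {0<..<1}" using \<open>(x(j := y)) i = x i\<close> by simp
    next
      fix i assume "i \<notin> I"
      then show "x i = undefined" using x by (auto simp: space_PiM PiE_def extensional_def)
    qed
    show ?thesis
      by (simp only: indicator_simps(1)[OF True] indicator_simps(1)[OF x'] indicator_simps(1)[OF y]
          mult_1_left order_refl)
  next
    case False
    show ?thesis by (simp only: indicator_simps(2)[OF False] zero_le)
  qed
  have "emeasure ?P ?Q = (\<integral>\<^sup>+u. indicator ?Q u \<partial>?P)"
    using Q by simp
  also have "\<dots> = (\<integral>\<^sup>+x. (\<integral>\<^sup>+y. indicator ?Q (x(j := y)) \<partial>lborel) \<partial>(\<Pi>\<^sub>M i\<in>I. lborel))"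
    using I Q by (intro product_nn_integral_insert) auto
  also have "\<dots> \<le> (\<integral>\<^sup>+x. (\<integral>\<^sup>+y. indicator ?C x *
      indicator {y. \<bar>(c + (\<Sum>i\<in>I. b i * x i)) + b j * y\<bar> \<le> \<epsilon>} y \<partial>lborel) \<partial>(\<Pi>\<^sub>M i\<in>I. lborel))"
    using le by (intro nn_integral_mono) auto
  also have "\<dots> = (\<integral>\<^sup>+x. ennreal (2 * \<epsilon> / \<bar>b j\<bar>) * indicator ?C x \<partial>(\<Pi>\<^sub>M i\<in>I. lborel))"
  proof (rule nn_integral_cong)
    fix x
    let ?Y = "{y. \<bar>(c + (\<Sum>i\<in>I. b i * x i)) + b j * y\<bar> \<le> \<epsilon>}"
    have "?Y \<in> sets lborel" by simp
    then have "(\<integral>\<^sup>+y. indicator ?C x * indicator ?Y y \<partial>lborel) = indicator ?C x * emeasure lborel ?Y"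
      by (rule nn_integral_cmult_indicator)
    then show "(\<integral>\<^sup>+y. indicator ?C x * indicator ?Y y \<partial>lborel) = ennreal (2 * \<epsilon> / \<bar>b j\<bar>) * indicator ?C x"
      unfolding emeasure_abs_affine_le[OF j(2) \<epsilon>] by (simp only: mult.commute)
  qed
  also have "\<dots> = ennreal (2 * \<epsilon> / \<bar>b j\<bar>) * emeasure (\<Pi>\<^sub>M i\<in>I. lborel) ?C"
    by (rule nn_integral_cmult_indicator[OF C])
  also have "\<dots> = ennreal (2 * \<epsilon> / \<bar>b j\<bar>)"
    using I(2) by (simp add: emeasure_unit_cube)
  finally show ?thesis
    unfolding I(1) by (simp only: order_refl)
qed

section \<open>The chart of the simplex\<close>

context
  fixes m d :: nat
  assumes m: "m = Suc d"
begin

abbreviation "simplex_chart \<equiv> {u :: nat \<Rightarrow> real. (\<forall>i<d. 0 < u i) \<and> (\<Sum>i<d. u i) < 1}"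

lemma simplex_chart_le_1: "u \<in> simplex_chart \<Longrightarrow> i < d \<Longrightarrow> u i < 1"
proof -
  assume u: "u \<in> simplex_chart" and i: "i < d"
  have "u i \<le> (\<Sum>i<d. u i)"
    using u i by (intro member_le_sum) (auto intro: less_imp_le)
  then show ?thesis using u by simp
qed

lemma simplex_chart_measurable:
  "(\<lambda>u. u(d := 1 - (\<Sum>i<d. u i))) \<in> restrict_space (\<Pi>\<^sub>M i\<in>{..<d}. lborel) simplex_chart \<rightarrow>\<^sub>M
    restrict_space (\<Pi>\<^sub>M i\<in>{..<m}. borel) (open_simplex m)"
proof (rule measurable_restrict_space2)
  have "u(d := 1 - (\<Sum>i<d. u i)) \<in> open_simplex m"
    if "u \<in> simplex_chart" "u \<in> space (\<Pi>\<^sub>M i\<in>{..<d}. lborel)" for u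
    using that by (auto simp: open_simplex_def m PiE_def extensional_def space_PiM less_Suc_eq)
  then show "(\<lambda>u. u(d := 1 - (\<Sum>i<d. u i))) \<in>
      space (restrict_space (\<Pi>\<^sub>M i\<in>{..<d}. lborel) simplex_chart) \<rightarrow> open_simplex m"
    by (auto simp: space_restrict_space)
  show "(\<lambda>u. u(d := 1 - (\<Sum>i<d. u i))) \<in> restrict_space (\<Pi>\<^sub>M i\<in>{..<d}. lborel) simplex_chart \<rightarrow>\<^sub>M
      (\<Pi>\<^sub>M i\<in>{..<m}. borel)"
  proof (rule measurable_restrict_space1, rule measurable_PiM_single')
    fix i assume i: "i \<in> {..<m}"
    have c: "(\<lambda>u :: nat \<Rightarrow> real. u i) \<in> (\<Pi>\<^sub>M i\<in>{..<d}. lborel) \<rightarrow>\<^sub>M borel" if "i \<in> {..<d}" for i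
      using measurable_component_singleton[OF that, of "\<lambda>_. lborel :: real measure"] by simp
    show "(\<lambda>u. (u(d := 1 - (\<Sum>i<d. u i))) i) \<in> (\<Pi>\<^sub>M i\<in>{..<d}. lborel) \<rightarrow>\<^sub>M borel"
    proof (cases "i = d")
      case True
      have "(\<lambda>u :: nat \<Rightarrow> real. 1 - (\<Sum>i<d. u i)) \<in> (\<Pi>\<^sub>M i\<in>{..<d}. lborel) \<rightarrow>\<^sub>M borel"
        using c by (intro borel_measurable_diff borel_measurable_sum) auto
      then show ?thesis using True by simp
    next
      case False
      then have "i \<in> {..<d}" using i m by auto
      then show ?thesis using c False by simp
    qed
  next
    show "(\<lambda>u. u(d := 1 - (\<Sum>i<d. u i))) \<in> space (\<Pi>\<^sub>M i\<in>{..<d}. lborel) \<rightarrow> (\<Pi>\<^sub>E i\<in>{..<m}. space borel)"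
      by (auto simp: m space_PiM PiE_def extensional_def)
  qed
qed

lemma simplex_chart_sets: "simplex_chart \<inter> space (\<Pi>\<^sub>M i\<in>{..<d}. lborel) \<in> sets (\<Pi>\<^sub>M i\<in>{..<d}. lborel)"
proof -
  let ?P = "\<Pi>\<^sub>M i\<in>{..<d}. lborel :: real measure"
  have c: "(\<lambda>u. u i) \<in> borel_measurable ?P" if "i \<in> {..<d}" for i
    using measurable_component_singleton[OF that, of "\<lambda>_. lborel :: real measure"] by simp
  then have "(\<lambda>u. \<Sum>i<d. u i) \<in> borel_measurable ?P"
    by (intro borel_measurable_sum)
  then have "{u \<in> space ?P. (\<Sum>i<d. u i) < 1} \<in> sets ?P"
    by (intro borel_measurable_less) auto
  moreover have "{u \<in> space ?P. 0 < u i} \<in> sets ?P" if "i \<in> {..<d}" for i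
    using c[OF that] by (intro borel_measurable_less) auto
  then have "{u \<in> space ?P. \<forall>i\<in>{..<d}. 0 < u i} \<in> sets ?P"
    by (intro sets.sets_Collect_finite_All) auto
  ultimately have "{u \<in> space ?P. (\<forall>i\<in>{..<d}. 0 < u i) \<and> (\<Sum>i<d. u i) < 1} \<in> sets ?P"
    by (intro sets.sets_Collect_conj)
  then show ?thesis by (rule back_subst[of "\<lambda>A. A \<in> _"]) auto
qed

text \<open>The measure is a push-forward, so the mass of \<open>B\<close> is that of its preimage
  under the chart, which any measurable \<open>E\<close> covering it bounds.\<close>

lemma emeasure_simplex_lebesgue_le:
  assumes "B \<in> sets (simplex_lebesgue m)" "E \<in> sets (\<Pi>\<^sub>M i\<in>{..<d}. lborel)"
    and "\<And>u. u \<in> simplex_chart \<Longrightarrow> u \<in> space (\<Pi>\<^sub>M i\<in>{..<d}. lborel) \<Longrightarrow>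
      u(d := 1 - (\<Sum>i<d. u i)) \<in> B \<Longrightarrow> u \<in> E"
  shows "emeasure (simplex_lebesgue m) B \<le> emeasure (\<Pi>\<^sub>M i\<in>{..<d}. lborel) E"
proof -
  have md: "m - 1 = d" using m by simp
  let ?R = "restrict_space (\<Pi>\<^sub>M i\<in>{..<d}. lborel :: real measure) simplex_chart"
  let ?f = "\<lambda>u :: nat \<Rightarrow> real. u(d := 1 - (\<Sum>i<d. u i))"
  have "emeasure (simplex_lebesgue m) B = emeasure ?R (?f -` B \<inter> space ?R)"
    using assms(1) simplex_chart_measurable unfolding simplex_lebesgue_def md
    by (intro emeasure_distr) auto
  also have "\<dots> = emeasure (\<Pi>\<^sub>M i\<in>{..<d}. lborel) (?f -` B \<inter> space ?R)"
    using simplex_chart_sets by (intro emeasure_restrict_space) (auto simp: space_restrict_space)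
  also have "\<dots> \<le> emeasure (\<Pi>\<^sub>M i\<in>{..<d}. lborel) E"
    using assms(2,3) by (intro emeasure_mono) (auto simp: space_restrict_space)
  finally show ?thesis .
qed

lemma space_simplex_lebesgue: "space (simplex_lebesgue m) = open_simplex m"
  by (auto simp: simplex_lebesgue_def space_restrict_space open_simplex_def space_PiM)

lemma slab_sets:
  "{s \<in> space (simplex_lebesgue m). cmod (\<Sum>i<m. a i * of_real (s i)) \<le> \<epsilon>} \<in> sets (simplex_lebesgue m)"
proof -
  have "{s \<in> space (\<Pi>\<^sub>M i\<in>{..<m}. borel). cmod (\<Sum>i<m. a i * of_real (s i)) \<le> \<epsilon>} \<in> sets (\<Pi>\<^sub>M i\<in>{..<m}. borel)"
  proof -
    have c: "(\<lambda>u. u i) \<in> borel_measurable (\<Pi>\<^sub>M i\<in>{..<m}. borel :: real measure)" if "i \<in> {..<m}" for i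
      using measurable_component_singleton[OF that, of "\<lambda>_. borel :: real measure"] by simp
    have "(\<lambda>s. \<Sum>i<m. a i * of_real (s i)) \<in> borel_measurable (\<Pi>\<^sub>M i\<in>{..<m}. borel :: real measure)"
      using measurable_compose[OF c borel_measurable_of_real]
      by (intro borel_measurable_sum borel_measurable_times) auto
    then show ?thesis
      by (intro borel_measurable_le borel_measurable_norm) auto
  qed
  then have "open_simplex m \<inter> {s \<in> space (\<Pi>\<^sub>M i\<in>{..<m}. borel). cmod (\<Sum>i<m. a i * of_real (s i)) \<le> \<epsilon>}
      \<in> sets (simplex_lebesgue m)"
    by (auto simp: simplex_lebesgue_def sets_restrict_space)
  then show ?thesis
    by (rule back_subst[of "\<lambda>A. A \<in> _"])
      (auto simp: space_simplex_lebesgue open_simplex_def space_PiM)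
qed

lemma emeasure_simplex_lebesgue_le_1:
  assumes "B \<in> sets (simplex_lebesgue m)"
  shows "emeasure (simplex_lebesgue m) B \<le> 1"
proof -
  have "emeasure (simplex_lebesgue m) B \<le> emeasure (\<Pi>\<^sub>M i\<in>{..<d}. lborel) (\<Pi>\<^sub>E i\<in>{..<d}. {0<..<1 :: real})"
    using assms simplex_chart_le_1
    by (intro emeasure_simplex_lebesgue_le sets_PiM_I_finite) (auto simp: space_PiM PiE_def)
  then show ?thesis by (simp add: emeasure_unit_cube)
qed

lemma emeasure_simplex_lebesgue_real_slab_le:
  assumes j: "j < d" "b j \<noteq> 0" and \<epsilon>: "\<epsilon> \<ge> 0" and B: "B \<in> sets (simplex_lebesgue m)"
    and "\<And>s. s \<in> B \<Longrightarrow> \<bar>c + (\<Sum>i<d. b i * s i)\<bar> \<le> \<epsilon>"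
  shows "emeasure (simplex_lebesgue m) B \<le> ennreal (2 * \<epsilon> / \<bar>b j\<bar>)"
proof -
  let ?E = "{u \<in> space (\<Pi>\<^sub>M i\<in>{..<d}. lborel). (\<forall>i\<in>{..<d}. 0 < u i \<and> u i < 1) \<and> \<bar>c + (\<Sum>i<d. b i * u i)\<bar> \<le> \<epsilon>}"
  have "{u \<in> space (\<Pi>\<^sub>M i\<in>{..<d}. lborel). (\<forall>i\<in>{..<d}. 0 < u i \<and> u i < 1) \<and> \<bar>c + (\<Sum>i<d. b i * u i)\<bar> \<le> \<epsilon>}
      \<in> sets (\<Pi>\<^sub>M i\<in>{..<d}. lborel)"
    by (rule cube_slab_sets) simp
  then have E: "?E \<in> sets (\<Pi>\<^sub>M i\<in>{..<d}. lborel)" .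
  have "emeasure (simplex_lebesgue m) B \<le> emeasure (\<Pi>\<^sub>M i\<in>{..<d}. lborel) ?E"
  proof (rule emeasure_simplex_lebesgue_le[OF B E])
    fix u assume u: "u \<in> simplex_chart" "u \<in> space (\<Pi>\<^sub>M i\<in>{..<d}. lborel)"
      "u(d := 1 - (\<Sum>i<d. u i)) \<in> B"
    have "(\<Sum>i<d. b i * (u(d := 1 - (\<Sum>i<d. u i))) i) = (\<Sum>i<d. b i * u i)"
      by (intro sum.cong) auto
    then show "u \<in> ?E"
      using u assms(5)[OF u(3)] simplex_chart_le_1[OF u(1)] by auto
  qed
  also have "\<dots> \<le> ennreal (2 * \<epsilon> / \<bar>b j\<bar>)"
    by (rule emeasure_cube_slab_le[where j = j and b = b, OF j \<epsilon>])
  finally show ?thesis .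
qed

text \<open>Either the linear form varies along the simplex, or it is nearly constant there and then it
  stays away from \<open>0\<close>.\<close>

lemma emeasure_simplex_lebesgue_slab_le:
  assumes \<kappa>: "\<kappa> > 0" "i0 < m" "\<kappa> \<le> cmod (a i0)" and \<epsilon>: "\<epsilon> \<ge> 0"
  shows "emeasure (simplex_lebesgue m)
    {s \<in> space (simplex_lebesgue m). cmod (\<Sum>i<m. a i * of_real (s i)) \<le> \<epsilon>} \<le> ennreal (16 * \<epsilon> / \<kappa>)"
    (is "emeasure _ ?B \<le> _")
proof -
  \<comment> \<open>The last coordinate is eliminated through the sum condition: \<open>a d\<close>
    is the constant part of the form on the simplex, and the differences \<open>a i - a d\<close>
    measure its variation.\<close>
  have val: "(\<Sum>i<m. a i * of_real (s i)) = a d + (\<Sum>i<d. (a i - a d) * of_real (s i))"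
    if "s \<in> ?B" for s
  proof -
    have sd: "s d = 1 - (\<Sum>i<d. s i)"
    proof -
      have "s \<in> open_simplex m" using that space_simplex_lebesgue by blast
      then show ?thesis by (simp add: open_simplex_def m)
    qed
    have "(\<Sum>i<m. a i * of_real (s i)) = (\<Sum>i<d. a i * of_real (s i)) + a d * of_real (s d)"
      by (simp add: m)
    then show ?thesis
      unfolding sd by (simp add: algebra_simps sum_subtractf sum_distrib_left)
  qed
  show ?thesis
  proof (cases "\<exists>i<d. \<kappa> / 4 \<le> cmod (a i - a d)")
    case True
    then obtain i where i: "i < d" "\<kappa> / 4 \<le> cmod (a i - a d)" by blast
    \<comment> \<open>Stated for a real-linear \<phi> so as to serve both the real and the imaginary
      part; one of them carries at least half of the modulus, hence
      \<open>\<kappa> / 8\<close>.\<close>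
    have part: "emeasure (simplex_lebesgue m) ?B \<le> ennreal (16 * \<epsilon> / \<kappa>)"
      if h: "\<kappa> / 8 \<le> \<bar>\<phi> (a i - a d)\<bar>" and \<phi>: "\<And>z w. \<phi> (z + w) = \<phi> z + \<phi> w"
        "\<And>z x. \<phi> (z * of_real x) = \<phi> z * x" "\<And>z. \<bar>\<phi> z\<bar> \<le> cmod z" for \<phi> :: "complex \<Rightarrow> real"
    proof -
      have \<phi>0: "\<phi> 0 = 0" using \<phi>(1)[of 0 0] by simp
      have sum: "\<phi> (\<Sum>i\<in>A. f i) = (\<Sum>i\<in>A. \<phi> (f i))" if "finite A" for f :: "nat \<Rightarrow> complex" and A
        using that by (induction A rule: finite_induct) (auto simp: \<phi> \<phi>0)
      have "emeasure (simplex_lebesgue m) ?B \<le> ennreal (2 * \<epsilon> / \<bar>\<phi> (a i - a d)\<bar>)"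
      proof (rule emeasure_simplex_lebesgue_real_slab_le[where c = "\<phi> (a d)" and j = i and b = "\<lambda>i. \<phi> (a i - a d)"])
        show "\<phi> (a i - a d) \<noteq> 0" using h \<kappa> by auto
        show "\<bar>\<phi> (a d) + (\<Sum>i<d. \<phi> (a i - a d) * s i)\<bar> \<le> \<epsilon>" if s: "s \<in> ?B" for s
        proof -
          have "\<phi> (a d) + (\<Sum>i<d. \<phi> (a i - a d) * s i) = \<phi> (\<Sum>i<m. a i * of_real (s i))"
            unfolding val[OF s] by (simp add: \<phi> sum)
          then show ?thesis using \<phi>(3)[of "\<Sum>i<m. a i * of_real (s i)"] s by simp
        qed
      qed (use i \<epsilon> slab_sets in auto)
      also have "\<dots> \<le> ennreal (16 * \<epsilon> / \<kappa>)"
      proof (rule ennreal_leI)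
        have "2 * \<epsilon> / \<bar>\<phi> (a i - a d)\<bar> \<le> 2 * \<epsilon> / (\<kappa> / 8)"
          using h \<kappa> \<epsilon> by (intro divide_left_mono mult_pos_pos) auto
        then show "2 * \<epsilon> / \<bar>\<phi> (a i - a d)\<bar> \<le> 16 * \<epsilon> / \<kappa>" by simp
      qed
      finally show ?thesis .
    qed
    have "\<kappa> / 8 \<le> \<bar>Re (a i - a d)\<bar> \<or> \<kappa> / 8 \<le> \<bar>Im (a i - a d)\<bar>"
      using cmod_le[of "a i - a d"] i(2) by linarith
    then show ?thesis
      using part[of Re] part[of Im] abs_Re_le_cmod abs_Im_le_cmod by auto
  next
    case False
    then have close: "cmod (a i - a d) \<le> \<kappa> / 4" if "i < d" for i
      using that False by fastforce
    show ?thesis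
    proof (cases "\<epsilon> < \<kappa> / 2")
      case True
      \<comment> \<open>Here \<open>a d\<close> has modulus at least \<open>3 * \<kappa> / 4\<close>
        and the variation is at most \<open>\<kappa> / 4\<close>, so the form stays above or at
        \<open>\<kappa> / 2\<close>, which exceeds \<epsilon>.\<close>
      have "?B = {}"
      proof (rule ccontr)
        assume "?B \<noteq> {}"
        then obtain s where s: "s \<in> ?B" by blast
        then have "s \<in> open_simplex m" using space_simplex_lebesgue by blast
        then have pos: "\<And>i. i < d \<Longrightarrow> 0 < s i" "0 < s d" "(\<Sum>i<d. s i) + s d = 1"
          by (auto simp: open_simplex_def m PiE_def Pi_def)
        have ad: "3 * \<kappa> / 4 \<le> cmod (a d)"
        proof (cases "i0 = d")
          case False
          then have "i0 < d" using \<kappa>(2) m by simp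
          then show ?thesis
            using close[of i0] \<kappa>(3) norm_triangle_ineq2[of "a i0" "a d"] by linarith
        qed (use \<kappa> in auto)
        have "cmod (\<Sum>i<d. (a i - a d) * of_real (s i)) \<le> (\<Sum>i<d. \<kappa> / 4 * s i)"
          using close pos by (intro order_trans[OF norm_sum] sum_mono) (auto simp: norm_mult less_imp_le intro!: mult_mono)
        also have "\<dots> = \<kappa> / 4 * (\<Sum>i<d. s i)" by (simp add: sum_distrib_left)
        also have "\<dots> \<le> \<kappa> / 4 * 1"
          using pos \<kappa> by (intro mult_left_mono) auto
        finally have "\<kappa> / 2 \<le> cmod (\<Sum>i<m. a i * of_real (s i))"
          unfolding val[OF s] using ad norm_diff_ineq[of "a d" "\<Sum>i<d. (a i - a d) * of_real (s i)"] by linarith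
        moreover have "cmod (\<Sum>i<m. a i * of_real (s i)) \<le> \<epsilon>" using s by blast
        ultimately show False using True by linarith
      qed
      then show ?thesis by (simp only: emeasure_empty zero_le)
    next
      case False
      \<comment> \<open>For \<open>\<epsilon> \<ge> \<kappa> / 2\<close> the right-hand side is at
        least 8, while the total mass is at most 1.\<close>
      have "emeasure (simplex_lebesgue m) ?B \<le> 1"
        by (rule emeasure_simplex_lebesgue_le_1[OF slab_sets])
      also have "\<dots> \<le> ennreal (16 * \<epsilon> / \<kappa>)"
        using False \<kappa> by (simp add: pos_le_divide_eq)
      finally show ?thesis .
    qed
  qed
qed

end

section \<open>The Erdos-Kahane argument\<close>

definition sparse_functions :: "nat \<Rightarrow> int \<Rightarrow> real \<Rightarrow> (nat \<Rightarrow> int) set" where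
  "sparse_functions N a e = {D \<in> {..<N} \<rightarrow>\<^sub>E {- a..a}. real (card {n. n < N \<and> D n \<noteq> 0}) \<le> e}"

lemma finite_sparse_functions: "finite (sparse_functions N a e)"
  unfolding sparse_functions_def by (rule finite_subset[of _ "{..<N} \<rightarrow>\<^sub>E {- a..a}"]) (auto intro: finite_PiE)

text \<open>Weighting each nonzero value by \<open>t < 1\<close> turns the count into a product.\<close>

lemma card_sparse_functions_le:
  assumes a: "a \<ge> 0" and t: "0 < t" "t \<le> 1"
  shows "real (card (sparse_functions N a e)) * t powr e \<le> (1 + 2 * real_of_int a * t) ^ N"
proof -
  let ?w = "\<lambda>c :: int. if c = 0 then 1 else t"
  let ?P = "{..<N} \<rightarrow>\<^sub>E {- a..a}"
  have wt: "(\<Prod>n<N. ?w (D n)) = t ^ card {n. n < N \<and> D n \<noteq> 0}" for D :: "nat \<Rightarrow> int"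
  proof -
    have "{..<N} \<inter> - {n. D n = 0} = {n. n < N \<and> D n \<noteq> 0}" by auto
    then show ?thesis by (simp add: prod.If_cases)
  qed
  have "real (card (sparse_functions N a e)) * t powr e = (\<Sum>D\<in>sparse_functions N a e. t powr e)"
    by simp
  also have "\<dots> \<le> (\<Sum>D\<in>sparse_functions N a e. \<Prod>n<N. ?w (D n))"
  proof (rule sum_mono)
    fix D assume "D \<in> sparse_functions N a e"
    then have "real (card {n. n < N \<and> D n \<noteq> 0}) \<le> e" by (simp add: sparse_functions_def)
    then have "t powr e \<le> t powr real (card {n. n < N \<and> D n \<noteq> 0})"
      using t by (intro powr_mono') auto
    then show "t powr e \<le> (\<Prod>n<N. ?w (D n))"
      unfolding wt using t by (simp add: powr_realpow)
  qed
  \<comment> \<open>Over all functions, without the sparsity condition, the sum of products factors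
    into a product of identical sums.\<close>
  also have "\<dots> \<le> (\<Sum>D\<in>?P. \<Prod>n<N. ?w (D n))"
    using t by (intro sum_mono2 finite_PiE prod_nonneg) (auto simp: sparse_functions_def)
  also have "\<dots> = (\<Prod>n<N. \<Sum>c\<in>{- a..a}. ?w c)"
    by (subst prod_sum_PiE) auto
  also have "(\<Sum>c\<in>{- a..a}. ?w c) = 1 + 2 * real_of_int a * t"
  proof -
    have "(\<Sum>c\<in>{- a..a}. ?w c) = ?w 0 + (\<Sum>c\<in>{- a..a} - {0}. ?w c)"
      using a by (intro sum.remove) auto
    also have "(\<Sum>c\<in>{- a..a} - {0}. ?w c) = (\<Sum>c\<in>{- a..a} - {0}. t)"
      by (rule sum.cong) auto
    also have "\<dots> = 2 * real_of_int a * t"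
      using a by (simp add: card_Diff_singleton)
    finally show ?thesis by simp
  qed
  finally show ?thesis by simp
qed

text \<open>The exponential growth rate can be pushed below any \<open>g > 1\<close> by making the
  permitted density \<open>d\<close> of nonzero values small.\<close>

lemma sparse_functions_growth:
  fixes g :: real
  assumes a: "a \<ge> 1" and g: "g > 1"
  obtains G d :: real where "0 < G" "G < g" "0 < d"
    "\<And>N. real (card (sparse_functions N a (d * real N))) \<le> G ^ N"
proof -
  \<comment> \<open>The budget \<open>g\<close> is split into four equal factors: one pays for
    \<open>1 + 2 * a * t\<close>, one for the weight \<open>t powr d\<close>, and the slack of the
    other two makes \<open>h\<^sup>2 < g\<close> strict.\<close>
  define h where "h = g powr (1 / 4)"
  have h: "h > 1" unfolding h_def using g powr_less_mono[of 0 "1 / 4" g] by simp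
  define t where "t = min 1 ((h - 1) / (2 * real_of_int a))"
  have t: "0 < t" "t \<le> 1" "1 + 2 * real_of_int a * t \<le> h"
  proof -
    show "0 < t" using h a by (simp add: t_def)
    show "t \<le> 1" by (simp add: t_def)
    have "t \<le> (h - 1) / (2 * real_of_int a)" by (simp add: t_def)
    then show "1 + 2 * real_of_int a * t \<le> h"
      using a by (simp add: pos_le_divide_eq mult.commute)
  qed
  \<comment> \<open>Small enough for \<open>1 \<le> h * t powr d\<close>; the 1 in the denominator
    keeps it positive when \<open>t = 1\<close>.\<close>
  define d where "d = ln h / (1 - ln t)"
  have lt: "ln t \<le> 0" using t by simp
  have d: "d > 0" unfolding d_def using h lt by (intro divide_pos_pos) auto
  have td: "1 \<le> h * t powr d"
  proof -
    have "- (d * ln t) \<le> d * (1 - ln t)" using d by (simp add: algebra_simps)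
    also have "\<dots> = ln h" using lt by (simp add: d_def)
    finally have "0 \<le> ln h + d * ln t" by simp
    then have "exp 0 \<le> exp (ln h + d * ln t)" by (simp only: exp_le_cancel_iff)
    also have "\<dots> = h * t powr d" using h t by (simp add: exp_add powr_def)
    finally show ?thesis by simp
  qed
  have "real (card (sparse_functions N a (d * real N))) \<le> (h\<^sup>2) ^ N" for N
  proof -
    let ?c = "real (card (sparse_functions N a (d * real N)))"
    have "?c \<le> ?c * (h * t powr d) ^ N"
      using td by (simp add: mult_le_cancel_left1)
    also have "\<dots> = (?c * t powr (d * real N)) * h ^ N"
      using t by (simp add: power_mult_distrib powr_powr[symmetric] powr_realpow mult_ac)
    also have "\<dots> \<le> (1 + 2 * real_of_int a * t) ^ N * h ^ N"
      using card_sparse_functions_le[of a t N "d * real N"] a t h by (intro mult_right_mono) auto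
    also have "\<dots> \<le> h ^ N * h ^ N"
      using t a h by (intro mult_right_mono power_mono) auto
    finally show ?thesis by (simp add: power2_eq_square power_mult_distrib)
  qed
  moreover have "h\<^sup>2 < g"
  proof -
    have "h\<^sup>2 = g powr (1 / 2)"
      using g by (simp add: h_def power2_eq_square flip: powr_add)
    also have "\<dots> < g powr 1" using g by (intro powr_less_mono) auto
    finally show ?thesis using g by simp
  qed
  ultimately show ?thesis
    using that[of "h\<^sup>2" d] d h by simp
qed

section \<open>Coding integer sequences by their defects\<close>

definition defect :: "(nat \<Rightarrow> int) \<Rightarrow> nat \<Rightarrow> (nat \<Rightarrow> int) \<Rightarrow> nat \<Rightarrow> int" where
  "defect \<xi> m K n = (\<Sum>i\<le>m. \<xi> i * K (n + i))"

text \<open>A code has \<open>N + m\<close> places because the defect at \<open>n\<close> looks at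
  the places \<open>n\<close> to \<open>n + m\<close>. Fixing the values elsewhere by
  \<open>extensional\<close> makes codes countable as finite data.\<close>

definition codes :: "(nat \<Rightarrow> int) \<Rightarrow> nat \<Rightarrow> nat \<Rightarrow> int \<Rightarrow> int \<Rightarrow> real \<Rightarrow> (nat \<Rightarrow> int) set" where
  "codes \<xi> m N R a e = {K \<in> extensional {..<N + m}. (\<forall>i<m. \<bar>K i\<bar> \<le> R) \<and>
     (\<forall>n<N. \<bar>defect \<xi> m K n\<bar> \<le> a) \<and> real (card {n. n < N \<and> defect \<xi> m K n \<noteq> 0}) \<le> e}"

text \<open>As the leading coefficient is 1, \<open>K (l + m)\<close> is recovered from the defect
  at \<open>l\<close> and the \<open>m\<close> preceding values. So the initial values and the
  defects determine the code, and only the defects contribute a factor growing with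
  \<open>N\<close>.\<close>

lemma codes_card:
  assumes \<xi>: "\<xi> m = 1" and R: "R \<ge> 0"
  shows "finite (codes \<xi> m N R a e)"
    and "card (codes \<xi> m N R a e) \<le> nat (2 * R + 1) ^ m * card (sparse_functions N a e)"
proof -
  let ?F = "\<lambda>K. (restrict K {..<m}, restrict (defect \<xi> m K) {..<N})"
  let ?T = "({..<m} \<rightarrow>\<^sub>E {- R..R}) \<times> sparse_functions N a e"
  have inj: "inj_on ?F (codes \<xi> m N R a e)"
  proof (rule inj_onI)
    fix K K' assume K: "K \<in> codes \<xi> m N R a e" "K' \<in> codes \<xi> m N R a e" and eq: "?F K = ?F K'"
    have eqs: "restrict K {..<m} = restrict K' {..<m}"
      "restrict (defect \<xi> m K) {..<N} = restrict (defect \<xi> m K') {..<N}"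
      using eq by auto
    have init: "K i = K' i" if "i < m" for i
      using fun_cong[OF eqs(1), of i] that by simp
    have def: "defect \<xi> m K n = defect \<xi> m K' n" if "n < N" for n
      using fun_cong[OF eqs(2), of n] that by simp
    have "n < N + m \<Longrightarrow> K n = K' n" for n
    proof (induction n rule: less_induct)
      case (less n)
      show ?case
      proof (cases "n < m")
        case False
        define l where "l = n - m"
        have l: "n = l + m" "l < N" using False less.prems by (auto simp: l_def)
        have "(\<Sum>i<m. \<xi> i * K (l + i)) = (\<Sum>i<m. \<xi> i * K' (l + i))"
          using less.IH less.prems l by (intro sum.cong) auto
        moreover have "defect \<xi> m J l = (\<Sum>i<m. \<xi> i * J (l + i)) + J (l + m)" for J
          using \<xi> by (simp add: defect_def flip: lessThan_Suc_atMost)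
        ultimately show ?thesis using def[OF l(2)] l(1) by simp
      qed (use init in simp)
    qed
    then show "K = K'"
      using K by (intro extensionalityI[of _ "{..<N + m}"]) (auto simp: codes_def)
  qed
  have sub: "?F ` codes \<xi> m N R a e \<subseteq> ?T"
  proof (intro image_subsetI SigmaI)
    fix K assume K: "K \<in> codes \<xi> m N R a e"
    then show "restrict K {..<m} \<in> {..<m} \<rightarrow>\<^sub>E {- R..R}"
      by (auto simp: codes_def abs_le_iff minus_le_iff)
    have "{n. n < N \<and> restrict (defect \<xi> m K) {..<N} n \<noteq> 0} = {n. n < N \<and> defect \<xi> m K n \<noteq> 0}" by auto
    then show "restrict (defect \<xi> m K) {..<N} \<in> sparse_functions N a e"
      using K by (auto simp: codes_def sparse_functions_def abs_le_iff minus_le_iff simp del: restrict_apply intro!: restrict_PiE_iff[THEN iffD2])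
  qed
  have fin: "finite ?T"
    by (intro finite_cartesian_product finite_PiE finite_sparse_functions) auto
  show "finite (codes \<xi> m N R a e)"
    using finite_subset[OF sub fin] inj by (rule finite_imageD)
  have "card (codes \<xi> m N R a e) \<le> card ?T"
    by (rule card_inj_on_le[OF inj sub fin])
  also have "\<dots> = nat (2 * R + 1) ^ m * card (sparse_functions N a e)"
    by (simp add: card_cartesian_product card_PiE)
  finally show "card (codes \<xi> m N R a e) \<le> nat (2 * R + 1) ^ m * card (sparse_functions N a e)" .
qed

text \<open>In the application \<open>p n\<close> counts the letters of the inflated return word,
  \<xi> holds the coefficients of the characteristic polynomial, and \<open>L1\<close>,
  \<open>L2\<close> are the eigenfunctionals read off \<open>m\<close> consecutive vectors. The
  nonzero minor expresses their independence.\<close>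

locale integer_recurrence =
  fixes m :: nat and p :: "nat \<Rightarrow> nat \<Rightarrow> int" and \<xi> :: "nat \<Rightarrow> int"
    and q1 q2 L1 L2 :: "nat \<Rightarrow> complex" and \<theta>1 \<theta>2 :: complex and b1 b2 :: nat
  assumes m_pos: "m > 0"
    and recurrence: "\<And>n b. b < m \<Longrightarrow> (\<Sum>i\<le>m. \<xi> i * p (n + i) b) = 0"
    and monic: "\<xi> m = 1"
    and L1: "\<And>n b. b < m \<Longrightarrow> (\<Sum>j<m. q1 j * of_int (p (n + j) b)) = \<theta>1 ^ n * L1 b"
    and L2: "\<And>n b. b < m \<Longrightarrow> (\<Sum>j<m. q2 j * of_int (p (n + j) b)) = \<theta>2 ^ n * L2 b"
    and minor: "b1 < m" "b2 < m" "L1 b1 * L2 b2 \<noteq> L1 b2 * L2 b1"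
    and \<theta>2: "cmod \<theta>2 > 1" and \<theta>1: "cmod \<theta>1 \<ge> cmod \<theta>2"
begin

definition X :: "(nat \<Rightarrow> real) \<Rightarrow> nat \<Rightarrow> real" where
  "X z n = (\<Sum>b<m. z b * of_int (p n b))"

definition form :: "(nat \<Rightarrow> complex) \<Rightarrow> (nat \<Rightarrow> real) \<Rightarrow> complex" where
  "form L z = (\<Sum>b<m. L b * of_real (z b))"

text \<open>Larger than the sum of the \<open>\<bar>\<xi> i\<bar>\<close>, so that rounding errors
  below \<open>1 / height\<close>, weighted by \<xi>, add up to less than 1.\<close>

definition height :: int where
  "height = 1 + (\<Sum>i\<le>m. \<bar>\<xi> i\<bar>)"

definition far :: "(nat \<Rightarrow> real) \<Rightarrow> nat \<Rightarrow> bool" where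
  "far z n \<longleftrightarrow> 1 / real_of_int height \<le> \<bar>X z n - of_int (round (X z n))\<bar>"

lemma height_ge_2: "height \<ge> 2"
proof -
  have "\<bar>\<xi> m\<bar> \<le> (\<Sum>i\<le>m. \<bar>\<xi> i\<bar>)"
    by (rule member_le_sum) auto
  then show ?thesis by (simp add: height_def monic)
qed

lemma X_recurrence: "(\<Sum>i\<le>m. of_int (\<xi> i) * X z (n + i)) = 0"
proof -
  have "(\<Sum>i\<le>m. of_int (\<xi> i) * X z (n + i)) = (\<Sum>i\<le>m. \<Sum>b<m. z b * (of_int (\<xi> i) * of_int (p (n + i) b)))"
    unfolding X_def sum_distrib_left by (intro sum.cong) (auto simp: mult_ac)
  also have "\<dots> = (\<Sum>b<m. z b * of_int (\<Sum>i\<le>m. \<xi> i * p (n + i) b))"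
    by (subst sum.swap) (simp add: sum_distrib_left)
  also have "\<dots> = 0" by (simp add: recurrence)
  finally show ?thesis .
qed

text \<open>The unrounded values satisfy the recurrence exactly, so the defect sees only the
  rounding errors.\<close>

lemma defect_round:
  "real_of_int (defect \<xi> m (\<lambda>n. round (X z n)) n) =
    (\<Sum>i\<le>m. of_int (\<xi> i) * (of_int (round (X z (n + i))) - X z (n + i)))"
  by (simp add: defect_def right_diff_distrib sum_subtractf X_recurrence)

lemma defect_round_le: "\<bar>defect \<xi> m (\<lambda>n. round (X z n)) n\<bar> \<le> height"
proof -
  have "real_of_int \<bar>defect \<xi> m (\<lambda>n. round (X z n)) n\<bar> \<le>
      (\<Sum>i\<le>m. \<bar>of_int (\<xi> i) * (of_int (round (X z (n + i))) - X z (n + i))\<bar>)"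
    unfolding of_int_abs defect_round by (rule sum_abs)
  also have "\<dots> \<le> (\<Sum>i\<le>m. \<bar>of_int (\<xi> i)\<bar>)"
  proof (rule sum_mono)
    fix i
    have "\<bar>of_int (round (X z (n + i))) - X z (n + i)\<bar> \<le> 1"
      using of_int_round_abs_le[of "X z (n + i)"] by linarith
    then show "\<bar>of_int (\<xi> i) * (of_int (round (X z (n + i))) - X z (n + i))\<bar> \<le> \<bar>of_int (\<xi> i)\<bar>"
      unfolding abs_mult by (simp add: mult_left_le)
  qed
  also have "\<dots> \<le> real_of_int height" by (simp add: height_def)
  finally show ?thesis by (simp only: of_int_le_iff)
qed

text \<open>The defect is an integer, so it vanishes as soon as all \<open>m + 1\<close> values involved are close to
  integers.\<close>

lemma defect_nonzero_imp_far:
  assumes "defect \<xi> m (\<lambda>n. round (X z n)) n \<noteq> 0"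
  shows "\<exists>i\<le>m. far z (n + i)"
proof (rule ccontr)
  assume none: "\<not> ?thesis"
  have near: "\<bar>X z (n + i) - of_int (round (X z (n + i)))\<bar> < 1 / real_of_int height" if "i \<le> m" for i
  proof -
    have "\<not> far z (n + i)" using none that by blast
    then show ?thesis by (simp add: far_def not_le)
  qed
  have "real_of_int \<bar>defect \<xi> m (\<lambda>n. round (X z n)) n\<bar> \<le>
      (\<Sum>i\<le>m. \<bar>of_int (\<xi> i) * (of_int (round (X z (n + i))) - X z (n + i))\<bar>)"
    unfolding of_int_abs defect_round by (rule sum_abs)
  also have "\<dots> \<le> (\<Sum>i\<le>m. \<bar>of_int (\<xi> i)\<bar> * (1 / real_of_int height))"
  proof (rule sum_mono)
    fix i assume "i \<in> {..m}"
    then have "\<bar>of_int (round (X z (n + i))) - X z (n + i)\<bar> \<le> 1 / real_of_int height"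
      using near[of i] by (simp add: abs_minus_commute)
    then show "\<bar>of_int (\<xi> i) * (of_int (round (X z (n + i))) - X z (n + i))\<bar> \<le>
        \<bar>of_int (\<xi> i)\<bar> * (1 / real_of_int height)"
      unfolding abs_mult by (intro mult_left_mono) auto
  qed
  also have "\<dots> = real_of_int (height - 1) / real_of_int height"
    by (simp add: height_def sum_divide_distrib)
  also have "\<dots> < 1" using height_ge_2 by simp
  finally have "\<bar>defect \<xi> m (\<lambda>n. round (X z n)) n\<bar> < 1"
    by (simp only: of_int_less_1_iff)
  then show False using assms by simp
qed

text \<open>A far index \<open>k\<close> can spoil only the defects at \<open>k - m\<close> to
  \<open>k\<close>, which are \<open>m + 1\<close> places.\<close>

lemma card_defect_le:
  "card {n. n < N \<and> defect \<xi> m (\<lambda>n. round (X z n)) n \<noteq> 0} \<le> (m + 1) * card {n. n < N + m \<and> far z n}"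
proof -
  have "{n. n < N \<and> defect \<xi> m (\<lambda>n. round (X z n)) n \<noteq> 0} \<subseteq>
      (\<Union>i\<le>m. (\<lambda>k. k - i) ` {n. n < N + m \<and> far z n})"
  proof
    fix n assume "n \<in> {n. n < N \<and> defect \<xi> m (\<lambda>n. round (X z n)) n \<noteq> 0}"
    then obtain i where "i \<le> m" "far z (n + i)" "n < N"
      using defect_nonzero_imp_far[of z n] by auto
    then show "n \<in> (\<Union>i\<le>m. (\<lambda>k. k - i) ` {n. n < N + m \<and> far z n})"
      by (intro UN_I[of i] image_eqI[of _ _ "n + i"]) auto
  qed
  then have "card {n. n < N \<and> defect \<xi> m (\<lambda>n. round (X z n)) n \<noteq> 0} \<le>
      card (\<Union>i\<le>m. (\<lambda>k. k - i) ` {n. n < N + m \<and> far z n})"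
    by (intro card_mono) auto
  also have "\<dots> \<le> (\<Sum>i\<le>m. card ((\<lambda>k. k - i) ` {n. n < N + m \<and> far z n}))"
    by (rule card_UN_le) simp
  also have "\<dots> \<le> (\<Sum>i\<le>m. card {n. n < N + m \<and> far z n})"
    by (intro sum_mono card_image_le) simp
  finally show ?thesis by simp
qed

text \<open>\<open>\<theta> ^ N * form L z\<close> is the combination with coefficients
  \<open>q\<close> of the \<open>m\<close> real values from \<open>N\<close> on. Rounding them
  changes it by a bounded amount, which division by \<open>\<theta> ^ N\<close> scales down.\<close>

lemma form_approx:
  assumes L: "\<And>n b. b < m \<Longrightarrow> (\<Sum>j<m. q j * of_int (p (n + j) b)) = \<theta> ^ n * L b" and "\<theta> \<noteq> 0"
  shows "cmod (form L z - (\<Sum>j<m. q j * of_int (round (X z (N + j)))) / \<theta> ^ N) \<le>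
    (\<Sum>j<m. cmod (q j)) / cmod \<theta> ^ N"
proof -
  have "\<theta> ^ N * form L z = (\<Sum>b<m. of_real (z b) * (\<Sum>j<m. q j * of_int (p (N + j) b)))"
    by (simp add: form_def L sum_distrib_left mult_ac)
  also have "\<dots> = (\<Sum>j<m. q j * of_real (X z (N + j)))"
    unfolding sum_distrib_left X_def of_real_sum by (subst sum.swap) (simp add: mult_ac)
  finally have "\<theta> ^ N * form L z - (\<Sum>j<m. q j * of_int (round (X z (N + j)))) =
      (\<Sum>j<m. q j * of_real (X z (N + j) - of_int (round (X z (N + j)))))"
    by (simp add: right_diff_distrib sum_subtractf)
  then have "cmod (\<theta> ^ N * form L z - (\<Sum>j<m. q j * of_int (round (X z (N + j))))) \<le>
      (\<Sum>j<m. cmod (q j * of_real (X z (N + j) - of_int (round (X z (N + j))))))"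
    by (simp only: norm_sum)
  also have "\<dots> \<le> (\<Sum>j<m. cmod (q j))"
  proof (rule sum_mono)
    fix j
    have "\<bar>X z (N + j) - of_int (round (X z (N + j)))\<bar> \<le> 1"
      using of_int_round_abs_le[of "X z (N + j)"] by linarith
    then show "cmod (q j * of_real (X z (N + j) - of_int (round (X z (N + j))))) \<le> cmod (q j)"
      unfolding norm_mult norm_of_real by (simp add: mult_left_le)
  qed
  finally have *: "cmod (\<theta> ^ N * form L z - (\<Sum>j<m. q j * of_int (round (X z (N + j))))) \<le> (\<Sum>j<m. cmod (q j))" .
  have "form L z - (\<Sum>j<m. q j * of_int (round (X z (N + j)))) / \<theta> ^ N =
      (\<theta> ^ N * form L z - (\<Sum>j<m. q j * of_int (round (X z (N + j))))) / \<theta> ^ N"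
    using assms(2) by (simp add: diff_divide_distrib)
  then show ?thesis
    using * assms(2) by (simp add: norm_divide norm_power divide_right_mono)
qed

text \<open>The quotient of the two eigenfunctionals as seen by the integers of a code; the true
  quotient is invariant under scaling by \<omega>. A vanishing denominator gives the value 0, which
  still defines a legitimate slab, because \<open>\<kappa>_le\<close> holds for every slope.\<close>

definition slope :: "nat \<Rightarrow> (nat \<Rightarrow> int) \<Rightarrow> complex" where
  "slope N K = ((\<Sum>j<m. q2 j * of_int (K (N + j))) / \<theta>2 ^ N) / ((\<Sum>j<m. q1 j * of_int (K (N + j))) / \<theta>1 ^ N)"

definition Q :: real where
  "Q = (\<Sum>j<m. cmod (q1 j)) + (\<Sum>j<m. cmod (q2 j))"

lemma Q_nonneg: "Q \<ge> 0"
  by (simp add: Q_def sum_nonneg)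

text \<open>\<open>Q\<close> bounds the rounding errors, the bracket is 1 plus a bound for the
  slope, and the outer \<open>B\<close> undoes the scaling by \<omega>.\<close>

definition width :: "real \<Rightarrow> real" where
  "width B = B * (1 + (B * (\<Sum>b<m. cmod (L2 b)) + Q) * (2 * B * B)) * Q"

lemma X_scale: "X (\<lambda>b. \<omega> * s b) n = \<omega> * X s n"
  by (simp add: X_def sum_distrib_left mult_ac)

lemma form_scale: "form L (\<lambda>b. \<omega> * s b) = of_real \<omega> * form L s"
  by (simp add: form_def sum_distrib_left mult_ac)

text \<open>With \<open>c\<close> the slope of the code, the rounded approximations satisfy
  \<open>k2 = c * k1\<close> and cancel in \<open>L2 - c * L1\<close>; only the two rounding errors
  remain, the second one multiplied by \<open>c\<close>. The lower bounds on \<omega> and on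
  \<open>form L1 s\<close> keep \<open>c\<close> bounded.\<close>

lemma slope_approx:
  assumes s: "\<And>b. b < m \<Longrightarrow> 0 \<le> s b \<and> s b \<le> 1" and B: "B \<ge> 1"
    and L1s: "1 / B \<le> cmod (form L1 s)"
    and \<omega>: "1 / B \<le> \<bar>\<omega>\<bar>" "\<bar>\<omega>\<bar> \<le> B"
    and N: "Q / cmod \<theta>2 ^ N \<le> 1 / (2 * B * B)"
    and K: "\<And>n. n < N + m \<Longrightarrow> K n = round (\<omega> * X s n)"
  shows "cmod (form (\<lambda>b. L2 b - slope N K * L1 b) s) \<le> width B / cmod \<theta>2 ^ N"
proof -
  let ?z = "\<lambda>b. \<omega> * s b"
  define k1 where "k1 = (\<Sum>j<m. q1 j * of_int (K (N + j))) / \<theta>1 ^ N"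
  define k2 where "k2 = (\<Sum>j<m. q2 j * of_int (K (N + j))) / \<theta>2 ^ N"
  define \<eta> where "\<eta> = Q / cmod \<theta>2 ^ N"
  have \<theta>0: "\<theta>1 \<noteq> 0" "\<theta>2 \<noteq> 0" using \<theta>1 \<theta>2 by auto
  have \<eta>0: "0 \<le> \<eta>" using Q_nonneg by (simp add: \<eta>_def)
  have k: "(\<Sum>j<m. q j * of_int (K (N + j))) = (\<Sum>j<m. q j * of_int (round (X ?z (N + j))))" for q :: "nat \<Rightarrow> complex"
    by (intro sum.cong) (auto simp: K X_scale)
  have d1: "cmod (form L1 ?z - k1) \<le> \<eta>"
  proof -
    have "cmod (form L1 ?z - k1) \<le> (\<Sum>j<m. cmod (q1 j)) / cmod \<theta>1 ^ N"
      unfolding k1_def k by (rule form_approx[OF L1 \<theta>0(1)])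
    also have "\<dots> \<le> Q / cmod \<theta>2 ^ N"
      using \<theta>1 \<theta>2 zero_less_power[of "cmod \<theta>2" N] \<theta>0
      by (intro frac_le power_mono) (auto simp: Q_def sum_nonneg)
    finally show ?thesis by (simp add: \<eta>_def)
  qed
  have d2: "cmod (form L2 ?z - k2) \<le> \<eta>"
  proof -
    have "cmod (form L2 ?z - k2) \<le> (\<Sum>j<m. cmod (q2 j)) / cmod \<theta>2 ^ N"
      unfolding k2_def k by (rule form_approx[OF L2 \<theta>0(2)])
    also have "\<dots> \<le> Q / cmod \<theta>2 ^ N"
      using \<theta>2 by (intro divide_right_mono) (auto simp: Q_def sum_nonneg)
    finally show ?thesis by (simp add: \<eta>_def)
  qed
  \<comment> \<open>The true value is at least \<open>1 / (B * B)\<close>, and the assumption on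
    \<open>N\<close> leaves an error of at most half of that.\<close>
  have lo: "1 / (2 * B * B) \<le> cmod k1"
  proof -
    have "1 / B * (1 / B) \<le> \<bar>\<omega>\<bar> * cmod (form L1 s)"
      using \<omega> L1s B by (intro mult_mono) auto
    also have "\<dots> = cmod (form L1 ?z)" by (simp add: form_scale norm_mult)
    also have "\<dots> \<le> cmod k1 + \<eta>"
      using norm_triangle_sub[of "form L1 ?z" k1] d1 by linarith
    finally show ?thesis using N by (simp add: \<eta>_def)
  qed
  have up: "cmod k2 \<le> B * (\<Sum>b<m. cmod (L2 b)) + Q"
  proof -
    have "cmod (form L2 s) \<le> (\<Sum>b<m. cmod (L2 b))"
      unfolding form_def using s
      by (intro order_trans[OF norm_sum] sum_mono) (auto simp: norm_mult mult_left_le)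
    then have "cmod (form L2 ?z) \<le> B * (\<Sum>b<m. cmod (L2 b))"
      unfolding form_scale norm_mult using \<omega> by (intro mult_mono) auto
    moreover have "\<eta> \<le> Q"
      using Q_nonneg \<theta>2 by (simp add: \<eta>_def divide_le_eq mult_left_le mult_le_cancel_left1)
    ultimately show ?thesis
      using norm_triangle_sub[of k2 "form L2 ?z"] d2 by (simp add: norm_minus_commute)
  qed
  define c where "c = slope N K"
  have c: "c = k2 / k1" by (simp add: c_def slope_def k1_def k2_def)
  have k10: "k1 \<noteq> 0"
  proof -
    have "0 < 1 / (2 * B * B)" using B by simp
    then show ?thesis using lo by auto
  qed
  have cle: "cmod c \<le> (B * (\<Sum>b<m. cmod (L2 b)) + Q) * (2 * B * B)"
  proof -
    have "cmod c = cmod k2 / cmod k1" by (simp add: c norm_divide)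
    also have "\<dots> \<le> (B * (\<Sum>b<m. cmod (L2 b)) + Q) / (1 / (2 * B * B))"
      using up lo B by (intro frac_le) (auto intro: order_trans[OF norm_ge_zero])
    finally show ?thesis by simp
  qed
  have split: "form (\<lambda>b. L2 b - c * L1 b) ?z = (form L2 ?z - k2) - c * (form L1 ?z - k1)"
  proof -
    have "form (\<lambda>b. L2 b - c * L1 b) ?z = form L2 ?z - c * form L1 ?z"
      by (simp add: form_def sum_subtractf sum_distrib_left algebra_simps)
    moreover have "c * k1 = k2" using k10 by (simp add: c)
    ultimately show ?thesis by (simp add: right_diff_distrib)
  qed
  have "\<bar>\<omega>\<bar> * cmod (form (\<lambda>b. L2 b - c * L1 b) s) = cmod (form (\<lambda>b. L2 b - c * L1 b) ?z)"
    by (simp add: form_scale norm_mult)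
  also have "\<dots> = cmod ((form L2 ?z - k2) - c * (form L1 ?z - k1))"
    by (simp only: split)
  also have "\<dots> \<le> cmod (form L2 ?z - k2) + cmod c * cmod (form L1 ?z - k1)"
    using norm_triangle_ineq4 by (metis norm_mult)
  also have "\<dots> \<le> \<eta> + ((B * (\<Sum>b<m. cmod (L2 b)) + Q) * (2 * B * B)) * \<eta>"
    using d1 d2 cle \<eta>0 order_trans[OF norm_ge_zero cle] by (intro add_mono mult_mono) auto
  finally have *: "\<bar>\<omega>\<bar> * cmod (form (\<lambda>b. L2 b - c * L1 b) s) \<le>
      (1 + (B * (\<Sum>b<m. cmod (L2 b)) + Q) * (2 * B * B)) * \<eta>"
    by (simp add: algebra_simps)
  have "1 \<le> B * \<bar>\<omega>\<bar>"
    using \<omega>(1) B by (simp add: divide_le_eq mult.commute)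
  then have "cmod (form (\<lambda>b. L2 b - c * L1 b) s) \<le> B * \<bar>\<omega>\<bar> * cmod (form (\<lambda>b. L2 b - c * L1 b) s)"
    by (simp add: mult_le_cancel_right1)
  also have "\<dots> \<le> B * ((1 + (B * (\<Sum>b<m. cmod (L2 b)) + Q) * (2 * B * B)) * \<eta>)"
    using * B by (simp add: mult.assoc)
  also have "\<dots> = width B / cmod \<theta>2 ^ N"
    by (simp add: width_def \<eta>_def)
  finally show ?thesis by (simp add: c_def)
qed

text \<open>Quantitative independence: a lower bound, the same for every \<open>c\<close>, for the
  largest coefficient of \<open>L2 - c * L1\<close>. It bounds the measure of each slab by one fixed
  multiple of its width.\<close>

definition \<kappa> :: real where
  "\<kappa> = cmod (L1 b1 * L2 b2 - L1 b2 * L2 b1) / (cmod (L1 b1) + cmod (L1 b2))"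

lemma L1_nonzero: "L1 b1 \<noteq> 0 \<or> L1 b2 \<noteq> 0"
  using minor by auto

lemma \<kappa>_pos: "\<kappa> > 0"
  unfolding \<kappa>_def using minor L1_nonzero
  by (intro divide_pos_pos) (auto intro: add_pos_nonneg add_nonneg_pos)

text \<open>Replacing \<open>L2\<close> by \<open>L2 - c * L1\<close> leaves the minor at
  \<open>b1\<close>, \<open>b2\<close> unchanged; with both new coefficients below \<kappa> the
  minor would be too small.\<close>

lemma \<kappa>_le: "\<exists>b<m. \<kappa> \<le> cmod (L2 b - c * L1 b)"
proof (rule ccontr)
  assume "\<not> ?thesis"
  then have lt: "cmod (L2 b - c * L1 b) < \<kappa>" if "b < m" for b
    using that not_le by blast
  have "L1 b1 * L2 b2 - L1 b2 * L2 b1 = L1 b1 * (L2 b2 - c * L1 b2) - L1 b2 * (L2 b1 - c * L1 b1)"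
    by (simp add: algebra_simps)
  then have le: "cmod (L1 b1 * L2 b2 - L1 b2 * L2 b1) \<le>
      cmod (L1 b1) * cmod (L2 b2 - c * L1 b2) + cmod (L1 b2) * cmod (L2 b1 - c * L1 b1)"
    using norm_triangle_ineq4[of "L1 b1 * (L2 b2 - c * L1 b2)" "L1 b2 * (L2 b1 - c * L1 b1)"]
    by (simp only: norm_mult)
  have "cmod (L1 b1) * cmod (L2 b2 - c * L1 b2) + cmod (L1 b2) * cmod (L2 b1 - c * L1 b1)
      < (cmod (L1 b1) + cmod (L1 b2)) * \<kappa>"
  proof (cases "L1 b1 = 0")
    case True
    then show ?thesis using L1_nonzero lt[OF minor(1)] by simp
  next
    case False
    then have "cmod (L1 b1) * cmod (L2 b2 - c * L1 b2) < cmod (L1 b1) * \<kappa>"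
      using lt[OF minor(2)] by simp
    moreover have "cmod (L1 b2) * cmod (L2 b1 - c * L1 b1) \<le> cmod (L1 b2) * \<kappa>"
      using lt[OF minor(1)] by (intro mult_left_mono) auto
    ultimately show ?thesis unfolding distrib_right by linarith
  qed
  also have "\<dots> = cmod (L1 b1 * L2 b2 - L1 b2 * L2 b1)"
    using \<kappa>_pos unfolding \<kappa>_def by (auto simp: zero_less_divide_iff)
  finally show False using le by linarith
qed

section \<open>Exceptional sets and the almost sure statement\<close>

definition start_bound :: "nat \<Rightarrow> int" where
  "start_bound B = \<lceil>real B * (\<Sum>i<m. \<Sum>b<m. \<bar>real_of_int (p i b)\<bar>)\<rceil> + 1"

text \<open>Frequencies enter only through their bound \<open>B\<close>, so one set of each level
  serves the whole range of \<omega>.\<close>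

definition exceptional :: "real \<Rightarrow> nat \<Rightarrow> nat \<Rightarrow> (nat \<Rightarrow> real) set" where
  "exceptional d B N = (\<Union>K\<in>codes \<xi> m N (start_bound B) height (d * real N).
     {s \<in> space (simplex_lebesgue m).
       cmod (form (\<lambda>b. L2 b - slope N K * L1 b) s) \<le> width (real B) / cmod \<theta>2 ^ N})"

lemma start_bound_nonneg: "start_bound B \<ge> 0"
proof -
  have "0 \<le> real B * (\<Sum>i<m. \<Sum>b<m. \<bar>real_of_int (p i b)\<bar>)"
    by (intro mult_nonneg_nonneg sum_nonneg) auto
  then show ?thesis unfolding start_bound_def by linarith
qed

lemma round_start_le:
  assumes s: "\<And>b. b < m \<Longrightarrow> 0 \<le> s b \<and> s b \<le> 1" and \<omega>: "\<bar>\<omega>\<bar> \<le> real B" and i: "i < m"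
  shows "\<bar>round (\<omega> * X s i)\<bar> \<le> start_bound B"
proof -
  have "\<bar>X s i\<bar> \<le> (\<Sum>b<m. \<bar>real_of_int (p i b)\<bar>)"
    unfolding X_def using s
    by (intro order_trans[OF sum_abs] sum_mono) (auto simp: abs_mult mult_left_le_one_le)
  also have "\<dots> \<le> (\<Sum>i<m. \<Sum>b<m. \<bar>real_of_int (p i b)\<bar>)"
    using i by (intro member_le_sum[where f = "\<lambda>i. \<Sum>b<m. \<bar>real_of_int (p i b)\<bar>"]) (auto intro: sum_nonneg)
  finally have "\<bar>\<omega>\<bar> * \<bar>X s i\<bar> \<le> real B * (\<Sum>i<m. \<Sum>b<m. \<bar>real_of_int (p i b)\<bar>)"
    using \<omega> by (intro mult_mono) auto
  moreover have "real_of_int \<bar>round (\<omega> * X s i)\<bar> \<le> \<bar>\<omega>\<bar> * \<bar>X s i\<bar> + 1"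
    using of_int_round_abs_le[of "\<omega> * X s i"] unfolding of_int_abs abs_mult[symmetric] by linarith
  ultimately have "real_of_int \<bar>round (\<omega> * X s i)\<bar> \<le> real_of_int (start_bound B)"
    unfolding start_bound_def of_int_add of_int_1 by linarith
  then show ?thesis by (simp only: of_int_le_iff)
qed

text \<open>A single admissible \<omega> with too few far indices makes the rounded values a code,
  and \<open>s\<close> then lies in the slab of that code.\<close>

lemma in_exceptional:
  assumes sM: "s \<in> space (simplex_lebesgue m)"
    and s: "\<And>b. b < m \<Longrightarrow> 0 \<le> s b \<and> s b \<le> 1" and B: "B \<ge> 1"
    and L1s: "1 / real B \<le> cmod (form L1 s)"
    and \<omega>: "1 / real B \<le> \<bar>\<omega>\<bar>" "\<bar>\<omega>\<bar> \<le> real B"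
    and N: "Q / cmod \<theta>2 ^ N \<le> 1 / (2 * real B * real B)"
    and few: "real (m + 1) * real (card {n. n < N + m \<and> far (\<lambda>b. \<omega> * s b) n}) \<le> d * real N"
  shows "s \<in> exceptional d B N"
proof -
  let ?z = "\<lambda>b. \<omega> * s b"
  define K where "K = restrict (\<lambda>n. round (X ?z n)) {..<N + m}"
  have K: "K n = round (\<omega> * X s n)" if "n < N + m" for n
    using that by (simp add: K_def X_scale)
  have def: "defect \<xi> m K n = defect \<xi> m (\<lambda>n. round (X ?z n)) n" if "n < N" for n
    unfolding defect_def using that by (intro sum.cong) (auto simp: K_def)
  have "K \<in> codes \<xi> m N (start_bound B) height (d * real N)"
    unfolding codes_def
  proof (intro CollectI conjI allI impI)
    show "K \<in> extensional {..<N + m}" by (simp add: K_def)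
    show "\<bar>K i\<bar> \<le> start_bound B" if "i < m" for i
      using round_start_le[OF s \<omega>(2) that] that by (simp add: K)
    show "\<bar>defect \<xi> m K n\<bar> \<le> height" if "n < N" for n
      unfolding def[OF that] by (rule defect_round_le)
    have "{n. n < N \<and> defect \<xi> m K n \<noteq> 0} = {n. n < N \<and> defect \<xi> m (\<lambda>n. round (X ?z n)) n \<noteq> 0}"
      using def by auto
    then have "real (card {n. n < N \<and> defect \<xi> m K n \<noteq> 0}) \<le>
        real ((m + 1) * card {n. n < N + m \<and> far ?z n})"
      using card_defect_le[of N ?z] by (simp only: of_nat_le_iff)
    then show "real (card {n. n < N \<and> defect \<xi> m K n \<noteq> 0}) \<le> d * real N"
      using few by (simp only: of_nat_mult)
  qed
  moreover have "cmod (form (\<lambda>b. L2 b - slope N K * L1 b) s) \<le> width (real B) / cmod \<theta>2 ^ N"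
    using B by (intro slope_approx[OF s _ L1s \<omega> N K]) auto
  ultimately show ?thesis
    using sM unfolding exceptional_def by blast
qed

lemma width_nonneg: "B \<ge> 0 \<Longrightarrow> width B \<ge> 0"
  unfolding width_def using Q_nonneg by (intro mult_nonneg_nonneg add_nonneg_nonneg sum_nonneg) auto

lemma m_Suc: "m = Suc (m - 1)"
  using m_pos by simp

lemma form_slab_sets: "{s \<in> space (simplex_lebesgue m). cmod (form L s) \<le> \<epsilon>} \<in> sets (simplex_lebesgue m)"
  unfolding form_def by (rule slab_sets[OF m_Suc])

lemma exceptional_sets: "exceptional d B N \<in> sets (simplex_lebesgue m)"
  unfolding exceptional_def
  by (intro sets.finite_UN codes_card(1) monic start_bound_nonneg form_slab_sets)

lemma emeasure_exceptional_le:
  assumes G: "real (card (sparse_functions N height (d * real N))) \<le> G ^ N"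
  shows "emeasure (simplex_lebesgue m) (exceptional d B N) \<le>
    ennreal (real (nat (2 * start_bound B + 1) ^ m) * (16 * width (real B) / \<kappa>) * (G / cmod \<theta>2) ^ N)"
proof -
  let ?C = "codes \<xi> m N (start_bound B) height (d * real N)"
  let ?U = "\<lambda>K. {s \<in> space (simplex_lebesgue m).
    cmod (form (\<lambda>b. L2 b - slope N K * L1 b) s) \<le> width (real B) / cmod \<theta>2 ^ N}"
  let ?w = "16 * (width (real B) / cmod \<theta>2 ^ N) / \<kappa>"
  have w0: "?w \<ge> 0" using width_nonneg[of "real B"] \<kappa>_pos by simp
  have one: "emeasure (simplex_lebesgue m) (?U K) \<le> ennreal ?w" for K
  proof -
    obtain b where "b < m" "\<kappa> \<le> cmod (L2 b - slope N K * L1 b)" using \<kappa>_le by blast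
    then show ?thesis
      unfolding form_def using \<kappa>_pos width_nonneg[of "real B"]
      by (intro emeasure_simplex_lebesgue_slab_le[OF m_Suc]) auto
  qed
  have "emeasure (simplex_lebesgue m) (exceptional d B N) \<le> (\<Sum>K\<in>?C. emeasure (simplex_lebesgue m) (?U K))"
    unfolding exceptional_def
    by (intro emeasure_subadditive_finite codes_card(1) monic start_bound_nonneg)
      (use form_slab_sets in auto)
  also have "\<dots> \<le> (\<Sum>K\<in>?C. ennreal ?w)" by (intro sum_mono one)
  also have "\<dots> = ennreal (real (card ?C)) * ennreal ?w"
    by (simp only: sum_constant ennreal_of_nat_eq_real_of_nat)
  also have "\<dots> = ennreal (real (card ?C) * ?w)"
    using w0 by (intro ennreal_mult[symmetric]) auto
  also have "\<dots> \<le> ennreal (real (nat (2 * start_bound B + 1) ^ m) * G ^ N * ?w)"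
  proof (intro ennreal_leI mult_right_mono w0)
    have "real (card ?C) \<le> real (nat (2 * start_bound B + 1) ^ m * card (sparse_functions N height (d * real N)))"
      using codes_card(2)[where \<xi> = \<xi> and m = m and R = "start_bound B" and N = N and a = height
          and e = "d * real N", OF monic start_bound_nonneg] by (simp only: of_nat_le_iff)
    also have "\<dots> \<le> real (nat (2 * start_bound B + 1) ^ m) * G ^ N"
      using G unfolding of_nat_mult by (intro mult_left_mono) auto
    finally show "real (card ?C) \<le> real (nat (2 * start_bound B + 1) ^ m) * G ^ N" .
  qed
  also have "real (nat (2 * start_bound B + 1) ^ m) * G ^ N * ?w =
      real (nat (2 * start_bound B + 1) ^ m) * (16 * width (real B) / \<kappa>) * (G / cmod \<theta>2) ^ N"
    by (simp add: power_divide mult.commute)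
  finally show ?thesis .
qed

lemma AE_not_exceptional:
  assumes G: "0 < G" "G < cmod \<theta>2" "\<And>N. real (card (sparse_functions N height (d * real N))) \<le> G ^ N"
  shows "AE s in simplex_lebesgue m. eventually (\<lambda>N. s \<notin> exceptional d B N) sequentially"
proof -
  let ?c = "real (nat (2 * start_bound B + 1) ^ m) * (16 * width (real B) / \<kappa>)"
  have c: "?c \<ge> 0"
    using width_nonneg[of "real B"] \<kappa>_pos by (intro mult_nonneg_nonneg) auto
  have le: "emeasure (simplex_lebesgue m) (exceptional d B N) \<le> ennreal (?c * (G / cmod \<theta>2) ^ N)" for N
    by (rule emeasure_exceptional_le[OF G(3)])
  have r: "0 \<le> G / cmod \<theta>2" "G / cmod \<theta>2 < 1"
    using G(1,2) \<theta>2 by (simp_all add: divide_less_eq)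
  have "summable (\<lambda>N. measure (simplex_lebesgue m) (exceptional d B N))"
  proof (rule summable_comparison_test')
    show "summable (\<lambda>N. ?c * (G / cmod \<theta>2) ^ N)"
      using r by (intro summable_mult summable_geometric) auto
    show "norm (measure (simplex_lebesgue m) (exceptional d B N)) \<le> ?c * (G / cmod \<theta>2) ^ N" for N
    proof -
      have "0 \<le> ?c * (G / cmod \<theta>2) ^ N"
        by (rule mult_nonneg_nonneg[OF c zero_le_power[OF r(1)]])
      then have "measure (simplex_lebesgue m) (exceptional d B N) \<le> ?c * (G / cmod \<theta>2) ^ N"
        unfolding measure_def by (rule enn2real_leI[OF _ le])
      then show ?thesis by (simp only: real_norm_def abs_of_nonneg[OF measure_nonneg])
    qed
  qed
  moreover have "emeasure (simplex_lebesgue m) (exceptional d B N) < \<infinity>" for N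
    using le[of N] by (rule le_less_trans) simp
  ultimately have "AE s in simplex_lebesgue m.
      eventually (\<lambda>N. s \<in> space (simplex_lebesgue m) - exceptional d B N) sequentially"
    using exceptional_sets by (intro borel_cantelli_AE1) auto
  then show ?thesis by eventually_elim (auto elim: eventually_mono)
qed

text \<open>The kernel of \<open>L1\<close> is a slab of width 0 with a nonzero coefficient. Off
  this null set \<open>form L1 s\<close> has a positive modulus, which constants depending on
  \<open>s\<close> may absorb.\<close>

lemma AE_form_nonzero: "AE s in simplex_lebesgue m. form L1 s \<noteq> 0"
proof -
  obtain b where b: "b < m" "L1 b \<noteq> 0" using L1_nonzero minor by auto
  let ?Z = "{s \<in> space (simplex_lebesgue m). cmod (form L1 s) \<le> 0}"
  have "emeasure (simplex_lebesgue m) ?Z \<le> ennreal (16 * 0 / cmod (L1 b))"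
    unfolding form_def using b by (intro emeasure_simplex_lebesgue_slab_le[OF m_Suc]) auto
  then have "emeasure (simplex_lebesgue m) ?Z = 0" by simp
  then show ?thesis
    by (rule AE_I[rotated]) (use form_slab_sets[of L1 0] in auto)
qed

theorem erdos_kahane:
  obtains \<rho> \<delta> :: real where "0 < \<rho>" "\<rho> \<le> 1 / 2" "0 < \<delta>"
    "AE s in simplex_lebesgue m. \<forall>B>1. \<exists>N0. \<forall>N\<ge>N0. \<forall>\<omega>. 1 / B \<le> \<bar>\<omega>\<bar> \<and> \<bar>\<omega>\<bar> \<le> B \<longrightarrow>
       \<delta> * real N \<le> real (card {n. n < N + m \<and> \<rho> \<le> \<bar>\<omega> * X s n - of_int (round (\<omega> * X s n))\<bar>})"
proof -
  have h1: "height \<ge> 1" using height_ge_2 by simp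
  obtain G d :: real where G: "0 < G" "G < cmod \<theta>2" "0 < d"
    "\<And>N. real (card (sparse_functions N height (d * real N))) \<le> G ^ N"
    using sparse_functions_growth[OF h1 \<theta>2] by blast
  \<comment> \<open>Here \<open>B\<close> ranges over natural numbers, so the null sets are
    countable in number.\<close>
  have "AE s in simplex_lebesgue m. \<forall>B. eventually (\<lambda>N. s \<notin> exceptional d B N) sequentially"
    using AE_not_exceptional[OF G(1,2,4)] by (simp add: AE_all_countable)
  with AE_form_nonzero AE_space
  have "AE s in simplex_lebesgue m. \<forall>B>1. \<exists>N0. \<forall>N\<ge>N0. \<forall>\<omega>. 1 / B \<le> \<bar>\<omega>\<bar> \<and> \<bar>\<omega>\<bar> \<le> B \<longrightarrow>
       d / real (m + 1) * real N \<le> real (card {n. n < N + m \<and>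
         1 / real_of_int height \<le> \<bar>\<omega> * X s n - of_int (round (\<omega> * X s n))\<bar>})"
  proof eventually_elim
    fix s
    assume nz: "form L1 s \<noteq> 0" and sM: "s \<in> space (simplex_lebesgue m)"
      and ev: "\<forall>B. eventually (\<lambda>N. s \<notin> exceptional d B N) sequentially"
    have sS: "s \<in> open_simplex m" using sM space_simplex_lebesgue[OF m_Suc] by simp
    have s: "0 \<le> s b \<and> s b \<le> 1" if "b < m" for b
    proof -
      have pos: "0 < s i" if "i < m" for i using sS that by (auto simp: open_simplex_def)
      have "s b \<le> (\<Sum>i<m. s i)" using that pos by (intro member_le_sum) (auto intro: less_imp_le)
      then show ?thesis using sS pos[OF that] by (simp add: open_simplex_def)
    qed
    show "\<forall>B>1. \<exists>N0. \<forall>N\<ge>N0. \<forall>\<omega>. 1 / B \<le> \<bar>\<omega>\<bar> \<and> \<bar>\<omega>\<bar> \<le> B \<longrightarrow>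
       d / real (m + 1) * real N \<le> real (card {n. n < N + m \<and>
         1 / real_of_int height \<le> \<bar>\<omega> * X s n - of_int (round (\<omega> * X s n))\<bar>})"
    proof (intro allI impI)
      fix B :: real assume B: "B > 1"
      \<comment> \<open>A natural number dominating both the real bound \<open>B\<close> and
        \<open>1 / cmod (form L1 s)\<close>, so that it serves at once as bound for \<omega> and for
        the denominator of the slope.\<close>
      define B' where "B' = nat \<lceil>max B (1 / cmod (form L1 s))\<rceil>"
      have "max B (1 / cmod (form L1 s)) \<le> real B'" unfolding B'_def by (rule real_nat_ceiling_ge)
      then have B': "B \<le> real B'" "1 / cmod (form L1 s) \<le> real B'" by auto
      then have B'1: "B' \<ge> 1" using B by linarith
      have L1s: "1 / real B' \<le> cmod (form L1 s)"
        using B'(2) B'1 nz by (simp add: divide_le_eq mult.commute)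
      have "(\<lambda>N. Q * inverse (cmod \<theta>2 ^ N)) \<longlonglongrightarrow> Q * 0"
        using \<theta>2 by (intro tendsto_mult tendsto_const LIMSEQ_inverse_realpow_zero)
      then have "eventually (\<lambda>N. Q * inverse (cmod \<theta>2 ^ N) < 1 / (2 * real B' * real B')) sequentially"
        by (rule order_tendstoD(2)) (use B'1 in simp)
      then have "eventually (\<lambda>N. s \<notin> exceptional d B' N \<and> Q / cmod \<theta>2 ^ N \<le> 1 / (2 * real B' * real B')) sequentially"
        using spec[OF ev, of B'] by eventually_elim (simp only: divide_inverse less_imp_le not_False_eq_True simp_thms)
      then obtain N0 where N0: "\<And>N. N \<ge> N0 \<Longrightarrow> s \<notin> exceptional d B' N \<and>
          Q / cmod \<theta>2 ^ N \<le> 1 / (2 * real B' * real B')"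
        unfolding eventually_sequentially by blast
      have "d / real (m + 1) * real N \<le> real (card {n. n < N + m \<and>
           1 / real_of_int height \<le> \<bar>\<omega> * X s n - of_int (round (\<omega> * X s n))\<bar>})" (is "_ \<le> real ?c")
        if N: "N \<ge> N0" and \<omega>: "1 / B \<le> \<bar>\<omega>\<bar>" "\<bar>\<omega>\<bar> \<le> B" for N \<omega>
      proof (rule ccontr)
        assume "\<not> ?thesis"
        then have "real ?c \<le> d / real (m + 1) * real N" by linarith
        then have "real (m + 1) * real ?c \<le> real (m + 1) * (d / real (m + 1) * real N)"
          by (rule mult_left_mono) simp
        then have few: "real (m + 1) * real ?c \<le> d * real N"
          by simp
        have "1 / real B' \<le> 1 / B" using B B' by (intro divide_left_mono mult_pos_pos) auto
        then have \<omega>': "1 / real B' \<le> \<bar>\<omega>\<bar>" "\<bar>\<omega>\<bar> \<le> real B'" using \<omega> B' by linarith+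
        have few': "real (m + 1) * real (card {n. n < N + m \<and> far (\<lambda>b. \<omega> * s b) n}) \<le> d * real N"
          using few by (simp only: far_def X_scale)
        have "s \<in> exceptional d B' N"
          by (rule in_exceptional[OF sM s B'1 L1s \<omega>' conjunct2[OF N0[OF N]] few'])
        then show False using N0[OF N] by blast
      qed
      then show "\<exists>N0. \<forall>N\<ge>N0. \<forall>\<omega>. 1 / B \<le> \<bar>\<omega>\<bar> \<and> \<bar>\<omega>\<bar> \<le> B \<longrightarrow>
         d / real (m + 1) * real N \<le> real (card {n. n < N + m \<and>
           1 / real_of_int height \<le> \<bar>\<omega> * X s n - of_int (round (\<omega> * X s n))\<bar>})"
        by blast
    qed
  qed
  moreover have "0 < 1 / real_of_int height" "1 / real_of_int height \<le> 1 / 2"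
    using height_ge_2 by (simp_all add: divide_le_eq)
  ultimately show ?thesis
    using that[of "1 / real_of_int height" "d / real (m + 1)"] G(3) by simp
qed

end

section \<open>Modulus of continuity of the spectral measures\<close>

lemma power_bracket:
  fixes \<Lambda> y :: real
  assumes "\<Lambda> > 1" "y \<ge> 1"
  obtains N where "\<Lambda> ^ N \<le> y" "y < \<Lambda> ^ Suc N"
proof -
  define n where "n = (LEAST n. y < \<Lambda> ^ n)"
  obtain n' where "y < \<Lambda> ^ n'" using real_arch_pow[OF assms(1)] by blast
  then have n: "y < \<Lambda> ^ n" unfolding n_def by (rule LeastI)
  then obtain N where N: "n = Suc N" using assms(2) by (cases n) auto
  have "\<not> y < \<Lambda> ^ N" using N unfolding n_def by (intro not_less_Least) simp
  then show ?thesis using that[of N] n N by simp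
qed

text \<open>Balance of scales: about \<open>1 / (6 * r\<^sup>2)\<close> samples at step
  \<open>r\<close> cover a time of about \<open>1 / (6 * r)\<close>, and the level \<open>N\<close>
  has \<open>\<Lambda> ^ N\<close> about \<open>r powr (- (1 / 2))\<close>. The ends of words cost
  order \<open>r powr (- (1 / 2))\<close>, the whole blocks order
  \<open>r powr (\<kappa> - 1)\<close>. Relative to the orbit time both are at most of order
  \<open>r powr \<kappa>\<close>, as \<open>\<kappa> \<le> 1 / 2\<close>, and squaring gives the
  exponent \<open>2 * \<kappa>\<close>.\<close>

lemma spectral_measure_powr_le:
  fixes \<Lambda> M N0 :: nat and \<beta> \<kappa> B :: real
  assumes subst: "substitution m \<zeta>" and s: "s \<in> open_simplex m" and m: "m > 0" and B: "B > 1"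
    and \<Lambda>: "\<And>b. b < m \<Longrightarrow> length (\<zeta> b) \<le> \<Lambda>" "\<Lambda> \<ge> 2"
    and \<beta>: "0 < \<beta>" "\<beta> \<le> real \<Lambda> powr (- (2 * \<kappa>))" and \<kappa>: "0 < \<kappa>" "\<kappa> \<le> 1 / 2"
    and decay: "\<And>N \<omega> a. N \<ge> N0 \<Longrightarrow> 1 / B \<le> \<bar>\<omega>\<bar> \<Longrightarrow> \<bar>\<omega>\<bar> \<le> B \<Longrightarrow> sup_ratio m \<zeta> \<omega> s a (N + M) \<le> \<beta> ^ N"
  shows "\<exists>r\<^sub>0>0. \<exists>C>0. \<forall>\<mu> a \<sigma>. invariant_prob m \<zeta> s \<mu> \<and> a < m \<and>
      is_spectral_measure \<mu> (susp_flow s) (indicator (susp_cylinder m \<zeta> s a)) \<sigma> \<longrightarrow>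
      (\<forall>\<omega> r. 1 / B \<le> \<bar>\<omega>\<bar> \<and> \<bar>\<omega>\<bar> \<le> B \<and> 0 < r \<and> r \<le> r\<^sub>0 \<longrightarrow>
        measure \<sigma> {\<omega> - r..\<omega> + r} \<le> C * r powr (2 * \<kappa>))"
proof -
  have pos: "0 < s b" if "b < m" for b
    using s that by (auto simp: open_simplex_def)
  have s1: "s b \<le> 1" if "b < m" for b
  proof -
    have "s b \<le> (\<Sum>i<m. s i)" using that pos by (intro member_le_sum) (auto intro: less_imp_le)
    then show ?thesis using s by (simp add: open_simplex_def)
  qed
  define \<delta> where "\<delta> = Min (s ` {..<m})"
  have \<delta>: "\<delta> > 0" "\<And>b. b < m \<Longrightarrow> \<delta> \<le> s b"
  proof -
    have "s ` {..<m} \<noteq> {}" using m by auto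
    then show "\<delta> > 0" unfolding \<delta>_def using pos by (subst Min_gr_iff) auto
    show "\<delta> \<le> s b" if "b < m" for b unfolding \<delta>_def using that by (intro Min_le) auto
  qed
  define C1 where "C1 = 2 * real \<Lambda> ^ M + 1 / (\<beta> * \<delta>)"
  define C2 where "C2 = 24 * B * (2 * C1 + (4 + 4 * pi * B / \<delta>))"
  have C1: "C1 \<ge> 0" using \<beta> \<delta> by (simp add: C1_def)
  have C2: "C2 > 0" unfolding C2_def using C1 B \<delta> by (intro mult_pos_pos add_nonneg_pos add_pos_nonneg) auto
  \<comment> \<open>The three bounds provide enough samples, a sampling angle of at most 1, and a
    level \<open>N \<ge> N0\<close>.\<close>
  define r0 where "r0 = min (1 / 8) (min (1 / (2 * pi * B)) (1 / (real \<Lambda> ^ N0)\<^sup>2))"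
  have \<Lambda>p: "real \<Lambda> > 1" using \<Lambda>(2) by simp
  have r0: "r0 > 0" unfolding r0_def using B \<Lambda>p by simp
  have main: "measure \<sigma> {\<omega> - r..\<omega> + r} \<le> C2\<^sup>2 * r powr (2 * \<kappa>)"
    if inv: "invariant_prob m \<zeta> s \<mu>"
      and \<sigma>: "is_spectral_measure \<mu> (susp_flow s) (indicator (susp_cylinder m \<zeta> s a)) \<sigma>"
      and \<omega>: "1 / B \<le> \<bar>\<omega>\<bar>" "\<bar>\<omega>\<bar> \<le> B" and r: "0 < r" "r \<le> r0" for \<mu> a \<sigma> \<omega> r
  proof -
    have r8: "r \<le> 1 / 8" and rB: "r \<le> 1 / (2 * pi * B)" and r\<Lambda>: "r \<le> 1 / (real \<Lambda> ^ N0)\<^sup>2"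
      using r(2) by (simp_all add: r0_def)
    define J where "J = nat \<lfloor>1 / (6 * r\<^sup>2)\<rfloor>"
    have J: "real J \<le> 1 / (6 * r\<^sup>2)" "1 / (12 * r\<^sup>2) \<le> real J"
    proof -
      have J': "real J = of_int \<lfloor>1 / (6 * r\<^sup>2)\<rfloor>" by (simp add: J_def)
      show "real J \<le> 1 / (6 * r\<^sup>2)" unfolding J' by simp
      have "r\<^sup>2 \<le> (1 / 8)\<^sup>2" using r(1) r8 by (intro power_mono) auto
      then have "1 \<le> 1 / (12 * r\<^sup>2)" using r(1) by (simp add: power2_eq_square)
      moreover have "1 / (6 * r\<^sup>2) = 1 / (12 * r\<^sup>2) + 1 / (12 * r\<^sup>2)" by simp
      ultimately show "1 / (12 * r\<^sup>2) \<le> real J" unfolding J' by linarith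
    qed
    have J0: "real J > 0"
    proof -
      have "0 < 1 / (12 * r\<^sup>2)" using r(1) by simp
      then show ?thesis using J(2) by linarith
    qed
    have Jr: "1 + real J * r \<le> 1 / r"
    proof -
      have "real J * r \<le> 1 / (6 * r\<^sup>2) * r" using J(1) r(1) by (intro mult_right_mono) auto
      also have "\<dots> = 1 / 6 * (1 / r)" using r(1) by (simp add: power2_eq_square)
      finally have "real J * r \<le> 1 / 6 * (1 / r)" .
      moreover have "8 \<le> 1 / r" using r(1) r8 by (simp add: le_divide_eq)
      ultimately show ?thesis by linarith
    qed
    define y where "y = r powr (- (1 / 2))"
    have y1: "y \<ge> 1"
    proof -
      have "r powr 0 \<le> r powr (- (1 / 2))" using r(1) r8 by (intro powr_mono') auto
      then show ?thesis using r(1) by (simp add: y_def)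
    qed
    obtain N where N: "real \<Lambda> ^ N \<le> y" "y < real \<Lambda> ^ Suc N"
      using power_bracket[OF \<Lambda>p y1] .
    have yy: "y\<^sup>2 = 1 / r"
    proof -
      have "y\<^sup>2 = r powr (- (1 / 2) + - (1 / 2))" unfolding y_def power2_eq_square by (rule powr_add[symmetric])
      also have "\<dots> = r powr (- 1)" by simp
      also have "\<dots> = 1 / r" using r(1) by (simp add: powr_neg_one)
      finally show ?thesis .
    qed
    have "N0 \<le> N"
    proof -
      have "(real \<Lambda> ^ N0)\<^sup>2 \<le> y\<^sup>2"
      proof -
        have "0 < (real \<Lambda> ^ N0)\<^sup>2" using \<Lambda>p by (intro zero_less_power) simp
        then have "r * (real \<Lambda> ^ N0)\<^sup>2 \<le> 1" using r\<Lambda> by (simp only: pos_le_divide_eq)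
        then show ?thesis unfolding yy using r(1) by (simp only: pos_le_divide_eq mult.commute)
      qed
      then have "real \<Lambda> ^ N0 \<le> y" by (rule power2_le_imp_le) (use y1 in simp)
      then have "real \<Lambda> ^ N0 < real \<Lambda> ^ Suc N" using N(2) by linarith
      then show ?thesis using \<Lambda>p by (simp only: power_strict_increasing_iff less_Suc_eq_le)
    qed
    \<comment> \<open>The upper bound for \<open>y\<close> involves the power \<open>Suc N\<close>,
      so the exponent is raised by one at the price of the factor
      \<open>1 / \<beta>\<close>.\<close>
    have \<beta>N: "\<beta> ^ N \<le> r powr \<kappa> / \<beta>"
    proof -
      have "\<beta> ^ Suc N \<le> (real \<Lambda> powr (- (2 * \<kappa>))) ^ Suc N"
        using \<beta> by (intro power_mono) auto
      also have "\<dots> = (real \<Lambda> ^ Suc N) powr (- (2 * \<kappa>))"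
      proof -
        have "(real \<Lambda> powr (- (2 * \<kappa>))) ^ Suc N = real \<Lambda> powr (- (2 * \<kappa>) * real (Suc N))"
          using \<Lambda>p powr_realpow[of "real \<Lambda> powr (- (2 * \<kappa>))" "Suc N"] by (simp only: powr_powr powr_gt_zero)
        moreover have "(real \<Lambda> ^ Suc N) powr (- (2 * \<kappa>)) = real \<Lambda> powr (real (Suc N) * - (2 * \<kappa>))"
          using \<Lambda>p powr_realpow[of "real \<Lambda>" "Suc N"] by (simp only: powr_powr[symmetric])
        ultimately show ?thesis by (simp only: mult.commute)
      qed
      also have "\<dots> \<le> y powr (- (2 * \<kappa>))"
        using N(2) y1 \<kappa> by (intro powr_mono2') auto
      also have "\<dots> = r powr \<kappa>" by (simp add: y_def powr_powr)
      finally show ?thesis using \<beta>(1) by (simp add: le_divide_eq mult.commute)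
    qed
    define T where "T = 2 * real \<Lambda> ^ (N + M) + \<beta> ^ N * (1 / (\<delta> * r))"
    have T: "cmod (twisted_sum \<omega> s a (map (\<lambda>j. x (int j)) [0..<l])) \<le> T"
      if x: "x \<in> subst_space m \<zeta>" and l: "real l * \<delta> \<le> 1 + real J * r" for x l
    proof -
      have "real l \<le> 1 / (\<delta> * r)"
        using order_trans[OF l Jr] \<delta>(1) r(1) by (simp add: field_simps)
      moreover have "sup_ratio m \<zeta> \<omega> s a (N + M) \<le> \<beta> ^ N" by (rule decay) fact+
      ultimately have "sup_ratio m \<zeta> \<omega> s a (N + M) * real l \<le> \<beta> ^ N * (1 / (\<delta> * r))"
        using \<beta>(1) by (intro mult_mono) auto
      then show ?thesis
        using norm_twisted_sum_factor_le[OF subst x \<Lambda>(1), of \<omega> s a 0 l "N + M"] \<Lambda>(2)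
        by (simp add: T_def)
    qed
    have rT: "r * T \<le> C1 * r powr \<kappa>"
    proof -
      have "real \<Lambda> ^ (N + M) \<le> y * real \<Lambda> ^ M"
        unfolding power_add using N(1) by (intro mult_right_mono) auto
      then have "r * T \<le> r * (2 * (y * real \<Lambda> ^ M) + r powr \<kappa> / \<beta> * (1 / (\<delta> * r)))"
        unfolding T_def using r(1) \<beta>N \<delta>(1) by (intro mult_left_mono add_mono mult_right_mono) auto
      also have "\<dots> = 2 * real \<Lambda> ^ M * (r * y) + r powr \<kappa> / (\<beta> * \<delta>)"
        using r(1) by (simp add: distrib_left)
      also have "r * y = r powr (1 / 2)"
        using r(1) powr_add[of r 1 "- (1 / 2)"] by (simp add: y_def)
      also have "2 * real \<Lambda> ^ M * r powr (1 / 2) \<le> 2 * real \<Lambda> ^ M * r powr \<kappa>"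
        using r(1) r8 \<kappa> by (intro mult_left_mono powr_mono') auto
      finally show ?thesis by (simp add: C1_def distrib_right)
    qed
    have rk: "r \<le> r powr \<kappa>"
      using r(1) r8 \<kappa> powr_mono'[of \<kappa> 1 r] by simp
    have J1: "J \<ge> 1" using J0 by simp
    have Jrr: "real J * r * r \<le> 1 / 6"
      using J(1) r(1) by (simp add: power2_eq_square field_simps)
    have \<omega>0: "\<omega> \<noteq> 0" "\<bar>\<omega>\<bar> > 0"
  proof -
    have "0 < 1 / B" using B by simp
    then have "0 < \<bar>\<omega>\<bar>" using \<omega>(1) by linarith
    then show "\<omega> \<noteq> 0" "\<bar>\<omega>\<bar> > 0" by auto
  qed
    have \<omega>r: "2 * pi * \<bar>\<omega>\<bar> * r \<le> 1"
    proof -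
      have "2 * pi * \<bar>\<omega>\<bar> * r \<le> 2 * pi * B * r"
        using \<omega>(2) r(1) by (intro mult_right_mono mult_left_mono) auto
      also have "\<dots> \<le> 1" using rB B by (simp add: field_simps)
      finally show ?thesis .
    qed
    let ?D = "2 * T + 4 + (1 + real J * r) / \<delta> * (4 * pi * \<bar>\<omega>\<bar> * r)"
    have T0: "T \<ge> 0" unfolding T_def using \<beta>(1) \<delta>(1) r(1) by simp
    have D0: "?D \<ge> 0"
      using T0 \<delta>(1) r(1) by (intro add_nonneg_nonneg mult_nonneg_nonneg divide_nonneg_nonneg) auto
    have "(1 + real J * r) / \<delta> * (4 * pi * \<bar>\<omega>\<bar> * r) \<le> (1 / r) / \<delta> * (4 * pi * B * r)"
      using Jr \<omega>(2) r(1) \<delta>(1) by (intro mult_mono divide_right_mono) auto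
    also have "\<dots> = 4 * pi * B / \<delta>" using r(1) by simp
    finally have D: "?D \<le> 2 * T + (4 + 4 * pi * B / \<delta>)" by simp
    have inv\<omega>: "1 / (pi * \<bar>\<omega>\<bar> * r) \<le> B / r"
    proof -
      have "1 \<le> B * \<bar>\<omega>\<bar>" using \<omega>(1) B by (simp add: divide_le_eq mult.commute)
      also have "\<dots> \<le> pi * (B * \<bar>\<omega>\<bar>)"
        using pi_gt3 mult_right_mono[of 1 pi "B * \<bar>\<omega>\<bar>"] B by simp
      finally show ?thesis using \<omega>0 r(1) by (simp add: field_simps)
    qed
    have invJ: "1 / real J \<le> 12 * r\<^sup>2"
      using J(2) J0 r(1) by (simp add: field_simps)
    have "measure \<sigma> {\<omega> - r..\<omega> + r} \<le> (2 * (?D / (pi * \<bar>\<omega>\<bar> * r)) / real J)\<^sup>2"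
      using r(1) Jrr \<omega>0 \<omega>r T J1 by (intro spectral_measure_le[OF subst \<delta> s1 inv \<sigma>]) auto
    also have "\<dots> \<le> (C2 * r powr \<kappa>)\<^sup>2"
    proof (rule power_mono)
      have "2 * (?D / (pi * \<bar>\<omega>\<bar> * r)) / real J = 2 * ?D * (1 / (pi * \<bar>\<omega>\<bar> * r)) * (1 / real J)"
        by simp
      also have "\<dots> \<le> 2 * ?D * (B / r) * (12 * r\<^sup>2)"
        using inv\<omega> invJ D0 B r(1) by (intro mult_mono mult_left_mono) auto
      also have "\<dots> = 24 * B * (r * ?D)"
        using r(1) by (simp add: power2_eq_square)
      also have "\<dots> \<le> 24 * B * (r * (2 * T + (4 + 4 * pi * B / \<delta>)))"
        using D r(1) B by (intro mult_left_mono) auto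
      also have "r * (2 * T + (4 + 4 * pi * B / \<delta>)) = 2 * (r * T) + r * (4 + 4 * pi * B / \<delta>)"
        by (simp add: algebra_simps)
      also have "24 * B * (2 * (r * T) + r * (4 + 4 * pi * B / \<delta>)) \<le>
          24 * B * (2 * (C1 * r powr \<kappa>) + r powr \<kappa> * (4 + 4 * pi * B / \<delta>))"
        using rT rk B \<delta>(1) by (intro mult_left_mono add_mono mult_right_mono) auto
      also have "\<dots> = C2 * r powr \<kappa>" by (simp add: C2_def algebra_simps)
      finally show "2 * (?D / (pi * \<bar>\<omega>\<bar> * r)) / real J \<le> C2 * r powr \<kappa>" .
      show "0 \<le> 2 * (?D / (pi * \<bar>\<omega>\<bar> * r)) / real J"
        using D0 r(1) by (intro divide_nonneg_nonneg mult_nonneg_nonneg) auto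
    qed
    also have "\<dots> = C2\<^sup>2 * r powr (2 * \<kappa>)"
      by (simp add: power_mult_distrib power2_eq_square flip: powr_add)
    finally show ?thesis .
  qed
  have "C2\<^sup>2 > 0" using C2 by simp
  then show ?thesis
    using r0 main by blast
qed

section \<open>Choice of the exponent and conclusion\<close>

theorem theorem4p1:
  fixes m :: nat and \<zeta> :: "nat \<Rightarrow> nat list" and \<theta> :: "complex list"
  assumes "m \<ge> 2"
    and "substitution m \<zeta>"
    and "primitive_subst m \<zeta>"
    and "aperiodic_subst m \<zeta>"
    and "irreducible (char_poly (map_mat rat_of_int (subst_matrix m \<zeta>)))"
    and "ordered_eigenvalues (map_mat complex_of_int (subst_matrix m \<zeta>)) \<theta>"
    and "cmod (\<theta> ! 1) > 1"
  shows "\<exists>\<gamma>>0. AE s in simplex_lebesgue m. \<forall>B>1. \<exists>r\<^sub>0>0. \<exists>C>0.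
    \<forall>\<mu> a \<sigma>. invariant_prob m \<zeta> s \<mu> \<and> a < m \<and>
      is_spectral_measure \<mu> (susp_flow s) (indicator (susp_cylinder m \<zeta> s a)) \<sigma> \<longrightarrow>
      (\<forall>\<omega> r. 1 / B \<le> \<bar>\<omega>\<bar> \<and> \<bar>\<omega>\<bar> \<le> B \<and> 0 < r \<and> r \<le> r\<^sub>0 \<longrightarrow>
        measure \<sigma> {\<omega> - r..\<omega> + r} \<le> C * r powr \<gamma>)"
proof -
  have m: "m > 0" using assms(1) by simp
  obtain v P where v: "v \<noteq> []" "set v \<subseteq> {..<m}" and P: "P \<ge> 1"
    and gain: "\<And>\<rho>. 0 < \<rho> \<Longrightarrow> \<rho> \<le> 1 / 2 \<Longrightarrow> \<exists>q. 0 < q \<and> q < 1 \<and> (\<forall>\<omega> s a k.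
       sup_ratio m \<zeta> \<omega> s a (k + P) ^ P \<le> q ^ card {n. n < k \<and>
         \<rho> \<le> \<bar>\<omega> * weight s (iter \<zeta> n v) - of_int (round (\<omega> * weight s (iter \<zeta> n v)))\<bar>})"
    using sup_ratio_power_le[OF assms(2,1,3)] by blast
  let ?S = "subst_matrix m \<zeta>"
  \<comment> \<open>Letter counts of the inflated return word; weighted by \<open>s\<close> they
    give the delay between the two copies of the inflated first letter.\<close>
  define p where "p = (\<lambda>n b. int (count_list (iter \<zeta> n v) b))"
  have S: "?S \<in> carrier_mat m m" by (simp add: subst_matrix_def)
  have p: "p (Suc n) b = (\<Sum>d<m. ?S $$ (b, d) * p n d)" if "b < m" for n b
    unfolding p_def by (rule count_list_iter_Suc[OF assms(2) v(2) that])
  have p0: "hd v < m" "p 0 (hd v) \<noteq> 0"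
    using v by (auto simp: p_def count_list_0_iff intro: hd_in_set)
  have \<theta>: "char_poly (map_mat complex_of_int ?S) = (\<Prod>e\<leftarrow>\<theta>. [:- e, 1:])"
    and sorted: "sorted_wrt (\<lambda>x y. cmod x \<ge> cmod y) \<theta>"
    using assms(6) by (auto simp: ordered_eigenvalues_def)
  obtain \<theta>1 \<theta>2 \<theta>' where \<theta>': "\<theta> = \<theta>1 # \<theta>2 # \<theta>'" and neq: "\<theta>1 \<noteq> \<theta>2"
    and root: "poly (char_poly (map_mat of_int ?S)) \<theta>1 = 0" "poly (char_poly (map_mat of_int ?S)) \<theta>2 = 0"
    by (rule distinct_roots_of_irreducible[OF S assms(1,5) \<theta>])
  obtain q1 q2 L1 L2 where
    L1: "\<And>n b. b < m \<Longrightarrow> (\<Sum>j<m. q1 j * of_int (p (n + j) b)) = \<theta>1 ^ n * L1 b" and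
    L2: "\<And>n b. b < m \<Longrightarrow> (\<Sum>j<m. q2 j * of_int (p (n + j) b)) = \<theta>2 ^ n * L2 b" and
    minor: "\<exists>b<m. \<exists>d<m. L1 b * L2 d \<noteq> L1 d * L2 b"
    by (rule eigenfunctionals_of_irreducible[OF S p assms(5) p0 root neq], assumption) (rule that)
  obtain b1 b2 where b12: "b1 < m" "b2 < m" "L1 b1 * L2 b2 \<noteq> L1 b2 * L2 b1"
    using minor by blast
  interpret integer_recurrence m p "coeff (char_poly ?S)" q1 q2 L1 L2 \<theta>1 \<theta>2 b1 b2
  proof
    show "(\<Sum>i\<le>m. coeff (char_poly ?S) i * p (n + i) b) = 0" if "b < m" for n b
    proof -
      have "poly_shift (char_poly ?S) (\<lambda>n. p n b) n = 0"
        using p that by (intro poly_shift_char_poly[OF S]) auto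
      then show ?thesis using degree_monic_char_poly[OF S] by (simp add: poly_shift_def)
    qed
    show "coeff (char_poly ?S) m = 1" using degree_monic_char_poly[OF S] by simp
    show "cmod \<theta>2 > 1" using assms(7) by (simp add: \<theta>')
    show "cmod \<theta>2 \<le> cmod \<theta>1" using sorted by (simp add: \<theta>')
  qed (fact m L1 L2 b12)+
  have X: "X s n = weight s (iter \<zeta> n v)" for s n
    unfolding X_def unfolding p_def
    using weight_eq_sum_count[OF assms(2) iter_letters[OF assms(2) v(2)], of s n] by simp
  obtain \<rho> \<delta> :: real where \<rho>: "0 < \<rho>" "\<rho> \<le> 1 / 2" and \<delta>: "0 < \<delta>"
    and AE: "AE s in simplex_lebesgue m. \<forall>B>1. \<exists>N0. \<forall>N\<ge>N0. \<forall>\<omega>. 1 / B \<le> \<bar>\<omega>\<bar> \<and> \<bar>\<omega>\<bar> \<le> B \<longrightarrow>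
       \<delta> * real N \<le> real (card {n. n < N + m \<and> \<rho> \<le> \<bar>\<omega> * X s n - of_int (round (\<omega> * X s n))\<bar>})"
    using erdos_kahane by blast
  obtain q where q: "0 < q" "q < 1" and dec: "\<And>\<omega> s a k.
       sup_ratio m \<zeta> \<omega> s a (k + P) ^ P \<le> q ^ card {n. n < k \<and> \<rho> \<le> \<bar>\<omega> * X s n - of_int (round (\<omega> * X s n))\<bar>}"
    using gain[OF \<rho>] unfolding X by blast
  \<comment> \<open>At least \<open>\<delta> * N\<close> gains by the factor \<open>q\<close>, after
    a \<open>P\<close>-th root, amount to \<open>\<beta> ^ N\<close>.\<close>
  define \<beta> where "\<beta> = q powr (\<delta> / real P)"
  have \<beta>: "0 < \<beta>" "\<beta> < 1"
  proof -
    show "0 < \<beta>" using q by (simp add: \<beta>_def)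
    have "\<delta> / real P * ln q < 0"
      using q \<delta> P by (intro mult_pos_neg divide_pos_pos) auto
    then show "\<beta> < 1" using q by (simp add: \<beta>_def powr_def)
  qed
  define \<Lambda> where "\<Lambda> = (\<Sum>b<m. length (\<zeta> b)) + 2"
  have \<Lambda>: "length (\<zeta> b) \<le> \<Lambda>" if "b < m" for b
  proof -
    have "length (\<zeta> b) \<le> (\<Sum>b<m. length (\<zeta> b))" using that by (intro member_le_sum) auto
    then show ?thesis by (simp add: \<Lambda>_def)
  qed
  have \<Lambda>2: "\<Lambda> \<ge> 2" by (simp add: \<Lambda>_def)
  \<comment> \<open>The largest exponent, capped at 1/2, with
    \<open>\<beta> \<le> \<Lambda> powr (- (2 * \<kappa>))\<close>. Its ingredients
    \<open>q\<close>, \<delta>, \<open>P\<close> and \<Lambda> are fixed before \<open>s\<close> and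
    \<open>B\<close>, so the exponent \<open>2 * \<kappa>\<close> depends on the substitution
    only.\<close>
  define \<kappa> where "\<kappa> = min (1 / 2) (- ln \<beta> / (2 * ln (real \<Lambda>)))"
  have ln\<Lambda>: "ln (real \<Lambda>) > 0" using \<Lambda>2 by simp
  have \<kappa>0: "0 < \<kappa>" using \<beta> ln\<Lambda> by (simp add: \<kappa>_def divide_neg_pos)
  have \<beta>\<Lambda>: "\<beta> \<le> real \<Lambda> powr (- (2 * \<kappa>))"
  proof -
    have "\<kappa> \<le> - ln \<beta> / (2 * ln (real \<Lambda>))" by (simp add: \<kappa>_def)
    then have "\<kappa> * (2 * ln (real \<Lambda>)) \<le> - ln \<beta>"
      using ln\<Lambda> by (subst (asm) pos_le_divide_eq) simp_all
    moreover have "- (2 * \<kappa>) * ln (real \<Lambda>) = - (\<kappa> * (2 * ln (real \<Lambda>)))" by simp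
    ultimately have "ln \<beta> \<le> - (2 * \<kappa>) * ln (real \<Lambda>)" by linarith
    then have "exp (ln \<beta>) \<le> exp (- (2 * \<kappa>) * ln (real \<Lambda>))" by (simp only: exp_le_cancel_iff)
    then show ?thesis using \<beta> \<Lambda>2 by (simp add: powr_def)
  qed
  have "AE s in simplex_lebesgue m. \<forall>B>1. \<exists>r\<^sub>0>0. \<exists>C>0.
    \<forall>\<mu> a \<sigma>. invariant_prob m \<zeta> s \<mu> \<and> a < m \<and>
      is_spectral_measure \<mu> (susp_flow s) (indicator (susp_cylinder m \<zeta> s a)) \<sigma> \<longrightarrow>
      (\<forall>\<omega> r. 1 / B \<le> \<bar>\<omega>\<bar> \<and> \<bar>\<omega>\<bar> \<le> B \<and> 0 < r \<and> r \<le> r\<^sub>0 \<longrightarrow>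
        measure \<sigma> {\<omega> - r..\<omega> + r} \<le> C * r powr (2 * \<kappa>))"
    using AE AE_space
  proof eventually_elim
    fix s
    assume far: "\<forall>B>1. \<exists>N0. \<forall>N\<ge>N0. \<forall>\<omega>. 1 / B \<le> \<bar>\<omega>\<bar> \<and> \<bar>\<omega>\<bar> \<le> B \<longrightarrow>
       \<delta> * real N \<le> real (card {n. n < N + m \<and> \<rho> \<le> \<bar>\<omega> * X s n - of_int (round (\<omega> * X s n))\<bar>})"
      and sM: "s \<in> space (simplex_lebesgue m)"
    have s: "s \<in> open_simplex m" using sM space_simplex_lebesgue[OF m_Suc] by simp
    show "\<forall>B>1. \<exists>r\<^sub>0>0. \<exists>C>0. \<forall>\<mu> a \<sigma>. invariant_prob m \<zeta> s \<mu> \<and> a < m \<and>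
      is_spectral_measure \<mu> (susp_flow s) (indicator (susp_cylinder m \<zeta> s a)) \<sigma> \<longrightarrow>
      (\<forall>\<omega> r. 1 / B \<le> \<bar>\<omega>\<bar> \<and> \<bar>\<omega>\<bar> \<le> B \<and> 0 < r \<and> r \<le> r\<^sub>0 \<longrightarrow>
        measure \<sigma> {\<omega> - r..\<omega> + r} \<le> C * r powr (2 * \<kappa>))"
    proof (intro allI impI)
      fix B :: real assume B: "B > 1"
      obtain N0 where N0: "\<And>N \<omega>. N \<ge> N0 \<Longrightarrow> 1 / B \<le> \<bar>\<omega>\<bar> \<Longrightarrow> \<bar>\<omega>\<bar> \<le> B \<Longrightarrow>
          \<delta> * real N \<le> real (card {n. n < N + m \<and> \<rho> \<le> \<bar>\<omega> * X s n - of_int (round (\<omega> * X s n))\<bar>})"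
        using far B by blast
      \<comment> \<open>Far indices are counted up to \<open>N + m\<close> and each gain takes
        effect \<open>P\<close> levels later, hence the offset \<open>m + P\<close>.\<close>
      have "sup_ratio m \<zeta> \<omega> s a (N + (m + P)) \<le> \<beta> ^ N"
        if N: "N \<ge> N0" and \<omega>: "1 / B \<le> \<bar>\<omega>\<bar>" "\<bar>\<omega>\<bar> \<le> B" for N \<omega> a
      proof (rule power_le_imp_le_base[of _ "P - 1"])
        let ?c = "card {n. n < N + m \<and> \<rho> \<le> \<bar>\<omega> * X s n - of_int (round (\<omega> * X s n))\<bar>}"
        have "sup_ratio m \<zeta> \<omega> s a (N + (m + P)) ^ P \<le> q ^ ?c"
          using dec[of \<omega> s a "N + m"] by (simp add: add.assoc)
        also have "\<dots> = q powr real ?c" using q by (simp add: powr_realpow)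
        also have "\<dots> \<le> q powr (\<delta> * real N)"
          using N0[OF N \<omega>] q by (intro powr_mono') auto
        also have "\<dots> = (\<beta> ^ N) ^ P"
        proof -
          have "(\<beta> ^ N) ^ P = \<beta> powr (real N * real P)"
            using \<beta>(1) by (simp add: powr_realpow[symmetric] powr_powr)
          also have "\<dots> = q powr (\<delta> * real N)"
            using P by (simp add: \<beta>_def powr_powr)
          finally show ?thesis by simp
        qed
        finally show "sup_ratio m \<zeta> \<omega> s a (N + (m + P)) ^ Suc (P - 1) \<le> (\<beta> ^ N) ^ Suc (P - 1)"
          using P by simp
        show "0 \<le> \<beta> ^ N" using \<beta>(1) by simp
      qed
      then show "\<exists>r\<^sub>0>0. \<exists>C>0. \<forall>\<mu> a \<sigma>. invariant_prob m \<zeta> s \<mu> \<and> a < m \<and>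
        is_spectral_measure \<mu> (susp_flow s) (indicator (susp_cylinder m \<zeta> s a)) \<sigma> \<longrightarrow>
        (\<forall>\<omega> r. 1 / B \<le> \<bar>\<omega>\<bar> \<and> \<bar>\<omega>\<bar> \<le> B \<and> 0 < r \<and> r \<le> r\<^sub>0 \<longrightarrow>
          measure \<sigma> {\<omega> - r..\<omega> + r} \<le> C * r powr (2 * \<kappa>))"
        by (intro spectral_measure_powr_le[OF assms(2) s m B \<Lambda> \<Lambda>2 \<beta>(1) \<beta>\<Lambda> \<kappa>0]) (auto simp: \<kappa>_def)
    qed
  qed
  then show ?thesis using \<kappa>0 by (intro exI[of _ "2 * \<kappa>"]) simp
qed

end
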